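(* Let $R$ be a commutative ring with unit and let $\mathscr{G}$ be an ample groupoid. Then the following are equivalent, both when "noetherian" is read throughout and when "artinian" is read throughout: (1) $R\mathscr{G}$ is categorically noetherian (respectively, categorically artinian). (2) $R\mathscr{G}$ is locally noetherian (respectively, locally artinian). (3) $\mathscr{G}$ is discrete and the group ring $R\mathscr{G}_x^x$ is noetherian (respectively, artinian) for all isotropy groups $\mathscr{G}_x^x$. (4) $R\mathscr{G}\cong\bigoplus_{\alpha\in J}M_{\mathscr{O}_\alpha}(R\mathscr{G}_{x_\alpha}^{x_\alpha})$, where $x_\alpha$, $\alpha\in J$, represent the orbits, $\mathscr{O}_\alpha$ is the orbit of $x_\alpha$, $\mathscr{G}_{x_\alpha}^{x_\alpha}$ is the isotropy group at $x_\alpha$, and the group rings $R\mathscr{G}_{x_\alpha}^{x_\alpha}$ are noetherian (respectively, artinian). In the case where the $R\mathscr{G}_{x_\alpha}^{x_\alpha}$ are artinian, the isotropy groups are finite and $R$ is artinian.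
   Context: Groupoids. A groupoid $\mathscr{G}$ is a small category in which every arrow is invertible, identified with its set of arrows; $\mathscr{G}^{(0)}$ is its set of units, $d(g)=g^{-1}g$, $r(g)=gg^{-1}$. A topological groupoid has a topology making multiplication and inversion continuous, with $\mathscr{G}^{(0)}$ carrying the subspace topology. All topological groupoids are locally compact with locally compact Hausdorff unit space ($\mathscr{G}$ itself need not be Hausdorff). It is etale if $d,r:\mathscr{G}\to\mathscr{G}^{(0)}$ are local homeomorphisms. An open bisection is an open $U\subseteq\mathscr{G}$ such that $d|_U$ and $r|_U$ are injective (hence homeomorphisms onto open subsets of $\mathscr{G}^{(0)}$). An ample groupoid is an etale groupoid with Hausdorff unit space and a basis of compact open bisections. The isotropy group at $x\in\mathscr{G}^{(0)}$ is $\mathscr{G}_x^x=\{g: d(g)=x=r(g)\}$; the orbit of $x$ is the set of $y\in\mathscr{G}^{(0)}$ for which there is an arrow $g$ with $d(g)=x$, $r(g)=y$. The $x_\alpha$, $\alpha\in J$, form a set of orbit representatives, one for each orbit. Groupoid algebra. $R\mathscr{G}$ is the $R$-submodule of $R^{\mathscr{G}}$ spanned by the characteristic functions $\chi_U$ of compact open bisections $U$, with the convolution product $(f_1*f_2)(g)=\sum_{d(h)=d(g)}f_1(gh^{-1})f_2(h)$. It is a ring with local units (a set of local units of a ring $A$ is a set $E$ of idempotents such that for every finite subset $x_1,\dots,x_n$ of $A$ there is $e\in E$ with $ex_i=x_ie=x_i$ for all $i$). $R\mathscr{G}_x^x$ is the group ring of $\mathscr{G}_x^x$ over $R$. Chain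 conditions. Left (right) modules $M$ over a ring $A$ are unitary: $AM=M$ ($MA=M$). A ring $A$ with local units is categorically left (right) noetherian/artinian if every finitely generated left (right) $A$-module is noetherian/artinian; it is locally left (right) noetherian/artinian if $eAe$ is a left (right) noetherian/artinian ring for every idempotent $e\in A$. Because $R\mathscr{G}$ and group rings over $R$ have involutions, left and right versions are equivalent, and the adjectives are omitted. Matrices. For a set $X$ and a ring $S$, $M_X(S)$ is the ring of $X\times X$ matrices over $S$ with only finitely many nonzero entries. *)

theory Defs
  imports
    "HOL-Algebra.Module"
    "HOL-Algebra.AbelCoset"
    "HOL-Analysis.Abstract_Topological_Spaces"
begin

section \<open>Rings without unit and their modules\<close>

text \<open>Rings that need not have a unit are represented by the record \<open>ring\<close> of HOL-Algebra
  with the field \<open>one\<close> ignored (and left \<open>undefined\<close> in the constructions below).\<close>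

locale nonunital_ring = abelian_group A for A (structure) +
  assumes m_closed: "\<lbrakk>a \<in> carrier A; b \<in> carrier A\<rbrakk> \<Longrightarrow> a \<otimes> b \<in> carrier A"
    and m_assoc: "\<lbrakk>a \<in> carrier A; b \<in> carrier A; c \<in> carrier A\<rbrakk> \<Longrightarrow> (a \<otimes> b) \<otimes> c = a \<otimes> (b \<otimes> c)"
    and l_distr: "\<lbrakk>a \<in> carrier A; b \<in> carrier A; c \<in> carrier A\<rbrakk> \<Longrightarrow> (a \<oplus> b) \<otimes> c = a \<otimes> c \<oplus> b \<otimes> c"
    and r_distr: "\<lbrakk>a \<in> carrier A; b \<in> carrier A; c \<in> carrier A\<rbrakk> \<Longrightarrow> c \<otimes> (a \<oplus> b) = c \<otimes> a \<oplus> c \<otimes> b"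

definition rng_isomorphic :: "('a, 'm) ring_scheme \<Rightarrow> ('b, 'n) ring_scheme \<Rightarrow> bool"
  where "rng_isomorphic A B \<longleftrightarrow>
    (\<exists>h. bij_betw h (carrier A) (carrier B) \<and>
      (\<forall>a\<in>carrier A. \<forall>b\<in>carrier A.
        h (a \<oplus>\<^bsub>A\<^esub> b) = h a \<oplus>\<^bsub>B\<^esub> h b \<and> h (a \<otimes>\<^bsub>A\<^esub> b) = h a \<otimes>\<^bsub>B\<^esub> h b))"

definition opposite_ring :: "('a, 'm) ring_scheme \<Rightarrow> ('a, 'm) ring_scheme"
  where "opposite_ring A = A\<lparr>mult := \<lambda>a b. b \<otimes>\<^bsub>A\<^esub> a\<rparr>"

locale left_module = A?: nonunital_ring A + M?: abelian_group M
  for A :: "('a, 'm) ring_scheme" and M :: "('a, 'b, 'n) module_scheme" (structure) +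
  assumes smult_closed: "\<lbrakk>a \<in> carrier A; x \<in> carrier M\<rbrakk> \<Longrightarrow> a \<odot> x \<in> carrier M"
    and smult_l_distr: "\<lbrakk>a \<in> carrier A; b \<in> carrier A; x \<in> carrier M\<rbrakk> \<Longrightarrow>
      (a \<oplus>\<^bsub>A\<^esub> b) \<odot> x = a \<odot> x \<oplus> b \<odot> x"
    and smult_r_distr: "\<lbrakk>a \<in> carrier A; x \<in> carrier M; y \<in> carrier M\<rbrakk> \<Longrightarrow>
      a \<odot> (x \<oplus> y) = a \<odot> x \<oplus> a \<odot> y"
    and smult_assoc: "\<lbrakk>a \<in> carrier A; b \<in> carrier A; x \<in> carrier M\<rbrakk> \<Longrightarrow>
      (a \<otimes>\<^bsub>A\<^esub> b) \<odot> x = a \<odot> (b \<odot> x)"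

text \<open>\<open>AM\<close> is the additive subgroup generated by the products \<open>a \<odot> x\<close>.\<close>

definition unitary_left_module :: "('a, 'm) ring_scheme \<Rightarrow> ('a, 'b, 'n) module_scheme \<Rightarrow> bool"
  where "unitary_left_module A M \<longleftrightarrow> left_module A M \<and>
    (\<lambda>N. additive_subgroup N M) hull {a \<odot>\<^bsub>M\<^esub> x | a x. a \<in> carrier A \<and> x \<in> carrier M} = carrier M"

text \<open>The library locale \<open>submodule\<close> requires neither a unit nor commutativity of its ring.\<close>

definition finitely_generated_module :: "('a, 'm) ring_scheme \<Rightarrow> ('a, 'b, 'n) module_scheme \<Rightarrow> bool"
  where "finitely_generated_module A M \<longleftrightarrow>
    (\<exists>S. finite S \<and> S \<subseteq> carrier M \<and> (\<lambda>N. submodule N A M) hull S = carrier M)"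

definition left_ideal :: "'a set \<Rightarrow> ('a, 'm) ring_scheme \<Rightarrow> bool"
  where "left_ideal I A \<longleftrightarrow> additive_subgroup I A \<and> (\<forall>a\<in>carrier A. \<forall>x\<in>I. a \<otimes>\<^bsub>A\<^esub> x \<in> I)"


section \<open>Chain conditions\<close>

datatype chain_condition = Noetherian | Artinian

datatype side = LeftSided | RightSided

primrec satisfies_chain :: "chain_condition \<Rightarrow> 'a set set \<Rightarrow> bool"
  where
    "satisfies_chain Noetherian L \<longleftrightarrow>
      (\<forall>N :: nat \<Rightarrow> 'a set. range N \<subseteq> L \<and> incseq N \<longrightarrow> (\<exists>n. \<forall>m\<ge>n. N m = N n))"
  | "satisfies_chain Artinian L \<longleftrightarrow>
      (\<forall>N :: nat \<Rightarrow> 'a set. range N \<subseteq> L \<and> decseq N \<longrightarrow> (\<exists>n. \<forall>m\<ge>n. N m = N n))"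

definition chain_module ::
    "chain_condition \<Rightarrow> ('a, 'm) ring_scheme \<Rightarrow> ('a, 'b, 'n) module_scheme \<Rightarrow> bool"
  where "chain_module c A M \<longleftrightarrow> satisfies_chain c {N. submodule N A M}"

text \<open>Right modules and right ideals over \<open>A\<close> are left modules and left ideals over the opposite
  ring of \<open>A\<close>.\<close>

primrec sided :: "side \<Rightarrow> ('a, 'm) ring_scheme \<Rightarrow> ('a, 'm) ring_scheme"
  where
    "sided LeftSided A = A"
  | "sided RightSided A = opposite_ring A"

definition chain_ring :: "chain_condition \<Rightarrow> side \<Rightarrow> ('a, 'm) ring_scheme \<Rightarrow> bool"
  where "chain_ring c s B \<longleftrightarrow> satisfies_chain c {I. left_ideal I (sided s B)}"

definition corner_ring :: "('a, 'm) ring_scheme \<Rightarrow> 'a \<Rightarrow> ('a, 'm) ring_scheme"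
  where "corner_ring A e = A\<lparr>carrier := {e \<otimes>\<^bsub>A\<^esub> a \<otimes>\<^bsub>A\<^esub> e | a. a \<in> carrier A}, one := e\<rparr>"

definition locally_chain :: "chain_condition \<Rightarrow> side \<Rightarrow> ('a, 'm) ring_scheme \<Rightarrow> bool"
  where "locally_chain c s A \<longleftrightarrow>
    (\<forall>e\<in>carrier A. e \<otimes>\<^bsub>A\<^esub> e = e \<longrightarrow> chain_ring c s (corner_ring A e))"

text \<open>The quantifier over modules has to range over a fixed carrier type. The type
  \<open>(nat \<Rightarrow> 'a) set\<close> holds all quotients of the powers \<open>A\<^sup>n\<close>, hence a copy of every
  finitely generated unitary module; the lemma \<open>categorically_chainD\<close> below shows that nothing is
  lost: the condition carries over to modules over arbitrary carrier types.\<close>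

definition categorically_chain :: "chain_condition \<Rightarrow> side \<Rightarrow> ('a, 'm) ring_scheme \<Rightarrow> bool"
  where "categorically_chain c s A \<longleftrightarrow>
    (\<forall>M :: ('a, (nat \<Rightarrow> 'a) set) module.
      unitary_left_module (sided s A) M \<and> finitely_generated_module (sided s A) M
        \<longrightarrow> chain_module c (sided s A) M)"

context left_module
begin

lemma additive_subgroup_iff:
  "additive_subgroup H M \<longleftrightarrow> H \<subseteq> carrier M \<and> \<zero> \<in> H \<and> (\<forall>x\<in>H. \<forall>y\<in>H. x \<oplus> y \<in> H) \<and> (\<forall>x\<in>H. \<ominus> x \<in> H)"
proof
  assume "additive_subgroup H M"
  then interpret H: additive_subgroup H M .
  show "H \<subseteq> carrier M \<and> \<zero> \<in> H \<and> (\<forall>x\<in>H. \<forall>y\<in>H. x \<oplus> y \<in> H) \<and> (\<forall>x\<in>H. \<ominus> x \<in> H)"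
    using H.a_subset H.zero_closed H.a_closed H.a_subgroup
    by (auto simp: a_inv_def dest: subgroup.m_inv_closed)
next
  assume "H \<subseteq> carrier M \<and> \<zero> \<in> H \<and> (\<forall>x\<in>H. \<forall>y\<in>H. x \<oplus> y \<in> H) \<and> (\<forall>x\<in>H. \<ominus> x \<in> H)"
  then show "additive_subgroup H M"
    by (auto intro!: additive_subgroupI group.subgroupI[OF M.a_group] simp: a_inv_def)
qed

lemma submodule_iff:
  "submodule H A M \<longleftrightarrow> additive_subgroup H M \<and> (\<forall>a\<in>carrier A. \<forall>x\<in>H. a \<odot> x \<in> H)"
  by (auto simp: submodule_def submodule_axioms_def additive_subgroup_def)

lemma smult_zero_left: "x \<in> carrier M \<Longrightarrow> \<zero>\<^bsub>A\<^esub> \<odot> x = \<zero>"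
  using smult_l_distr[of "\<zero>\<^bsub>A\<^esub>" "\<zero>\<^bsub>A\<^esub>" x] smult_closed[of "\<zero>\<^bsub>A\<^esub>" x]
  by (metis A.zero_closed A.r_zero M.r_zero M.zero_closed M.add.l_cancel_one)

lemma smult_zero_right: "a \<in> carrier A \<Longrightarrow> a \<odot> \<zero> = \<zero>"
  using smult_r_distr[of a \<zero> \<zero>] smult_closed[of a \<zero>]
  by (metis M.r_zero M.zero_closed M.add.l_cancel_one)

lemma smult_minus_left: "a \<in> carrier A \<Longrightarrow> x \<in> carrier M \<Longrightarrow> (\<ominus>\<^bsub>A\<^esub> a) \<odot> x = \<ominus> (a \<odot> x)"
  using smult_l_distr[of "\<ominus>\<^bsub>A\<^esub> a" a x] smult_zero_left[of x] smult_closed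
  by (metis A.a_inv_closed A.l_neg M.minus_equality)

lemma smult_minus_right: "a \<in> carrier A \<Longrightarrow> x \<in> carrier M \<Longrightarrow> a \<odot> (\<ominus> x) = \<ominus> (a \<odot> x)"
  using smult_r_distr[of a "\<ominus> x" x] smult_zero_right[of a] smult_closed
  by (metis M.a_inv_closed M.l_neg M.minus_equality)

lemma unitary_finitely_generated_combinations:
  assumes un: "unitary_left_module A M" and fg: "finitely_generated_module A M"
  obtains n :: nat and v where "v \<in> {..<n} \<rightarrow> carrier M"
    "carrier M = {\<Oplus>i\<in>{..<n}. a i \<odot> v i | a. a \<in> {..<n} \<rightarrow> carrier A}"
proof -
  obtain S where S: "finite S" "S \<subseteq> carrier M" "(\<lambda>N. submodule N A M) hull S = carrier M"
    using fg by (auto simp: finitely_generated_module_def)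
  obtain v and n :: nat where v: "S = v ` {..<n}"
    using finite_imp_nat_seg_image_inj_on[OF S(1)] by (metis lessThan_def)
  have vM [simp, intro]: "v i \<in> carrier M" if "i < n" for i
    using that S(2) v by auto
  define c where "c = (\<lambda>a. \<Oplus>i\<in>{..<n}. a i \<odot> v i)"
  define W where "W = {c a | a. a \<in> {..<n} \<rightarrow> carrier A}"
  have trm: "(\<lambda>i. a i \<odot> v i) \<in> {..<n} \<rightarrow> carrier M" if "a \<in> {..<n} \<rightarrow> carrier A" for a
    using that by (auto intro!: smult_closed)
  have c_closed: "c a \<in> carrier M" if "a \<in> {..<n} \<rightarrow> carrier A" for a
    using M.finsum_closed[OF trm[OF that]] by (simp add: c_def)
  have c_add: "c a \<oplus> c b = c (\<lambda>i. a i \<oplus>\<^bsub>A\<^esub> b i)"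
    if "a \<in> {..<n} \<rightarrow> carrier A" "b \<in> {..<n} \<rightarrow> carrier A" for a b
  proof -
    have "c a \<oplus> c b = (\<Oplus>i\<in>{..<n}. a i \<odot> v i \<oplus> b i \<odot> v i)"
      unfolding c_def using M.finsum_addf[OF trm[OF that(1)] trm[OF that(2)]] by simp
    also have "\<dots> = c (\<lambda>i. a i \<oplus>\<^bsub>A\<^esub> b i)"
      unfolding c_def using that
      by (intro M.finsum_cong') (auto simp: smult_l_distr Pi_iff intro!: smult_closed)
    finally show ?thesis .
  qed
  have c_zero: "c (\<lambda>i. \<zero>\<^bsub>A\<^esub>) = \<zero>"
    unfolding c_def using M.finsum_zero[of "{..<n}"]
    by (subst M.finsum_cong'[where g = "\<lambda>i. \<zero>"]) (auto simp: smult_zero_left)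
  have W_sub: "additive_subgroup W M"
    unfolding additive_subgroup_iff
  proof (intro conjI ballI)
    show "W \<subseteq> carrier M" using c_closed by (auto simp: W_def)
    show "\<zero> \<in> W" unfolding W_def using c_zero
      by (auto intro!: exI[of _ "\<lambda>i. \<zero>\<^bsub>A\<^esub>"])
    show "x \<oplus> y \<in> W" if "x \<in> W" "y \<in> W" for x y
    proof -
      obtain a b where "x = c a" "y = c b" "a \<in> {..<n} \<rightarrow> carrier A" "b \<in> {..<n} \<rightarrow> carrier A"
        using \<open>x \<in> W\<close> \<open>y \<in> W\<close> unfolding W_def by blast
      then show ?thesis unfolding W_def using c_add[of a b]
        by (auto intro!: exI[of _ "\<lambda>i. a i \<oplus>\<^bsub>A\<^esub> b i"])
    qed
    show "\<ominus> x \<in> W" if "x \<in> W" for x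
    proof -
      obtain a where a: "x = c a" "a \<in> {..<n} \<rightarrow> carrier A"
        using \<open>x \<in> W\<close> unfolding W_def by blast
      have b: "(\<lambda>i. \<ominus>\<^bsub>A\<^esub> a i) \<in> {..<n} \<rightarrow> carrier A" using a by auto
      have "c (\<lambda>i. \<ominus>\<^bsub>A\<^esub> a i) \<oplus> c a = c (\<lambda>i. \<ominus>\<^bsub>A\<^esub> a i \<oplus>\<^bsub>A\<^esub> a i)"
        by (rule c_add[OF b a(2)])
      also have "\<dots> = c (\<lambda>i. \<zero>\<^bsub>A\<^esub>)"
        unfolding c_def using a
        by (intro M.finsum_cong') (auto simp: A.l_neg Pi_iff intro!: smult_closed)
      finally have "\<ominus> x = c (\<lambda>i. \<ominus>\<^bsub>A\<^esub> a i)"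
        using c_zero a c_closed[OF b] c_closed[OF a(2)] by (metis M.minus_equality)
      then show ?thesis unfolding W_def using b by blast
    qed
  qed
  interpret W: additive_subgroup W M by (fact W_sub)
  have gen_W: "a \<odot> v i \<in> W" if "a \<in> carrier A" "i < n" for a i
  proof -
    have "c (\<lambda>j. if j = i then a else \<zero>\<^bsub>A\<^esub>) = (\<Oplus>j\<in>{..<n}. if i = j then a \<odot> v j else \<zero>)"
      unfolding c_def using that
      by (intro M.finsum_cong') (auto simp: smult_zero_left intro!: smult_closed)
    also have "\<dots> = a \<odot> v i"
      using that by (intro M.finsum_singleton) (auto intro!: smult_closed)
    finally show ?thesis unfolding W_def using that
      by (auto intro!: exI[of _ "\<lambda>j. if j = i then a else \<zero>\<^bsub>A\<^esub>"])
  qed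
  define K where "K = {x \<in> carrier M. \<forall>a\<in>carrier A. a \<odot> x \<in> W}"
  have "submodule K A M"
    unfolding submodule_iff additive_subgroup_iff
  proof (intro conjI ballI)
    show "\<zero> \<in> K" by (auto simp: K_def smult_zero_right)
    show "x \<oplus> y \<in> K" if "x \<in> K" "y \<in> K" for x y
      using that by (auto simp: K_def smult_r_distr W.a_closed)
    show "\<ominus> x \<in> K" if "x \<in> K" for x
      using that W_sub[unfolded additive_subgroup_iff] by (auto simp: K_def smult_minus_right)
    show "a \<odot> x \<in> K" if "a \<in> carrier A" "x \<in> K" for a x
      using that by (auto simp: K_def smult_closed smult_assoc[symmetric] A.m_closed)
  qed (auto simp: K_def)
  moreover have "S \<subseteq> K" using v gen_W by (auto simp: K_def)
  ultimately have "carrier M \<subseteq> K" using S(3) hull_minimal[of S K "\<lambda>N. submodule N A M"] by simp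
  then have "{a \<odot> x | a x. a \<in> carrier A \<and> x \<in> carrier M} \<subseteq> W" by (auto simp: K_def)
  from hull_minimal[OF this, of "\<lambda>N. additive_subgroup N M"] have "carrier M \<subseteq> W"
    using un W_sub unfolding unitary_left_module_def by simp
  then have "carrier M = W" using W.a_subset by auto
  then show thesis using that[of v n] vM by (auto simp: W_def c_def)
qed

lemma module_transport:
  fixes \<phi> :: "'b \<Rightarrow> 'c"
  assumes inj: "inj_on \<phi> (carrier M)"
    and un: "unitary_left_module A M" and fg: "finitely_generated_module A M"
  obtains N :: "('a, 'c) module" where
    "unitary_left_module A N" "finitely_generated_module A N"
    "chain_module k A N \<longrightarrow> chain_module k A M"
proof -
  define \<psi> where "\<psi> = inv_into (carrier M) \<phi>"
  have \<psi>\<phi> [simp]: "\<psi> (\<phi> x) = x" if "x \<in> carrier M" for x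
    using that inj by (simp add: \<psi>_def)
  define N :: "('a, 'c) module" where "N =
    \<lparr>carrier = \<phi> ` carrier M, mult = undefined, one = undefined, zero = \<phi> \<zero>,
     add = (\<lambda>X Y. \<phi> (\<psi> X \<oplus> \<psi> Y)), smult = (\<lambda>a X. \<phi> (a \<odot> \<psi> X))\<rparr>"
  have N_sel [simp]: "carrier N = \<phi> ` carrier M" "\<zero>\<^bsub>N\<^esub> = \<phi> \<zero>"
      "X \<oplus>\<^bsub>N\<^esub> Y = \<phi> (\<psi> X \<oplus> \<psi> Y)" "a \<odot>\<^bsub>N\<^esub> X = \<phi> (a \<odot> \<psi> X)" for X Y a
    by (simp_all add: N_def)
  have "abelian_group N"
  proof (rule abelian_groupI)
    show "\<exists>Y\<in>carrier N. Y \<oplus>\<^bsub>N\<^esub> X = \<zero>\<^bsub>N\<^esub>" if X: "X \<in> carrier N" for X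
      using X by (auto intro!: bexI[of _ "\<ominus> \<psi> X"] simp: M.l_neg)
  qed (auto simp: M.a_ac)
  then interpret N: abelian_group N .
  have "left_module A N"
    by unfold_locales (auto simp: smult_closed smult_l_distr smult_r_distr smult_assoc)
  then interpret N: left_module A N .
  have N_minus: "\<ominus>\<^bsub>N\<^esub> (\<phi> x) = \<phi> (\<ominus> x)" if "x \<in> carrier M" for x
    by (rule N.minus_equality) (use that in \<open>auto simp: M.l_neg\<close>)
  have add_pull: "additive_subgroup (\<psi> ` K) M" if "additive_subgroup K N" for K
  proof -
    have K: "K \<subseteq> \<phi> ` carrier M" "\<phi> \<zero> \<in> K" "\<And>X Y. X \<in> K \<Longrightarrow> Y \<in> K \<Longrightarrow> \<phi> (\<psi> X \<oplus> \<psi> Y) \<in> K"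
      "\<And>X. X \<in> K \<Longrightarrow> \<ominus>\<^bsub>N\<^esub> X \<in> K"
      using that by (auto simp: N.additive_subgroup_iff)
    have el: "\<psi> X \<in> carrier M" if "X \<in> K" for X using that K(1) by auto
    show ?thesis unfolding additive_subgroup_iff
    proof (intro conjI ballI)
      show "\<zero> \<in> \<psi> ` K" using K(2) by (metis M.zero_closed \<psi>\<phi> imageI)
      show "x \<oplus> y \<in> \<psi> ` K" if "x \<in> \<psi> ` K" "y \<in> \<psi> ` K" for x y
        using that K(3) el by (metis (no_types, lifting) M.a_closed \<psi>\<phi> image_iff)
      show "\<ominus> x \<in> \<psi> ` K" if "x \<in> \<psi> ` K" for x
      proof -
        obtain X where X: "X \<in> K" "x = \<psi> X" using \<open>x \<in> \<psi> ` K\<close> by auto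
        then obtain y where y: "X = \<phi> y" "y \<in> carrier M" using K(1) by auto
        have "\<phi> (\<ominus> x) \<in> K" using K(4)[OF X(1)] X y N_minus by simp
        then show ?thesis using X y by (metis M.a_inv_closed \<psi>\<phi> imageI)
      qed
    qed (use el in auto)
  qed
  have sub_pull: "submodule (\<psi> ` K) A M" if "submodule K A N" for K
  proof -
    have K: "additive_subgroup K N" "\<And>a X. a \<in> carrier A \<Longrightarrow> X \<in> K \<Longrightarrow> \<phi> (a \<odot> \<psi> X) \<in> K"
      using that by (auto simp: N.submodule_iff)
    have "\<psi> X \<in> carrier M" if "X \<in> K" for X
      using that K(1) by (auto simp: N.additive_subgroup_iff)
    then have "a \<odot> \<psi> X \<in> \<psi> ` K" if "a \<in> carrier A" "X \<in> K" for a X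
      using K(2)[OF that] that \<psi>\<phi>[of "a \<odot> \<psi> X"] smult_closed by (metis image_eqI)
    then show ?thesis unfolding submodule_iff using add_pull[OF K(1)] by blast
  qed
  have sub_push: "submodule (\<phi> ` H) A N" if "submodule H A M" for H
  proof -
    have "H \<subseteq> carrier M" using that by (auto simp: submodule_iff additive_subgroup_iff)
    then have [simp]: "x \<in> carrier M" if "x \<in> H" for x using that by auto
    show ?thesis
      using that by (auto simp: submodule_iff additive_subgroup_iff N.submodule_iff
          N.additive_subgroup_iff N_minus)
  qed
  have pull_all: "carrier N \<subseteq> K" if sub: "carrier M \<subseteq> \<psi> ` K" "K \<subseteq> carrier N" for K
  proof
    fix X assume "X \<in> carrier N"
    then obtain x where x: "X = \<phi> x" "x \<in> carrier M" by auto
    then obtain Y where "Y \<in> K" "x = \<psi> Y" using sub(1) by blast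
    then show "X \<in> K" using x sub(2) by auto
  qed
  show thesis
  proof (rule that)
    let ?Q = "{a \<odot>\<^bsub>N\<^esub> X | a X. a \<in> carrier A \<and> X \<in> carrier N}"
    have "(\<lambda>K. additive_subgroup K N) hull ?Q = carrier N"
    proof
      have "additive_subgroup (carrier N) N" unfolding N.additive_subgroup_iff by (auto simp del: N_sel)
      moreover have "?Q \<subseteq> carrier N" using N.smult_closed by blast
      ultimately show "(\<lambda>K. additive_subgroup K N) hull ?Q \<subseteq> carrier N"
        by (intro hull_minimal) auto
      show "carrier N \<subseteq> (\<lambda>K. additive_subgroup K N) hull ?Q"
        unfolding hull_def
      proof (intro Inter_greatest, clarify)
        fix K X assume K: "additive_subgroup K N" "?Q \<subseteq> K" and X: "X \<in> carrier N"
        have "{a \<odot> x | a x. a \<in> carrier A \<and> x \<in> carrier M} \<subseteq> \<psi> ` K"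
        proof clarify
          fix a x assume ax: "a \<in> carrier A" "x \<in> carrier M"
          then have "a \<odot>\<^bsub>N\<^esub> \<phi> x \<in> K" using K(2) by (auto simp del: N_sel(3,4))
          then have "\<phi> (a \<odot> x) \<in> K" using ax by simp
          then show "a \<odot> x \<in> \<psi> ` K" using ax by (metis \<psi>\<phi> imageI smult_closed)
        qed
        from hull_minimal[OF this, of "\<lambda>N. additive_subgroup N M"] have "carrier M \<subseteq> \<psi> ` K"
          using un add_pull[OF K(1)] unfolding unitary_left_module_def by simp
        then show "X \<in> K" using pull_all K(1) X by (auto simp: N.additive_subgroup_iff simp del: N_sel)
      qed
    qed
    then show "unitary_left_module A N"
      unfolding unitary_left_module_def using N.left_module_axioms by blast
  next
    obtain S where S: "finite S" "S \<subseteq> carrier M" "(\<lambda>N. submodule N A M) hull S = carrier M"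
      using fg by (auto simp: finitely_generated_module_def)
    have "(\<lambda>K. submodule K A N) hull (\<phi> ` S) = carrier N"
    proof
      have "submodule (carrier N) A N" unfolding N.additive_subgroup_iff N.submodule_iff
        by (auto simp del: N_sel intro: N.smult_closed)
      then show "(\<lambda>K. submodule K A N) hull (\<phi> ` S) \<subseteq> carrier N"
        using S(2) by (intro hull_minimal) auto
      show "carrier N \<subseteq> (\<lambda>K. submodule K A N) hull (\<phi> ` S)"
        unfolding hull_def
      proof (intro Inter_greatest, clarify)
        fix K X assume K: "submodule K A N" "\<phi> ` S \<subseteq> K" and X: "X \<in> carrier N"
        have "S \<subseteq> \<psi> ` K" using K(2) S(2) by (metis \<psi>\<phi> image_eqI image_subset_iff subset_iff)
        from hull_minimal[OF this, of "\<lambda>N. submodule N A M"] have "carrier M \<subseteq> \<psi> ` K"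
          using S(3) sub_pull[OF K(1)] by simp
        then show "X \<in> K" using pull_all K(1) X
          by (auto simp: N.additive_subgroup_iff N.submodule_iff simp del: N_sel)
      qed
    qed
    then show "finitely_generated_module A N"
      unfolding finitely_generated_module_def using S(1,2)
      by (intro exI[of _ "\<phi> ` S"]) auto
  next
    have stab: "P m = P n" if P: "range P \<subseteq> {H. submodule H A M}" and "\<phi> ` P m = \<phi> ` P n"
      for P :: "nat \<Rightarrow> 'b set" and m n
    proof -
      have "P i \<subseteq> carrier M" for i
        using subsetD[OF P rangeI[of P i]] by (simp add: submodule_iff additive_subgroup_iff)
      then show ?thesis using that(2) inj by (metis inj_on_image_eq_iff)
    qed
    have push: "range (\<lambda>i. \<phi> ` P i) \<subseteq> {H. submodule H A N}"
      if "range P \<subseteq> {H. submodule H A M}" for P :: "nat \<Rightarrow> 'b set"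
      using that sub_push by auto
    show "chain_module k A N \<longrightarrow> chain_module k A M"
    proof (cases k)
      case Noetherian
      show ?thesis unfolding Noetherian chain_module_def satisfies_chain.simps
      proof (intro impI allI, elim conjE)
        fix P :: "nat \<Rightarrow> 'b set"
        assume N: "\<forall>Q :: nat \<Rightarrow> 'c set. range Q \<subseteq> {K. submodule K A N} \<and> incseq Q
            \<longrightarrow> (\<exists>n. \<forall>m\<ge>n. Q m = Q n)"
          and P: "range P \<subseteq> {H. submodule H A M}" "incseq P"
        have "incseq (\<lambda>i. \<phi> ` P i)" using P(2) by (auto simp: incseq_def)
        then have "\<exists>n. \<forall>m\<ge>n. \<phi> ` P m = \<phi> ` P n"
          using N[rule_format, of "\<lambda>i. \<phi> ` P i"] push[OF P(1)] by simp
        then obtain n where n: "\<forall>m\<ge>n. \<phi> ` P m = \<phi> ` P n" ..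
        have "P m = P n" if "n \<le> m" for m
          by (rule stab[OF P(1) n[rule_format, OF that]])
        then show "\<exists>n. \<forall>m\<ge>n. P m = P n" by blast
      qed
    next
      case Artinian
      show ?thesis unfolding Artinian chain_module_def satisfies_chain.simps
      proof (intro impI allI, elim conjE)
        fix P :: "nat \<Rightarrow> 'b set"
        assume N: "\<forall>Q :: nat \<Rightarrow> 'c set. range Q \<subseteq> {K. submodule K A N} \<and> decseq Q
            \<longrightarrow> (\<exists>n. \<forall>m\<ge>n. Q m = Q n)"
          and P: "range P \<subseteq> {H. submodule H A M}" "decseq P"
        have "decseq (\<lambda>i. \<phi> ` P i)" using P(2) by (auto simp: decseq_def)
        then have "\<exists>n. \<forall>m\<ge>n. \<phi> ` P m = \<phi> ` P n"
          using N[rule_format, of "\<lambda>i. \<phi> ` P i"] push[OF P(1)] by simp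
        then obtain n where n: "\<forall>m\<ge>n. \<phi> ` P m = \<phi> ` P n" ..
        have "P m = P n" if "n \<le> m" for m
          by (rule stab[OF P(1) n[rule_format, OF that]])
        then show "\<exists>n. \<forall>m\<ge>n. P m = P n" by blast
      qed
    qed
  qed
qed

end

lemma categorically_chainD:
  fixes A :: "('a, 'm) ring_scheme" and M :: "('a, 'b, 'n) module_scheme"
  assumes A: "categorically_chain c s A"
    and un: "unitary_left_module (sided s A) M"
    and fg: "finitely_generated_module (sided s A) M"
  shows "chain_module c (sided s A) M"
proof -
  define B where "B = sided s A"
  note un = un[folded B_def] and fg = fg[folded B_def]
  interpret M: left_module B M using un by (simp add: unitary_left_module_def)
  obtain n :: nat and v where vn:
    "carrier M = {\<Oplus>\<^bsub>M\<^esub>i\<in>{..<n}. a i \<odot>\<^bsub>M\<^esub> v i | a. a \<in> {..<n} \<rightarrow> carrier B}"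
    by (rule M.unitary_finitely_generated_combinations[OF un fg])
  define \<phi> :: "'b \<Rightarrow> (nat \<Rightarrow> 'a) set" where
    "\<phi> x = {a \<in> {..<n} \<rightarrow> carrier B. (\<Oplus>\<^bsub>M\<^esub>i\<in>{..<n}. a i \<odot>\<^bsub>M\<^esub> v i) = x}" for x
  have "inj_on \<phi> (carrier M)"
  proof (rule inj_onI)
    fix x y assume xy: "x \<in> carrier M" "y \<in> carrier M" "\<phi> x = \<phi> y"
    obtain a where "a \<in> \<phi> x" using xy(1) unfolding vn \<phi>_def by blast
    moreover from this have "a \<in> \<phi> y" using xy(3) by simp
    ultimately show "x = y" by (simp add: \<phi>_def)
  qed
  from M.module_transport[OF this un fg, where k = c] obtain N :: "('a, (nat \<Rightarrow> 'a) set) module"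
    where "unitary_left_module B N" "finitely_generated_module B N"
      "chain_module c B N \<longrightarrow> chain_module c B M" by blast
  then show ?thesis using A unfolding categorically_chain_def B_def by blast
qed



section \<open>Ample groupoids\<close>

text \<open>The unit at an object is identified with the object, and \<open>g \<cdot> h\<close> is meaningful exactly when
  the source of \<open>g\<close> is the target of \<open>h\<close>; \<open>src\<close> and \<open>tgt\<close> are the maps \<open>d\<close> and \<open>r\<close>.\<close>

record 'g groupoid =
  arrows :: "'g set"
  src :: "'g \<Rightarrow> 'g"
  tgt :: "'g \<Rightarrow> 'g"
  cmp :: "'g \<Rightarrow> 'g \<Rightarrow> 'g"  (infixl \<open>\<cdot>\<index>\<close> 70)

locale groupoid =
  fixes G :: "'g groupoid" (structure)
  assumes src_closed: "g \<in> arrows G \<Longrightarrow> src G g \<in> arrows G"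
    and tgt_closed: "g \<in> arrows G \<Longrightarrow> tgt G g \<in> arrows G"
    and src_src: "g \<in> arrows G \<Longrightarrow> src G (src G g) = src G g"
    and tgt_src: "g \<in> arrows G \<Longrightarrow> tgt G (src G g) = src G g"
    and src_tgt: "g \<in> arrows G \<Longrightarrow> src G (tgt G g) = tgt G g"
    and tgt_tgt: "g \<in> arrows G \<Longrightarrow> tgt G (tgt G g) = tgt G g"
    and cmp_closed: "\<lbrakk>g \<in> arrows G; h \<in> arrows G; src G g = tgt G h\<rbrakk> \<Longrightarrow> g \<cdot> h \<in> arrows G"
    and src_cmp: "\<lbrakk>g \<in> arrows G; h \<in> arrows G; src G g = tgt G h\<rbrakk> \<Longrightarrow> src G (g \<cdot> h) = src G h"
    and tgt_cmp: "\<lbrakk>g \<in> arrows G; h \<in> arrows G; src G g = tgt G h\<rbrakk> \<Longrightarrow> tgt G (g \<cdot> h) = tgt G g"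
    and cmp_assoc: "\<lbrakk>g \<in> arrows G; h \<in> arrows G; k \<in> arrows G; src G g = tgt G h; src G h = tgt G k\<rbrakk>
      \<Longrightarrow> (g \<cdot> h) \<cdot> k = g \<cdot> (h \<cdot> k)"
    and cmp_src: "g \<in> arrows G \<Longrightarrow> g \<cdot> src G g = g"
    and tgt_cmp_self: "g \<in> arrows G \<Longrightarrow> tgt G g \<cdot> g = g"
    and ex_inverse: "g \<in> arrows G \<Longrightarrow> \<exists>h\<in>arrows G. src G h = tgt G g \<and> tgt G h = src G g \<and>
      h \<cdot> g = src G g \<and> g \<cdot> h = tgt G g"

definition arrow_inv :: "'g groupoid \<Rightarrow> 'g \<Rightarrow> 'g"
  where "arrow_inv G g = (THE h. h \<in> arrows G \<and> src G h = tgt G g \<and> tgt G h = src G g \<and>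
    h \<cdot>\<^bsub>G\<^esub> g = src G g \<and> g \<cdot>\<^bsub>G\<^esub> h = tgt G g)"

definition unit_arrows :: "'g groupoid \<Rightarrow> 'g set"
  where "unit_arrows G = {u \<in> arrows G. src G u = u}"

definition composable_pairs :: "'g groupoid \<Rightarrow> ('g \<times> 'g) set"
  where "composable_pairs G = {(g, h). g \<in> arrows G \<and> h \<in> arrows G \<and> src G g = tgt G h}"

definition isotropy_group :: "'g groupoid \<Rightarrow> 'g \<Rightarrow> 'g monoid"
  where "isotropy_group G x =
    \<lparr>carrier = {g \<in> arrows G. src G g = x \<and> tgt G g = x}, mult = cmp G, one = x\<rparr>"

definition groupoid_orbit :: "'g groupoid \<Rightarrow> 'g \<Rightarrow> 'g set"
  where "groupoid_orbit G x = {y \<in> unit_arrows G. \<exists>g\<in>arrows G. src G g = x \<and> tgt G g = y}"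

definition orbit_representatives :: "'g groupoid \<Rightarrow> 'j set \<Rightarrow> ('j \<Rightarrow> 'g) \<Rightarrow> bool"
  where "orbit_representatives G J x \<longleftrightarrow> x \<in> J \<rightarrow> unit_arrows G \<and>
    (\<forall>y\<in>unit_arrows G. \<exists>!\<alpha>. \<alpha> \<in> J \<and> y \<in> groupoid_orbit G (x \<alpha>))"

definition local_homeomorphism :: "'a topology \<Rightarrow> 'b topology \<Rightarrow> ('a \<Rightarrow> 'b) \<Rightarrow> bool"
  where "local_homeomorphism X Y f \<longleftrightarrow>
    (\<forall>x\<in>topspace X. \<exists>U. x \<in> U \<and> openin X U \<and> openin Y (f ` U) \<and>
      homeomorphic_map (subtopology X U) (subtopology Y (f ` U)) f)"

locale topological_groupoid = groupoid G for G :: "'g groupoid" (structure) +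
  fixes T :: "'g topology"
  assumes topspace_arrows: "topspace T = arrows G"
    and continuous_cmp:
      "continuous_map (subtopology (prod_topology T T) (composable_pairs G)) T (\<lambda>(g, h). g \<cdot> h)"
    and continuous_inv: "continuous_map T T (arrow_inv G)"
    and locally_compact: "locally_compact_space T"
    and locally_compact_units: "locally_compact_space (subtopology T (unit_arrows G))"
    and Hausdorff_units: "Hausdorff_space (subtopology T (unit_arrows G))"

locale etale_groupoid = topological_groupoid +
  assumes local_homeomorphism_src: "local_homeomorphism T (subtopology T (unit_arrows G)) (src G)"
    and local_homeomorphism_tgt: "local_homeomorphism T (subtopology T (unit_arrows G)) (tgt G)"

definition compact_open_bisection :: "'g groupoid \<Rightarrow> 'g topology \<Rightarrow> 'g set \<Rightarrow> bool"
  where "compact_open_bisection G T U \<longleftrightarrow>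
    compactin T U \<and> openin T U \<and> inj_on (src G) U \<and> inj_on (tgt G) U"

text \<open>The library's way of saying that a family of sets is a basis of the topology \<open>T\<close>.\<close>

locale ample_groupoid = etale_groupoid +
  assumes basis: "openin T = arbitrary union_of (compact_open_bisection G T)"


section \<open>Groupoid algebras, group rings, matrix rings and direct sums\<close>

text \<open>Functions on a carrier set are extensional, i.e. \<open>undefined\<close> outside of it. The value of
  \<open>finsum\<close> over an infinite index set is zero, so every sum below is taken over its nonzero
  terms only, of which there are finitely many.\<close>

definition function_module :: "('r, 'm) ring_scheme \<Rightarrow> 'g set \<Rightarrow> ('r, 'g \<Rightarrow> 'r) module"
  where "function_module R X =
    \<lparr>carrier = X \<rightarrow>\<^sub>E carrier R, mult = undefined, one = undefined,
     zero = (\<lambda>g\<in>X. \<zero>\<^bsub>R\<^esub>), add = (\<lambda>f f'. \<lambda>g\<in>X. f g \<oplus>\<^bsub>R\<^esub> f' g),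
     smult = (\<lambda>r f. \<lambda>g\<in>X. r \<otimes>\<^bsub>R\<^esub> f g)\<rparr>"

definition char_fun :: "('r, 'm) ring_scheme \<Rightarrow> 'g set \<Rightarrow> 'g set \<Rightarrow> 'g \<Rightarrow> 'r"
  where "char_fun R X U = (\<lambda>g\<in>X. if g \<in> U then \<one>\<^bsub>R\<^esub> else \<zero>\<^bsub>R\<^esub>)"

definition groupoid_convolution ::
    "('r, 'm) ring_scheme \<Rightarrow> 'g groupoid \<Rightarrow> ('g \<Rightarrow> 'r) \<Rightarrow> ('g \<Rightarrow> 'r) \<Rightarrow> 'g \<Rightarrow> 'r"
  where "groupoid_convolution R G f1 f2 = (\<lambda>g\<in>arrows G.
    \<Oplus>\<^bsub>R\<^esub>h\<in>{h \<in> arrows G. src G h = src G g \<and> f1 (g \<cdot>\<^bsub>G\<^esub> arrow_inv G h) \<otimes>\<^bsub>R\<^esub> f2 h \<noteq> \<zero>\<^bsub>R\<^esub>}.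
      f1 (g \<cdot>\<^bsub>G\<^esub> arrow_inv G h) \<otimes>\<^bsub>R\<^esub> f2 h)"

definition groupoid_algebra ::
    "('r, 'm) ring_scheme \<Rightarrow> 'g groupoid \<Rightarrow> 'g topology \<Rightarrow> ('g \<Rightarrow> 'r) ring"
  where "groupoid_algebra R G T =
    \<lparr>carrier = (\<lambda>N. submodule N R (function_module R (arrows G))) hull
        {char_fun R (arrows G) U | U. compact_open_bisection G T U},
     mult = groupoid_convolution R G, one = undefined,
     zero = (\<lambda>g\<in>arrows G. \<zero>\<^bsub>R\<^esub>), add = (\<lambda>f f'. \<lambda>g\<in>arrows G. f g \<oplus>\<^bsub>R\<^esub> f' g)\<rparr>"

definition group_ring :: "('r, 'm) ring_scheme \<Rightarrow> ('g, 'n) monoid_scheme \<Rightarrow> ('g \<Rightarrow> 'r) ring"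
  where "group_ring R H =
    \<lparr>carrier = {f \<in> carrier H \<rightarrow>\<^sub>E carrier R. finite {h \<in> carrier H. f h \<noteq> \<zero>\<^bsub>R\<^esub>}},
     mult = (\<lambda>f1 f2. \<lambda>g\<in>carrier H.
       \<Oplus>\<^bsub>R\<^esub>h\<in>{h \<in> carrier H. f1 (g \<otimes>\<^bsub>H\<^esub> inv\<^bsub>H\<^esub> h) \<otimes>\<^bsub>R\<^esub> f2 h \<noteq> \<zero>\<^bsub>R\<^esub>}.
         f1 (g \<otimes>\<^bsub>H\<^esub> inv\<^bsub>H\<^esub> h) \<otimes>\<^bsub>R\<^esub> f2 h),
     one = (\<lambda>h\<in>carrier H. if h = \<one>\<^bsub>H\<^esub> then \<one>\<^bsub>R\<^esub> else \<zero>\<^bsub>R\<^esub>),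
     zero = (\<lambda>h\<in>carrier H. \<zero>\<^bsub>R\<^esub>), add = (\<lambda>f f'. \<lambda>h\<in>carrier H. f h \<oplus>\<^bsub>R\<^esub> f' h)\<rparr>"

definition matrix_ring :: "'x set \<Rightarrow> ('s, 'm) ring_scheme \<Rightarrow> ('x \<times> 'x \<Rightarrow> 's) ring"
  where "matrix_ring X S =
    \<lparr>carrier = {A \<in> X \<times> X \<rightarrow>\<^sub>E carrier S. finite {p \<in> X \<times> X. A p \<noteq> \<zero>\<^bsub>S\<^esub>}},
     mult = (\<lambda>A B. \<lambda>(i, j)\<in>X \<times> X.
       \<Oplus>\<^bsub>S\<^esub>k\<in>{k \<in> X. A (i, k) \<otimes>\<^bsub>S\<^esub> B (k, j) \<noteq> \<zero>\<^bsub>S\<^esub>}. A (i, k) \<otimes>\<^bsub>S\<^esub> B (k, j)),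
     one = undefined,
     zero = (\<lambda>p\<in>X \<times> X. \<zero>\<^bsub>S\<^esub>), add = (\<lambda>A B. \<lambda>p\<in>X \<times> X. A p \<oplus>\<^bsub>S\<^esub> B p)\<rparr>"

definition direct_sum_ring :: "'j set \<Rightarrow> ('j \<Rightarrow> ('a, 'm) ring_scheme) \<Rightarrow> ('j \<Rightarrow> 'a) ring"
  where "direct_sum_ring J A =
    \<lparr>carrier = {f \<in> (\<Pi>\<^sub>E \<alpha>\<in>J. carrier (A \<alpha>)). finite {\<alpha> \<in> J. f \<alpha> \<noteq> \<zero>\<^bsub>A \<alpha>\<^esub>}},
     mult = (\<lambda>f f'. \<lambda>\<alpha>\<in>J. f \<alpha> \<otimes>\<^bsub>A \<alpha>\<^esub> f' \<alpha>), one = undefined,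
     zero = (\<lambda>\<alpha>\<in>J. \<zero>\<^bsub>A \<alpha>\<^esub>), add = (\<lambda>f f'. \<lambda>\<alpha>\<in>J. f \<alpha> \<oplus>\<^bsub>A \<alpha>\<^esub> f' \<alpha>)\<rparr>"

end

theory Submission
  imports Defs "HOL-Algebra.Multiplicative_Group" "HOL-Algebra.Zassenhaus"
begin

text \<open>
  Let \<open>A\<close> be the algebra of an ample groupoid \<open>G\<close> over \<open>R\<close>. The conditions are equivalent by a cycle of
  implications.

  For an idempotent \<open>e\<close> the module \<open>A e\<close> is generated by one element, and the left ideals of the corner
  \<open>e A e\<close> embed into its submodules by \<open>I \<mapsto> {x \<in> A e. e A x \<subseteq> I}\<close>. Hence a categorical chain condition is
  a local one (\<open>categorically_chain_imp_locally_chain\<close>).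

  Suppose that all corners satisfy the chain condition. Compact open neighbourhoods of a unit \<open>x\<close> inside a
  fixed compact open \<open>U\<close> that shrink strictly would give a strictly descending sequence of idempotents in the
  corner at the characteristic function of \<open>U\<close>, and neither chain condition permits one
  (\<open>descending_idempotents_stabilize\<close>). So \<open>x\<close> has a smallest compact open neighbourhood, which is \<open>{x}\<close>
  because the unit space is Hausdorff; as the source map is locally injective, \<open>G\<close> is discrete
  (\<open>discrete_if_locally_chain\<close>). Then \<open>A\<close> consists of the functions with finite support, and its corner at
  \<open>x\<close> is the group ring of the isotropy group (\<open>corner_isomorphic_group_ring\<close>).

  An arrow from the representative of each orbit to every unit of the orbit identifies an arrow of \<open>G\<close> with
  its target, its source and an element of an isotropy group; this turns convolution into matrix
  multiplication (\<open>finite_support_isomorphic_matrices\<close>). The isomorphism exists for the ring of functions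
  with finite support whatever the topology of \<open>G\<close> is. Thus an isomorphism of \<open>A\<close> with the sum of matrix
  rings is an isomorphism with that ring of functions, and the way back needs no computation with matrices:
  a finitely generated module over functions with finite support is a sum of finitely many cyclic modules,
  each generated by a vector that is fixed by a matrix unit, and the submodules of such a sum are controlled
  by left ideals of the corners at these matrix units (\<open>chain_module_if_matrix_like\<close>).

  It remains to see that an Artinian group ring \<open>R H\<close> has a finite group \<open>H\<close> and
  Artinian coefficients. The latter is read off from the left ideals of functions with values in an ideal of
  \<open>R\<close>. For the former let \<open>H\<close> be infinite. The descending chain condition for
  \<open>R H\<close> implies the one for subgroups of \<open>H\<close>, so \<open>H\<close> may be replaced
  by a minimal infinite subgroup: now all proper subgroups are finite. It also yields a maximal finite
  normal subgroup \<open>N\<close>, and then elements outside \<open>N\<close> have finite centralizers. Let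
  \<open>L\<close> be a minimal left ideal of right \<open>N\<close>-invariant functions. An element that
  annihilates \<open>L\<close> has coset sums which annihilate a fixed nonzero \<open>b \<in> R\<close>, a
  form of primeness of the group ring of \<open>H / N\<close> (\<open>annihilator_augmentation\<close>). The
  left ideal \<open>W\<close> of all \<open>f\<close> whose augmentation annihilates \<open>b\<close> is
  proper, but \<open>W L = L\<close> since a nonzero function with finite support is not invariant under an
  infinite group. This equation lets \<open>W\<close> be a supplement of the annihilator of any finite
  subset of \<open>L\<close>, hence by the descending chain condition of the annihilator of
  \<open>L\<close>, which is contained in \<open>W\<close>: a contradiction
  (\<open>artinian_not_quasifinite\<close>).\<close>

section \<open>Chain conditions and order embeddings\<close>

definition chain_direction :: "chain_condition \<Rightarrow> (nat \<Rightarrow> 'a set) \<Rightarrow> bool"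
  where "chain_direction c N \<longleftrightarrow> (case c of Noetherian \<Rightarrow> incseq N | Artinian \<Rightarrow> decseq N)"

lemma satisfies_chain_iff:
  "satisfies_chain c L \<longleftrightarrow>
    (\<forall>N. range N \<subseteq> L \<and> chain_direction c N \<longrightarrow> (\<exists>n. \<forall>m\<ge>n. N m = N n))"
  by (cases c) (simp_all add: chain_direction_def)

lemma chain_direction_comparable:
  "chain_direction c N \<Longrightarrow> N m \<subseteq> N n \<or> N n \<subseteq> N m"
  by (cases c; cases "m \<le> n") (auto simp: chain_direction_def incseq_def decseq_def)

lemma chain_direction_image:
  assumes "chain_direction c N" and "\<And>m n. N m \<subseteq> N n \<Longrightarrow> \<phi> (N m) \<subseteq> \<phi> (N n)"
  shows "chain_direction c (\<lambda>n. \<phi> (N n))"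
  using assms by (cases c) (auto simp: chain_direction_def incseq_def decseq_def)

text \<open>A finite family of monotone maps may jointly detect strict inclusions; this is what is needed for modules
  with several generators, where each generator contributes one map to a lattice of left ideals.\<close>

lemma satisfies_chain_embed:
  fixes \<phi> :: "'i \<Rightarrow> 'a set \<Rightarrow> 'b set"
  assumes fin: "finite I"
    and chain: "\<And>i. i \<in> I \<Longrightarrow> satisfies_chain c (L' i)"
    and into: "\<And>i K. i \<in> I \<Longrightarrow> K \<in> L \<Longrightarrow> \<phi> i K \<in> L' i"
    and mono: "\<And>i K K'. i \<in> I \<Longrightarrow> K \<in> L \<Longrightarrow> K' \<in> L \<Longrightarrow> K \<subseteq> K' \<Longrightarrow> \<phi> i K \<subseteq> \<phi> i K'"
    and inj: "\<And>K K'. K \<in> L \<Longrightarrow> K' \<in> L \<Longrightarrow> K \<subseteq> K' \<Longrightarrow> (\<And>i. i \<in> I \<Longrightarrow> \<phi> i K = \<phi> i K') \<Longrightarrow> K = K'"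
  shows "satisfies_chain c L"
  unfolding satisfies_chain_iff
proof (intro allI impI, elim conjE)
  fix N :: "nat \<Rightarrow> 'a set" assume N: "range N \<subseteq> L" "chain_direction c N"
  have NL: "N n \<in> L" for n using N(1) by auto
  have "\<exists>n. \<forall>m\<ge>n. \<phi> i (N m) = \<phi> i (N n)" if "i \<in> I" for i
  proof -
    have "chain_direction c (\<lambda>n. \<phi> i (N n))"
      by (rule chain_direction_image[OF N(2)]) (rule mono[OF that NL NL])
    moreover have "range (\<lambda>n. \<phi> i (N n)) \<subseteq> L' i" using into[OF that NL] by auto
    ultimately show ?thesis
      using chain[OF that, unfolded satisfies_chain_iff, rule_format, of "\<lambda>n. \<phi> i (N n)"] by blast
  qed
  then obtain \<nu> where \<nu>: "\<And>i m. i \<in> I \<Longrightarrow> m \<ge> \<nu> i \<Longrightarrow> \<phi> i (N m) = \<phi> i (N (\<nu> i))" by metis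
  define n where "n = Max (insert 0 (\<nu> ` I))"
  have n: "\<nu> i \<le> n" if "i \<in> I" for i using fin that by (simp add: n_def)
  have "N m = N n" if "m \<ge> n" for m
  proof -
    have eq: "\<phi> i (N m) = \<phi> i (N n)" if "i \<in> I" for i
      using \<nu>[OF that, of m] \<nu>[OF that, of n] n[OF that] \<open>m \<ge> n\<close> by simp
    from chain_direction_comparable[OF N(2), of m n] show ?thesis
    proof
      assume "N m \<subseteq> N n" then show ?thesis by (rule inj[OF NL NL _ eq])
    next
      assume "N n \<subseteq> N m" then show ?thesis by (rule inj[OF NL NL _ eq[symmetric], symmetric])
    qed
  qed
  then show "\<exists>n. \<forall>m\<ge>n. N m = N n" by blast
qed

lemma satisfies_chain_embed1:
  assumes "satisfies_chain c L'" "\<And>K. K \<in> L \<Longrightarrow> \<phi> K \<in> L'"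
    and "\<And>K K'. K \<in> L \<Longrightarrow> K' \<in> L \<Longrightarrow> K \<subseteq> K' \<Longrightarrow> \<phi> K \<subseteq> \<phi> K'"
    and "\<And>K K'. K \<in> L \<Longrightarrow> K' \<in> L \<Longrightarrow> K \<subseteq> K' \<Longrightarrow> \<phi> K = \<phi> K' \<Longrightarrow> K = K'"
  shows "satisfies_chain c L"
  by (rule satisfies_chain_embed[where I = "{()}" and \<phi> = "\<lambda>_. \<phi>" and L' = "\<lambda>_. L'"])
    (use assms in auto)

lemma satisfies_chain_Artinian_minimal:
  assumes "satisfies_chain Artinian L" "\<F> \<subseteq> L" "K \<in> \<F>"
  shows "\<exists>M\<in>\<F>. \<forall>M'\<in>\<F>. M' \<subseteq> M \<longrightarrow> M' = M"
proof (rule ccontr)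
  assume "\<not> ?thesis"
  then have "\<forall>M\<in>\<F>. \<exists>M'\<in>\<F>. M' \<subset> M" by (meson psubsetI)
  then obtain f where f: "\<And>M. M \<in> \<F> \<Longrightarrow> f M \<in> \<F> \<and> f M \<subset> M" by metis
  define N where "N n = (f ^^ n) K" for n
  have N: "N n \<in> \<F>" for n by (induction n) (use f assms(3) in \<open>auto simp: N_def\<close>)
  have N2: "N (Suc n) \<subset> N n" for n using f[OF N[of n]] by (simp add: N_def)
  have "decseq N" using N2 by (simp add: decseq_Suc_iff psubset_imp_subset)
  moreover have "range N \<subseteq> L" using N assms(2) by auto
  ultimately obtain n where "\<forall>m\<ge>n. N m = N n"
    using assms(1) unfolding satisfies_chain.simps by blast
  then show False using N2[of n] by (metis le_SucI order_refl psubset_eq)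
qed

section \<open>Rings without unit\<close>

lemma (in abelian_group) additive_subgroup_iff_closed:
  "additive_subgroup H G \<longleftrightarrow> H \<subseteq> carrier G \<and> \<zero> \<in> H \<and> (\<forall>x\<in>H. \<forall>y\<in>H. x \<oplus> y \<in> H) \<and> (\<forall>x\<in>H. \<ominus> x \<in> H)"
proof
  assume "additive_subgroup H G"
  then interpret H: additive_subgroup H G .
  show "H \<subseteq> carrier G \<and> \<zero> \<in> H \<and> (\<forall>x\<in>H. \<forall>y\<in>H. x \<oplus> y \<in> H) \<and> (\<forall>x\<in>H. \<ominus> x \<in> H)"
    using H.a_subset H.zero_closed H.a_closed H.a_subgroup
    by (auto simp: a_inv_def dest: subgroup.m_inv_closed)
next
  assume "H \<subseteq> carrier G \<and> \<zero> \<in> H \<and> (\<forall>x\<in>H. \<forall>y\<in>H. x \<oplus> y \<in> H) \<and> (\<forall>x\<in>H. \<ominus> x \<in> H)"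
  then show "additive_subgroup H G"
    by (auto intro!: additive_subgroupI group.subgroupI[OF a_group] simp: a_inv_def)
qed

context nonunital_ring
begin

lemma l_null: "a \<in> carrier A \<Longrightarrow> \<zero> \<otimes> a = \<zero>"
  using l_distr[of \<zero> \<zero> a] m_closed[of \<zero> a] by (metis r_zero zero_closed add.l_cancel_one)

lemma r_null: "a \<in> carrier A \<Longrightarrow> a \<otimes> \<zero> = \<zero>"
  using r_distr[of \<zero> \<zero> a] m_closed[of a \<zero>] by (metis r_zero zero_closed add.l_cancel_one)

lemma l_minus: "a \<in> carrier A \<Longrightarrow> b \<in> carrier A \<Longrightarrow> (\<ominus> a) \<otimes> b = \<ominus> (a \<otimes> b)"
  by (metis a_inv_closed l_distr l_neg l_null m_closed minus_equality)

lemma r_minus: "a \<in> carrier A \<Longrightarrow> b \<in> carrier A \<Longrightarrow> a \<otimes> (\<ominus> b) = \<ominus> (a \<otimes> b)"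
  by (metis a_inv_closed r_distr l_neg r_null m_closed minus_equality)

end

lemma sided_simps [simp]:
  "carrier (sided s A) = carrier A" "zero (sided s A) = zero A" "add (sided s A) = add A"
  "add_monoid (sided s A) = add_monoid A"
  by (cases s; simp add: opposite_ring_def)+

lemma a_inv_sided [simp]: "a_inv (sided s A) = a_inv A"
  by (rule ext) (simp add: a_inv_def)

lemma additive_subgroup_sided [simp]: "additive_subgroup I (sided s A) = additive_subgroup I A"
  by (simp add: additive_subgroup_def)

lemma abelian_group_sided: "abelian_group A \<Longrightarrow> abelian_group (sided s A)"
  by (simp add: abelian_group_def abelian_monoid_def abelian_group_axioms_def)

lemma nonunital_ring_sided:
  assumes "nonunital_ring A" shows "nonunital_ring (sided s A)"
proof -
  interpret nonunital_ring A by fact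
  interpret S: abelian_group "sided s A" by (rule abelian_group_sided) unfold_locales
  show ?thesis
    by (intro nonunital_ring.intro nonunital_ring_axioms.intro S.abelian_group_axioms; cases s)
      (simp_all add: opposite_ring_def m_assoc m_closed l_distr r_distr)
qed

lemma (in nonunital_ring) sided_corner_ring:
  assumes "e \<in> carrier A"
  shows "sided s (corner_ring A e) = corner_ring (sided s A) e"
proof (cases s)
  case RightSided
  have "{e \<otimes> a \<otimes> e |a. a \<in> carrier A} = {e \<otimes> (a \<otimes> e) |a. a \<in> carrier A}"
    using assms by (intro Collect_cong ex_cong) (metis m_assoc)
  then show ?thesis using RightSided by (simp add: opposite_ring_def corner_ring_def)
qed simp

lemma corner_ring_simps [simp]:
  "mult (corner_ring A e) = mult A" "zero (corner_ring A e) = zero A" "add (corner_ring A e) = add A"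
  "one (corner_ring A e) = e"
  by (simp_all add: corner_ring_def)

context nonunital_ring
begin

lemma carrier_corner:
  assumes "e \<in> carrier A" "e \<otimes> e = e"
  shows "carrier (corner_ring A e) = {a \<in> carrier A. e \<otimes> a = a \<and> a \<otimes> e = a}"
proof
  show "carrier (corner_ring A e) \<subseteq> {a \<in> carrier A. e \<otimes> a = a \<and> a \<otimes> e = a}"
    using assms by (auto simp: corner_ring_def m_closed m_assoc) (metis assms m_assoc m_closed)
  show "{a \<in> carrier A. e \<otimes> a = a \<and> a \<otimes> e = a} \<subseteq> carrier (corner_ring A e)"
    by (auto simp: corner_ring_def) metis
qed

lemma corner_nonunital_ring:
  assumes "e \<in> carrier A" "e \<otimes> e = e"
  shows "nonunital_ring (corner_ring A e)"
proof -
  have "abelian_group (corner_ring A e)"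
  proof (rule abelian_groupI)
    show "\<exists>b\<in>carrier (corner_ring A e). b \<oplus>\<^bsub>corner_ring A e\<^esub> a = \<zero>\<^bsub>corner_ring A e\<^esub>"
      if "a \<in> carrier (corner_ring A e)" for a
      using that assms
      by (intro bexI[of _ "\<ominus> a"]) (auto simp: carrier_corner l_neg r_minus l_minus)
  qed (use assms in \<open>auto simp: carrier_corner a_ac l_null r_null l_distr r_distr\<close>)
  then interpret C: abelian_group "corner_ring A e" .
  show ?thesis
  proof
    fix a b assume ab: "a \<in> carrier (corner_ring A e)" "b \<in> carrier (corner_ring A e)"
    show "a \<otimes>\<^bsub>corner_ring A e\<^esub> b \<in> carrier (corner_ring A e)"
      using ab assms by (simp add: carrier_corner m_closed m_assoc[symmetric]) (simp add: m_assoc)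
  qed (use assms in \<open>auto simp: carrier_corner m_assoc l_distr r_distr\<close>)
qed

lemma corner_a_inv:
  assumes "e \<in> carrier A" "e \<otimes> e = e" "a \<in> carrier (corner_ring A e)"
  shows "\<ominus>\<^bsub>corner_ring A e\<^esub> a = \<ominus> a"
proof -
  interpret C: nonunital_ring "corner_ring A e" by (rule corner_nonunital_ring) fact+
  show ?thesis
    by (rule C.minus_equality)
      (use assms in \<open>auto simp: carrier_corner l_neg r_minus l_minus\<close>)
qed

end

lemma (in nonunital_ring) left_ideal_iff:
  "left_ideal I A \<longleftrightarrow> I \<subseteq> carrier A \<and> \<zero> \<in> I \<and> (\<forall>x\<in>I. \<forall>y\<in>I. x \<oplus> y \<in> I) \<and> (\<forall>x\<in>I. \<ominus> x \<in> I) \<and>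
    (\<forall>a\<in>carrier A. \<forall>x\<in>I. a \<otimes> x \<in> I)"
  by (auto simp: left_ideal_def additive_subgroup_iff_closed)

lemma rng_isomorphic_sided: "rng_isomorphic A B \<Longrightarrow> rng_isomorphic (sided s A) (sided s B)"
  unfolding rng_isomorphic_def by (cases s) (auto simp: opposite_ring_def)

lemma (in nonunital_ring) rng_isomorphic_sym:
  assumes "rng_isomorphic A B" shows "rng_isomorphic B A"
proof -
  obtain h where h: "bij_betw h (carrier A) (carrier B)"
    "\<And>a b. a \<in> carrier A \<Longrightarrow> b \<in> carrier A \<Longrightarrow> h (a \<oplus> b) = h a \<oplus>\<^bsub>B\<^esub> h b \<and> h (a \<otimes> b) = h a \<otimes>\<^bsub>B\<^esub> h b"
    using assms by (auto simp: rng_isomorphic_def)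
  define k where "k = inv_into (carrier A) h"
  have k: "bij_betw k (carrier B) (carrier A)" unfolding k_def by (rule bij_betw_inv_into[OF h(1)])
  have hk: "h (k b) = b" "k b \<in> carrier A" if "b \<in> carrier B" for b
    using that h(1) k unfolding k_def by (auto simp: bij_betw_def f_inv_into_f)
  have kh: "k (h a) = a" if "a \<in> carrier A" for a
    using that h(1) by (simp add: k_def bij_betw_def)
  have "k (a \<oplus>\<^bsub>B\<^esub> b) = k a \<oplus> k b \<and> k (a \<otimes>\<^bsub>B\<^esub> b) = k a \<otimes> k b" if "a \<in> carrier B" "b \<in> carrier B" for a b
    using h(2)[of "k a" "k b"] hk that kh[of "k a \<oplus> k b"] kh[of "k a \<otimes> k b"] m_closed a_closed by metis
  then show ?thesis using k unfolding rng_isomorphic_def by blast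
qed

lemma rng_isomorphic_trans:
  assumes "rng_isomorphic A B" "rng_isomorphic B C" shows "rng_isomorphic A C"
proof -
  obtain h k where h: "bij_betw h (carrier A) (carrier B)"
    "\<And>a b. a \<in> carrier A \<Longrightarrow> b \<in> carrier A \<Longrightarrow> h (a \<oplus>\<^bsub>A\<^esub> b) = h a \<oplus>\<^bsub>B\<^esub> h b \<and> h (a \<otimes>\<^bsub>A\<^esub> b) = h a \<otimes>\<^bsub>B\<^esub> h b"
    and k: "bij_betw k (carrier B) (carrier C)"
    "\<And>a b. a \<in> carrier B \<Longrightarrow> b \<in> carrier B \<Longrightarrow> k (a \<oplus>\<^bsub>B\<^esub> b) = k a \<oplus>\<^bsub>C\<^esub> k b \<and> k (a \<otimes>\<^bsub>B\<^esub> b) = k a \<otimes>\<^bsub>C\<^esub> k b"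
    using assms by (auto simp: rng_isomorphic_def)
  have "bij_betw (k \<circ> h) (carrier A) (carrier C)" by (rule bij_betw_trans[OF h(1) k(1)])
  moreover have "h a \<in> carrier B" if "a \<in> carrier A" for a using h(1) that by (auto simp: bij_betw_def)
  ultimately show ?thesis unfolding rng_isomorphic_def using h(2) k(2)
    by (intro exI[of _ "k \<circ> h"]) auto
qed

lemma chain_ring_isomorphic:
  assumes A: "nonunital_ring A" and B: "nonunital_ring B" and iso: "rng_isomorphic A B"
    and chain: "chain_ring c s B"
  shows "chain_ring c s A"
proof -
  interpret A: nonunital_ring "sided s A" by (rule nonunital_ring_sided[OF A])
  interpret B: nonunital_ring "sided s B" by (rule nonunital_ring_sided[OF B])
  obtain h where h: "bij_betw h (carrier A) (carrier B)"
    "\<And>a b. a \<in> carrier A \<Longrightarrow> b \<in> carrier A \<Longrightarrow> h (a \<oplus>\<^bsub>A\<^esub> b) = h a \<oplus>\<^bsub>B\<^esub> h b"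
    "\<And>a b. a \<in> carrier A \<Longrightarrow> b \<in> carrier A \<Longrightarrow> h (a \<otimes>\<^bsub>sided s A\<^esub> b) = h a \<otimes>\<^bsub>sided s B\<^esub> h b"
    using rng_isomorphic_sided[OF iso, of s] by (auto simp: rng_isomorphic_def)
  have hc: "h a \<in> carrier B" if "a \<in> carrier A" for a using h(1) that by (auto simp: bij_betw_def)
  have h0: "h \<zero>\<^bsub>A\<^esub> = \<zero>\<^bsub>B\<^esub>"
    using h(2)[of "\<zero>\<^bsub>A\<^esub>" "\<zero>\<^bsub>A\<^esub>"] A.r_zero[OF A.zero_closed] hc[of "\<zero>\<^bsub>A\<^esub>"] A.zero_closed
      B.add.l_cancel_one[of "h \<zero>\<^bsub>A\<^esub>" "h \<zero>\<^bsub>A\<^esub>"]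
    by simp
  have hm: "h (\<ominus>\<^bsub>A\<^esub> a) = \<ominus>\<^bsub>B\<^esub> h a" if "a \<in> carrier A" for a
    using B.minus_equality[of "h (\<ominus>\<^bsub>A\<^esub> a)" "h a"] h(2)[of "\<ominus>\<^bsub>A\<^esub> a" a] that hc h0
      A.l_neg[of a] A.a_inv_closed[of a] by simp
  show ?thesis unfolding chain_ring_def
  proof (rule satisfies_chain_embed1[OF chain[unfolded chain_ring_def], where \<phi> = "\<lambda>I. h ` I"])
    fix I assume "I \<in> {I. left_ideal I (sided s A)}"
    then have I: "I \<subseteq> carrier A" "\<zero>\<^bsub>A\<^esub> \<in> I" "\<And>x y. x \<in> I \<Longrightarrow> y \<in> I \<Longrightarrow> x \<oplus>\<^bsub>A\<^esub> y \<in> I"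
      "\<And>x. x \<in> I \<Longrightarrow> \<ominus>\<^bsub>A\<^esub> x \<in> I" "\<And>a x. a \<in> carrier A \<Longrightarrow> x \<in> I \<Longrightarrow> a \<otimes>\<^bsub>sided s A\<^esub> x \<in> I"
      by (auto simp: A.left_ideal_iff)
    have Ic: "x \<in> carrier A" if "x \<in> I" for x using that I(1) by auto
    have "left_ideal (h ` I) (sided s B)"
      unfolding B.left_ideal_iff
    proof (intro conjI ballI)
      show "h ` I \<subseteq> carrier (sided s B)" using hc Ic by auto
      show "\<zero>\<^bsub>sided s B\<^esub> \<in> h ` I" using I(2) h0 by (auto intro!: image_eqI[of _ h "\<zero>\<^bsub>A\<^esub>"])
      show "x \<oplus>\<^bsub>sided s B\<^esub> y \<in> h ` I" if xy: "x \<in> h ` I" "y \<in> h ` I" for x y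
      proof -
        obtain a b where ab: "a \<in> I" "b \<in> I" "x = h a" "y = h b" using xy by auto
        then have "x \<oplus>\<^bsub>B\<^esub> y = h (a \<oplus>\<^bsub>A\<^esub> b)" using h(2) Ic by simp
        then show ?thesis using I(3) ab by auto
      qed
      show "\<ominus>\<^bsub>sided s B\<^esub> x \<in> h ` I" if x: "x \<in> h ` I" for x
      proof -
        obtain a where ab: "a \<in> I" "x = h a" using x by auto
        then have "\<ominus>\<^bsub>B\<^esub> x = h (\<ominus>\<^bsub>A\<^esub> a)" using hm Ic by simp
        then show ?thesis using I(4) ab by auto
      qed
      show "b \<otimes>\<^bsub>sided s B\<^esub> x \<in> h ` I" if bx: "b \<in> carrier (sided s B)" "x \<in> h ` I" for b x
      proof -
        have "b \<in> h ` carrier A" using bx h(1) by (simp add: bij_betw_def)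
        then obtain a y where a: "a \<in> carrier A" "b = h a" "y \<in> I" "x = h y"
          using bx by blast
        then have "b \<otimes>\<^bsub>sided s B\<^esub> x = h (a \<otimes>\<^bsub>sided s A\<^esub> y)" using h(3) Ic by simp
        then show ?thesis using I(5) a by auto
      qed
    qed
    then show "h ` I \<in> {I. left_ideal I (sided s B)}" by simp
  next
    fix I I' assume I: "I \<in> {I. left_ideal I (sided s A)}" "I' \<in> {I. left_ideal I (sided s A)}"
      and eq: "h ` I = h ` I'"
    have "inj_on h (carrier A)" "I \<subseteq> carrier A" "I' \<subseteq> carrier A"
      using h(1) I by (auto simp: A.left_ideal_iff bij_betw_def)
    then show "I = I'" using eq by (simp add: inj_on_image_eq_iff)
  qed blast
qed

section \<open>Categorical chain conditions\<close>

lemma (in nonunital_ring) column_module: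
  assumes e: "e \<in> carrier A" "e \<otimes> e = e"
  defines "M \<equiv> \<lparr>carrier = {a \<in> carrier A. a \<otimes> e = a}, mult = undefined, one = undefined,
    zero = \<zero>, add = add A, smult = mult A\<rparr> :: ('a, 'a) module"
  shows "unitary_left_module A M" and "finitely_generated_module A M"
proof -
  have M_sel [simp]: "carrier M = {a \<in> carrier A. a \<otimes> e = a}" "\<zero>\<^bsub>M\<^esub> = \<zero>" "add M = add A" "smult M = mult A"
    by (simp_all add: M_def)
  have "abelian_group M"
  proof (rule abelian_groupI)
    show "\<exists>b\<in>carrier M. b \<oplus>\<^bsub>M\<^esub> a = \<zero>\<^bsub>M\<^esub>" if "a \<in> carrier M" for a
      using that e by (intro bexI[of _ "\<ominus> a"]) (auto simp: l_neg l_minus)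
  qed (use e in \<open>auto simp: a_ac l_null l_distr\<close>)
  then interpret M: abelian_group M .
  interpret left_module A M
    by unfold_locales (use e in \<open>auto simp: m_closed m_assoc l_distr r_distr\<close>)
  have gen: "{a \<odot>\<^bsub>M\<^esub> x |a x. a \<in> carrier A \<and> x \<in> carrier M} = carrier M"
  proof
    show "carrier M \<subseteq> {a \<odot>\<^bsub>M\<^esub> x |a x. a \<in> carrier A \<and> x \<in> carrier M}"
    proof
      fix a assume a: "a \<in> carrier M"
      show "a \<in> {a \<odot>\<^bsub>M\<^esub> x |a x. a \<in> carrier A \<and> x \<in> carrier M}"
        using a e by (intro CollectI exI[of _ a] exI[of _ e]) simp
    qed
  qed (use smult_closed in auto)
  show "unitary_left_module A M"
    unfolding unitary_left_module_def gen
    by (intro conjI left_module_axioms hull_same)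
      (auto simp: M.additive_subgroup_iff_closed simp del: M_sel)
  have "carrier M \<subseteq> N" if "{e} \<subseteq> N" "submodule N A M" for N
  proof
    fix a assume a: "a \<in> carrier M"
    have "a \<odot>\<^bsub>M\<^esub> e \<in> N" by (rule submodule.smult_closed[OF that(2)]) (use a that(1) in auto)
    then show "a \<in> N" using a by simp
  qed
  moreover have "submodule (carrier M) A M"
    by (auto simp: submodule_iff M.additive_subgroup_iff_closed smult_closed simp del: M_sel)
  ultimately have "(\<lambda>N. submodule N A M) hull {e} = carrier M"
    using e by (intro hull_unique) auto
  then show "finitely_generated_module A M"
    unfolding finitely_generated_module_def using e by (intro exI[of _ "{e}"]) auto
qed

text \<open>The obvious map \<open>I \<mapsto> A I\<close> requires generated submodules. Its companion, which sends \<open>I\<close> to the largest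
  submodule \<open>K\<close> of \<open>A e\<close> with \<open>e K \<subseteq> I\<close>, is given by a formula and recovers \<open>I\<close> as \<open>K \<inter> e A e\<close>.\<close>

lemma (in nonunital_ring) corner_chain_of_column_chain:
  assumes e: "e \<in> carrier A" "e \<otimes> e = e"
    and ch: "chain_module c A (\<lparr>carrier = {a \<in> carrier A. a \<otimes> e = a}, mult = undefined, one = undefined,
    zero = \<zero>, add = add A, smult = mult A\<rparr> :: ('a, 'a) module)" (is "chain_module c A ?M")
  shows "satisfies_chain c {I. left_ideal I (corner_ring A e)}"
proof -
  interpret C: nonunital_ring "corner_ring A e" by (rule corner_nonunital_ring) fact+
  interpret M: left_module A ?M
    using column_module(1)[OF e] by (simp add: unitary_left_module_def)
  have M_inv: "\<ominus>\<^bsub>?M\<^esub> x = \<ominus> x" if "x \<in> carrier ?M" for x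
    by (rule M.minus_equality) (use that e in \<open>auto simp: l_neg l_minus\<close>)
  define \<phi> where "\<phi> I = {x \<in> carrier ?M. \<forall>b\<in>carrier A. e \<otimes> (b \<otimes> x) \<in> I}" for I
  show ?thesis
  proof (rule satisfies_chain_embed1[OF ch[unfolded chain_module_def], where \<phi> = \<phi>])
    fix I assume "I \<in> {I. left_ideal I (corner_ring A e)}"
    then have I: "I \<subseteq> carrier (corner_ring A e)" "\<zero> \<in> I" "\<And>x y. x \<in> I \<Longrightarrow> y \<in> I \<Longrightarrow> x \<oplus> y \<in> I"
      "\<And>x. x \<in> I \<Longrightarrow> \<ominus>\<^bsub>corner_ring A e\<^esub> x \<in> I"
      by (auto simp: C.left_ideal_iff)
    have Im: "\<ominus> x \<in> I" if "x \<in> I" for x using I(4)[OF that] corner_a_inv[OF e] I(1) that by auto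
    have "submodule (\<phi> I) A ?M"
      unfolding M.submodule_iff M.additive_subgroup_iff
    proof (intro conjI ballI)
      show "\<phi> I \<subseteq> carrier ?M" by (auto simp: \<phi>_def)
      show "\<zero>\<^bsub>?M\<^esub> \<in> \<phi> I" using e I(2) by (auto simp: \<phi>_def l_null r_null)
      show "x \<oplus>\<^bsub>?M\<^esub> y \<in> \<phi> I" if "x \<in> \<phi> I" "y \<in> \<phi> I" for x y
        using that e I(3) by (auto simp: \<phi>_def r_distr l_distr m_closed)
      show "\<ominus>\<^bsub>?M\<^esub> x \<in> \<phi> I" if "x \<in> \<phi> I" for x
      proof -
        have "\<ominus>\<^bsub>?M\<^esub> x = \<ominus> x" using that by (intro M_inv) (simp add: \<phi>_def)
        then show ?thesis using that e Im by (auto simp: \<phi>_def r_minus l_minus m_closed)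
      qed
      show "a \<odot>\<^bsub>?M\<^esub> x \<in> \<phi> I" if "a \<in> carrier A" "x \<in> \<phi> I" for a x
      proof -
        have "e \<otimes> (b \<otimes> (a \<otimes> x)) \<in> I" if "b \<in> carrier A" for b
          using \<open>x \<in> \<phi> I\<close> that \<open>a \<in> carrier A\<close> m_assoc[of b a x] m_closed[of b a] by (auto simp: \<phi>_def)
        then show ?thesis using that e by (auto simp: \<phi>_def m_closed m_assoc)
      qed
    qed
    then show "\<phi> I \<in> {N. submodule N A ?M}" by simp
  next
    fix I I' assume I: "I \<in> {I. left_ideal I (corner_ring A e)}" "I' \<in> {I. left_ideal I (corner_ring A e)}"
      and eq: "\<phi> I = \<phi> I'"
    have rec: "I = \<phi> I \<inter> carrier (corner_ring A e)" if "left_ideal I (corner_ring A e)" for I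
    proof
      have I: "I \<subseteq> carrier (corner_ring A e)"
        "\<And>a x. a \<in> carrier (corner_ring A e) \<Longrightarrow> x \<in> I \<Longrightarrow> a \<otimes> x \<in> I"
        using that by (auto simp: C.left_ideal_iff)
      show "I \<subseteq> \<phi> I \<inter> carrier (corner_ring A e)"
      proof
        fix x assume x: "x \<in> I"
        then have xc: "x \<in> carrier A" "e \<otimes> x = x" "x \<otimes> e = x"
          using I(1) by (auto simp: carrier_corner[OF e])
        have "e \<otimes> (b \<otimes> x) \<in> I" if b: "b \<in> carrier A" for b
        proof -
          have "e \<otimes> b \<otimes> e \<in> carrier (corner_ring A e)" using b by (auto simp: corner_ring_def)
          from I(2)[OF this x] have "e \<otimes> b \<otimes> e \<otimes> x \<in> I" .
          also have "e \<otimes> b \<otimes> e \<otimes> x = e \<otimes> (b \<otimes> x)"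
            using xc e b by (simp add: m_assoc m_closed)
          finally show ?thesis .
        qed
        then show "x \<in> \<phi> I \<inter> carrier (corner_ring A e)" using x I(1) xc by (auto simp: \<phi>_def)
      qed
      show "\<phi> I \<inter> carrier (corner_ring A e) \<subseteq> I"
      proof
        fix x assume x: "x \<in> \<phi> I \<inter> carrier (corner_ring A e)"
        then have "e \<otimes> (e \<otimes> x) \<in> I" using e by (auto simp: \<phi>_def)
        then show "x \<in> I" using x by (auto simp: carrier_corner[OF e])
      qed
    qed
    show "I = I'" using rec I eq by blast
  qed (auto simp: \<phi>_def)
qed

theorem categorically_chain_imp_locally_chain:
  assumes A: "nonunital_ring A" and cat: "categorically_chain c s A"
  shows "locally_chain c s A"
  unfolding locally_chain_def
proof (intro ballI impI)
  fix e assume e: "e \<in> carrier A" "e \<otimes>\<^bsub>A\<^esub> e = e"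
  interpret A: nonunital_ring A by fact
  interpret S: nonunital_ring "sided s A" by (rule nonunital_ring_sided) fact
  have e': "e \<in> carrier (sided s A)" "e \<otimes>\<^bsub>sided s A\<^esub> e = e" using e by (cases s; simp add: opposite_ring_def)+
  show "chain_ring c s (corner_ring A e)"
    unfolding chain_ring_def A.sided_corner_ring[OF e(1)]
    by (rule S.corner_chain_of_column_chain[OF e'])
      (rule categorically_chainD[OF cat S.column_module[OF e']])
qed

text \<open>A module over \<open>B\<close> becomes a module over \<open>A\<close> with the same submodules by restriction along the isomorphism.\<close>

lemma categorically_chain_isomorphic:
  assumes iso: "rng_isomorphic A B" and A: "nonunital_ring A" and cat: "categorically_chain c s A"
  shows "categorically_chain c s B"
  unfolding categorically_chain_def
proof (intro allI impI, elim conjE)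
  fix M :: "('c, (nat \<Rightarrow> 'c) set) module"
  assume un: "unitary_left_module (sided s B) M" and fg: "finitely_generated_module (sided s B) M"
  interpret M: left_module "sided s B" M using un by (simp add: unitary_left_module_def)
  interpret A: nonunital_ring "sided s A" by (rule nonunital_ring_sided[OF A])
  obtain h where h: "bij_betw h (carrier A) (carrier B)"
    "\<And>a b. a \<in> carrier A \<Longrightarrow> b \<in> carrier A \<Longrightarrow> h (a \<oplus>\<^bsub>A\<^esub> b) = h a \<oplus>\<^bsub>B\<^esub> h b"
    "\<And>a b. a \<in> carrier A \<Longrightarrow> b \<in> carrier A \<Longrightarrow> h (a \<otimes>\<^bsub>sided s A\<^esub> b) = h a \<otimes>\<^bsub>sided s B\<^esub> h b"
    using rng_isomorphic_sided[OF iso, of s] by (auto simp: rng_isomorphic_def)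
  have hc: "h a \<in> carrier B" if "a \<in> carrier A" for a using h(1) that by (auto simp: bij_betw_def)
  have img: "h ` carrier A = carrier B" using h(1) by (simp add: bij_betw_def)
  define N :: "('a, (nat \<Rightarrow> 'c) set) module" where "N = \<lparr>carrier = carrier M, mult = undefined,
    one = undefined, zero = \<zero>\<^bsub>M\<^esub>, add = add M, smult = (\<lambda>a x. h a \<odot>\<^bsub>M\<^esub> x)\<rparr>"
  have N_sel [simp]: "carrier N = carrier M" "add N = add M" "\<zero>\<^bsub>N\<^esub> = \<zero>\<^bsub>M\<^esub>"
    "smult N = (\<lambda>a x. h a \<odot>\<^bsub>M\<^esub> x)" by (simp_all add: N_def)
  have "abelian_group N"
  proof (rule abelian_groupI)
    show "\<exists>y\<in>carrier N. y \<oplus>\<^bsub>N\<^esub> x = \<zero>\<^bsub>N\<^esub>" if "x \<in> carrier N" for x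
      using that by (intro bexI[of _ "\<ominus>\<^bsub>M\<^esub> x"]) (auto simp: M.l_neg)
  qed (auto simp: M.a_ac)
  then interpret N: abelian_group N .
  have lm: "left_module (sided s A) N"
    by unfold_locales
      (use hc M.smult_closed M.smult_l_distr M.smult_r_distr M.smult_assoc h in auto)
  interpret N: left_module "sided s A" N by (rule lm)
  have N_inv: "\<ominus>\<^bsub>N\<^esub> x = \<ominus>\<^bsub>M\<^esub> x" if "x \<in> carrier M" for x
    by (rule N.minus_equality) (use that in \<open>auto simp: M.l_neg\<close>)
  have add: "additive_subgroup H N \<longleftrightarrow> additive_subgroup H M" for H
    unfolding M.additive_subgroup_iff N.additive_subgroup_iff using N_inv by auto (metis subsetD)+
  have sub: "submodule H (sided s A) N \<longleftrightarrow> submodule H (sided s B) M" for H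
    unfolding M.submodule_iff N.submodule_iff add by (auto simp: img[symmetric])
  have "{a \<odot>\<^bsub>N\<^esub> x |a x. a \<in> carrier (sided s A) \<and> x \<in> carrier N} =
    {a \<odot>\<^bsub>M\<^esub> x |a x. a \<in> carrier (sided s B) \<and> x \<in> carrier M}"
    by (auto simp: img[symmetric])
  then have "unitary_left_module (sided s A) N"
    using un lm unfolding unitary_left_module_def add by simp
  moreover have "finitely_generated_module (sided s A) N"
    using fg unfolding finitely_generated_module_def sub by simp
  ultimately have "chain_module c (sided s A) N" by (rule categorically_chainD[OF cat])
  then show "chain_module c (sided s B) M" unfolding chain_module_def sub .
qed

text \<open>The left ideals \<open>A u\<^sub>n\<close> descend and the left ideals \<open>A (e - u\<^sub>n)\<close> ascend, and each of them determines
  \<open>u\<^sub>n\<close>. This treats both chain conditions with the same sequence of idempotents.\<close>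

lemma (in nonunital_ring) descending_idempotents_stabilize:
  fixes u :: "nat \<Rightarrow> 'a"
  assumes unit: "e \<in> carrier A" "\<And>a. a \<in> carrier A \<Longrightarrow> e \<otimes> a = a"
    and ch: "satisfies_chain c {I. left_ideal I A}"
    and u: "\<And>n. u n \<in> carrier A" "\<And>m n. n \<le> m \<Longrightarrow> u n \<otimes> u m = u m" "\<And>m n. n \<le> m \<Longrightarrow> u m \<otimes> u n = u m"
  shows "\<exists>n. \<forall>m\<ge>n. u m = u n"
proof (cases c)
  case Artinian
  define I where "I n = {a \<in> carrier A. a \<otimes> u n = a}" for n
  have "left_ideal (I n) A" for n
    using u(1) by (auto simp: left_ideal_iff I_def l_null l_distr l_minus m_closed m_assoc)
  moreover have "decseq I"
  proof (unfold decseq_def, intro allI impI subsetI)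
    fix n m a assume "n \<le> m" "a \<in> I m"
    then have a: "a \<in> carrier A" "a \<otimes> u m = a" by (auto simp: I_def)
    then have "a \<otimes> u n = a" using u(3)[OF \<open>n \<le> m\<close>] m_assoc[of a "u m" "u n"] u(1) by metis
    then show "a \<in> I n" using a by (simp add: I_def)
  qed
  ultimately obtain n where n: "\<forall>m\<ge>n. I m = I n"
    using ch[unfolded Artinian satisfies_chain.simps, rule_format, of I] by blast
  have "u m = u n" if "m \<ge> n" for m
  proof -
    have "u n \<in> I n" using u(1) u(2)[of n n] by (simp add: I_def)
    then have "u n \<in> I m" using n that by blast
    then show ?thesis using u(2)[OF that] by (simp add: I_def)
  qed
  then show ?thesis by blast
next
  case Noetherian
  define I where "I n = {a \<in> carrier A. a \<otimes> u n = \<zero>}" for n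
  have "left_ideal (I n) A" for n
    using u(1) by (auto simp: left_ideal_iff I_def l_null r_null l_distr l_minus m_closed m_assoc)
  moreover have "incseq I"
  proof (unfold incseq_def, intro allI impI subsetI)
    fix n m a assume "n \<le> m" "a \<in> I n"
    then have a: "a \<in> carrier A" "a \<otimes> u n = \<zero>" by (auto simp: I_def)
    then have "a \<otimes> u m = \<zero>" using u(2)[OF \<open>n \<le> m\<close>] m_assoc[of a "u n" "u m"] u(1) l_null by metis
    then show "a \<in> I m" using a by (simp add: I_def)
  qed
  ultimately obtain n where n: "\<forall>m\<ge>n. I m = I n"
    using ch[unfolded Noetherian satisfies_chain.simps, rule_format, of I] by blast
  have "u m = u n" if "m \<ge> n" for m
  proof -
    have "(e \<ominus> u m) \<otimes> u m = \<zero>"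
      using u unit u(2)[of m m] by (simp add: a_minus_def l_distr l_minus r_neg)
    then have "e \<ominus> u m \<in> I m" using unit u by (simp add: I_def)
    then have "e \<ominus> u m \<in> I n" using n that by blast
    then have "(e \<ominus> u m) \<otimes> u n = \<zero>" by (simp add: I_def)
    then have "u n \<oplus> \<ominus> (u m) = \<zero>"
      using u unit u(3)[OF that] by (simp add: a_minus_def l_distr l_minus)
    then show ?thesis using u(1) by (metis a_inv_closed minus_equality minus_minus)
  qed
  then show ?thesis by blast
qed

section \<open>Rings resembling sums of matrix rings\<close>

text \<open>For idempotents \<open>f\<close> and \<open>e\<close> this says that multiplication by \<open>f\<close> factors through the corner at \<open>e\<close>: an
  element fixed by \<open>f\<close> is recovered by \<open>p\<close> from its image under \<open>q\<close>, which is fixed by \<open>e\<close>.\<close>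

definition factors_through :: "('a, 'm) ring_scheme \<Rightarrow> 'a \<Rightarrow> 'a \<Rightarrow> bool"
  where "factors_through A f e \<longleftrightarrow>
    (\<exists>p\<in>carrier A. \<exists>q\<in>carrier A. p \<otimes>\<^bsub>A\<^esub> q = f \<and> e \<otimes>\<^bsub>A\<^esub> q = q)"

context left_module
begin

lemma mem_set_add: "x \<in> H <+>\<^bsub>M\<^esub> K \<longleftrightarrow> (\<exists>h\<in>H. \<exists>k\<in>K. x = h \<oplus> k)"
  by (auto simp: set_add_def set_mult_def)

lemma submodule_set_add:
  assumes "submodule H A M" "submodule K A M" shows "submodule (H <+>\<^bsub>M\<^esub> K) A M"
proof -
  have sub: "additive_subgroup H M" "additive_subgroup K M" using assms by (simp_all add: submodule_iff)
  have c: "h \<in> carrier M" "k \<in> carrier M" if "h \<in> H" "k \<in> K" for h k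
    using sub that by (auto simp: additive_subgroup_iff)
  show ?thesis unfolding submodule_iff
  proof (intro conjI ballI M.add_additive_subgroups sub)
    fix a x assume a: "a \<in> carrier A" and "x \<in> H <+>\<^bsub>M\<^esub> K"
    then obtain h k where hk: "h \<in> H" "k \<in> K" "x = h \<oplus> k" by (auto simp: mem_set_add)
    then have "a \<odot> x = a \<odot> h \<oplus> a \<odot> k" using a c smult_r_distr by simp
    moreover have "a \<odot> h \<in> H" "a \<odot> k \<in> K" using assms a hk by (auto simp: submodule_iff)
    ultimately show "a \<odot> x \<in> H <+>\<^bsub>M\<^esub> K" by (auto simp: mem_set_add)
  qed
qed

lemma submodule_cyclic:
  assumes m: "m \<in> carrier M" shows "submodule {b \<odot> m | b. b \<in> carrier A} A M"
  unfolding submodule_iff additive_subgroup_iff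
proof (intro conjI ballI)
  show "{b \<odot> m |b. b \<in> carrier A} \<subseteq> carrier M" using m smult_closed by auto
  show "\<zero> \<in> {b \<odot> m |b. b \<in> carrier A}"
    using smult_zero_left[OF m] A.zero_closed by (metis (mono_tags, lifting) mem_Collect_eq)
  show "x \<oplus> y \<in> {b \<odot> m |b. b \<in> carrier A}"
    if "x \<in> {b \<odot> m |b. b \<in> carrier A}" "y \<in> {b \<odot> m |b. b \<in> carrier A}" for x y
    using that m by clarsimp (metis smult_l_distr A.a_closed)
  show "\<ominus> x \<in> {b \<odot> m |b. b \<in> carrier A}" if "x \<in> {b \<odot> m |b. b \<in> carrier A}" for x
    using that m by clarsimp (metis smult_minus_left A.a_inv_closed)
  show "a \<odot> x \<in> {b \<odot> m |b. b \<in> carrier A}"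
    if "a \<in> carrier A" "x \<in> {b \<odot> m |b. b \<in> carrier A}" for a x
    using that m by clarsimp (metis smult_assoc A.m_closed)
qed

text \<open>The submodules \<open>A m\<^sub>1 + \<dots> + A m\<^sub>n\<close>, built one generator at a time because the submodules of a sum are
  compared by peeling off one generator after the other.\<close>

primrec list_span :: "'b list \<Rightarrow> 'b set" where
  "list_span [] = {\<zero>}"
| "list_span (m # ms) = {b \<odot> m | b. b \<in> carrier A} <+>\<^bsub>M\<^esub> list_span ms"

lemma submodule_list_span: "set ms \<subseteq> carrier M \<Longrightarrow> submodule (list_span ms) A M"
proof (induction ms)
  case Nil
  show ?case by (auto simp: submodule_iff additive_subgroup_iff smult_zero_right)
next
  case (Cons m ms)
  then show ?case using submodule_set_add[OF submodule_cyclic] by simp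
qed

lemma submodule_subset: "submodule K A M \<Longrightarrow> x \<in> K \<Longrightarrow> x \<in> carrier M"
  by (auto simp: submodule_iff additive_subgroup_iff)

lemma submodule_closed:
  assumes "submodule K A M"
  shows "\<zero> \<in> K" "x \<in> K \<Longrightarrow> y \<in> K \<Longrightarrow> x \<oplus> y \<in> K" "x \<in> K \<Longrightarrow> \<ominus> x \<in> K"
    "a \<in> carrier A \<Longrightarrow> x \<in> K \<Longrightarrow> a \<odot> x \<in> K"
  using assms by (auto simp: submodule_iff additive_subgroup_iff)

lemma list_span_append:
  assumes "set (ms @ ns) \<subseteq> carrier M"
  shows "list_span ms \<subseteq> list_span (ms @ ns)" "list_span ns \<subseteq> list_span (ms @ ns)"
proof -
  show "list_span ms \<subseteq> list_span (ms @ ns)" using assms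
  proof (induction ms)
    case Nil
    then show ?case using submodule_closed(1)[OF submodule_list_span[of ns]] by simp
  next
    case (Cons m ms)
    then have "list_span ms \<subseteq> list_span (ms @ ns)" by simp
    then show ?case unfolding list_span.simps append_Cons by (blast intro: mem_set_add[THEN iffD2] dest: mem_set_add[THEN iffD1])
  qed
  show "list_span ns \<subseteq> list_span (ms @ ns)" using assms
  proof (induction ms)
    case (Cons m ms)
    then have IH: "list_span ns \<subseteq> list_span (ms @ ns)" and m: "m \<in> carrier M"
      and c: "list_span (ms @ ns) \<subseteq> carrier M"
      using submodule_subset[OF submodule_list_span[of "ms @ ns"]] by auto
    show ?case
    proof
      fix x assume "x \<in> list_span ns"
      then have x: "x \<in> list_span (ms @ ns)" "x \<in> carrier M" using IH c by auto
      then have "x = \<zero>\<^bsub>A\<^esub> \<odot> m \<oplus> x" using m by (simp add: smult_zero_left)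
      then show "x \<in> list_span ((m # ms) @ ns)"
        using x(1) A.zero_closed unfolding list_span.simps append_Cons mem_set_add by blast
    qed
  qed simp
qed

lemma additive_subgroup_transporter:
  assumes "additive_subgroup X M" "m \<in> carrier M"
  shows "additive_subgroup {b \<in> carrier A. b \<odot> m \<in> X} A"
  using assms
  by (auto simp: A.additive_subgroup_iff_closed additive_subgroup_iff smult_zero_left smult_l_distr smult_minus_left)

text \<open>The set \<open>E\<close> stands for the diagonal matrix units of a sum of matrix rings and \<open>E'\<close> for a choice of one of
  them from each summand. The assumption on additive subgroups expresses that \<open>b\<close> is the sum of finitely many
  of its rows \<open>f b\<close> without naming the sum, and it has the same form for left and for right multiplication.

  By unitarity \<open>M = A m\<^sub>1 + \<dots> + A m\<^sub>n\<close> where \<open>m\<^sub>j\<close> is fixed by some \<open>e\<^sub>j \<in> E'\<close>. A submodule \<open>K\<close> yields the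
  left ideals \<open>{b \<in> e\<^sub>j A e\<^sub>j. b m\<^sub>j \<in> K + A m\<^sub>j\<^sub>+\<^sub>1 + \<dots> + A m\<^sub>n}\<close>, and comparable submodules with the same left
  ideals are equal.\<close>

theorem chain_module_if_matrix_like:
  assumes E: "E \<subseteq> carrier A" "E' \<subseteq> E" "\<And>f. f \<in> E \<Longrightarrow> f \<otimes>\<^bsub>A\<^esub> f = f"
    and detect: "\<And>b V. b \<in> carrier A \<Longrightarrow> additive_subgroup V A \<Longrightarrow>
      (\<And>f. f \<in> E \<Longrightarrow> f \<otimes>\<^bsub>A\<^esub> b \<in> V) \<Longrightarrow> b \<in> V"
    and link: "\<And>f e b. f \<in> E \<Longrightarrow> e \<in> E' \<Longrightarrow> b \<in> carrier A \<Longrightarrow>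
      f \<otimes>\<^bsub>A\<^esub> (b \<otimes>\<^bsub>A\<^esub> e) \<noteq> \<zero>\<^bsub>A\<^esub> \<Longrightarrow> factors_through A f e"
    and rep: "\<And>f. f \<in> E \<Longrightarrow> \<exists>e\<in>E'. factors_through A f e"
    and corner: "\<And>e. e \<in> E' \<Longrightarrow> satisfies_chain c {I. left_ideal I (corner_ring A e)}"
    and un: "unitary_left_module A M" and fg: "finitely_generated_module A M"
  shows "chain_module c A M"
proof -
  define good where "good ms \<longleftrightarrow> set ms \<subseteq> carrier M \<and> (\<forall>m\<in>set ms. \<exists>e\<in>E'. e \<odot> m = m)" for ms
  have good_append: "good (ms @ ns)" if "good ms" "good ns" for ms ns
    using that by (auto simp: good_def)
  have good_sub: "submodule (list_span ms) A M" if "good ms" for ms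
    using that submodule_list_span by (simp add: good_def)
  define X where "X = {x \<in> carrier M. \<exists>ms. good ms \<and> x \<in> list_span ms}"
  have X: "additive_subgroup X M"
    unfolding additive_subgroup_iff
  proof (intro conjI ballI)
    show "X \<subseteq> carrier M" by (auto simp: X_def)
    show "\<zero> \<in> X" unfolding X_def by (auto intro!: exI[of _ "[]"] simp: good_def)
    show "x \<oplus> y \<in> X" if xy: "x \<in> X" "y \<in> X" for x y
    proof -
      obtain ms ns where mn: "good ms" "good ns" "x \<in> list_span ms" "y \<in> list_span ns"
        using xy by (auto simp: X_def)
      then have "x \<in> list_span (ms @ ns)" "y \<in> list_span (ms @ ns)"
        using list_span_append[of ms ns] by (auto simp: good_def)
      then have "x \<oplus> y \<in> list_span (ms @ ns)"
        using submodule_closed(2) good_sub good_append mn by blast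
      then show ?thesis using good_append mn xy by (auto simp: X_def)
    qed
    show "\<ominus> x \<in> X" if "x \<in> X" for x
      using that submodule_closed(3) good_sub by (auto simp: X_def)
  qed
  have "{a \<odot> x | a x. a \<in> carrier A \<and> x \<in> carrier M} \<subseteq> X"
  proof clarify
    fix a x assume a: "a \<in> carrier A" and x: "x \<in> carrier M"
    have "a \<in> {b \<in> carrier A. b \<odot> x \<in> X}"
    proof (rule detect[OF a additive_subgroup_transporter[OF X x]])
      fix f assume f: "f \<in> E"
      obtain e p q where e: "e \<in> E'" and pq: "p \<in> carrier A" "q \<in> carrier A" "p \<otimes>\<^bsub>A\<^esub> q = f" "e \<otimes>\<^bsub>A\<^esub> q = q"
        using rep[OF f] by (auto simp: factors_through_def)
      define m where "m = q \<odot> (a \<odot> x)"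
      have ec: "e \<in> carrier A" "f \<in> carrier A" using E e f by auto
      have m: "m \<in> carrier M" using pq a x by (simp add: m_def smult_closed)
      have "e \<odot> m = m" using pq a x ec smult_assoc[of e q "a \<odot> x"] by (simp add: m_def smult_closed)
      then have "good [m]" using m e by (auto simp: good_def)
      moreover have "(f \<otimes>\<^bsub>A\<^esub> a) \<odot> x = p \<odot> m"
        using pq a x ec by (simp add: m_def smult_closed smult_assoc[symmetric] A.m_closed A.m_assoc[symmetric])
      moreover have "p \<odot> m \<in> list_span [m]"
        using pq m smult_closed[OF pq(1) m] by (force simp: mem_set_add)
      ultimately have "(f \<otimes>\<^bsub>A\<^esub> a) \<odot> x \<in> X" using pq m smult_closed by (auto simp: X_def)
      then show "f \<otimes>\<^bsub>A\<^esub> a \<in> {b \<in> carrier A. b \<odot> x \<in> X}" using a ec by (simp add: A.m_closed)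
    qed
    then show "a \<odot> x \<in> X" by simp
  qed
  from hull_minimal[OF this, of "\<lambda>N. additive_subgroup N M"] have all: "carrier M \<subseteq> X"
    using un X unfolding unitary_left_module_def by simp
  obtain S where S: "finite S" "S \<subseteq> carrier M" "(\<lambda>N. submodule N A M) hull S = carrier M"
    using fg by (auto simp: finitely_generated_module_def)
  have "\<exists>ms. good ms \<and> S \<subseteq> list_span ms" using S(1,2)
  proof (induction S)
    case empty
    then show ?case by (auto intro!: exI[of _ "[]"] simp: good_def)
  next
    case (insert x F)
    then obtain ms where ms: "good ms" "F \<subseteq> list_span ms" by auto
    obtain ns where ns: "good ns" "x \<in> list_span ns" using all insert.prems by (auto simp: X_def)
    have "insert x F \<subseteq> list_span (ms @ ns)"
      using list_span_append[of ms ns] ms ns by (auto simp: good_def)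
    then show ?case using good_append ms ns by blast
  qed
  then obtain ms where ms: "good ms" "S \<subseteq> list_span ms" by blast
  have span: "list_span ms = carrier M"
    using hull_minimal[OF ms(2), of "\<lambda>N. submodule N A M"] good_sub[OF ms(1)] S(3)
      submodule_subset[OF good_sub[OF ms(1)]] by auto
  define \<psi> where "\<psi> e m ns K = {b \<in> carrier (corner_ring A e). b \<odot> m \<in> K <+>\<^bsub>M\<^esub> list_span ns}" for e m ns K
  have good_drop: "good (drop j ms)" for j
    using ms(1) by (auto simp: good_def dest: in_set_dropD)
  obtain \<epsilon> where \<epsilon>: "\<epsilon> j \<in> E'" "\<epsilon> j \<odot> ms ! j = ms ! j" if "j < length ms" for j
  proof -
    have "\<forall>j. \<exists>e. j < length ms \<longrightarrow> e \<in> E' \<and> e \<odot> ms ! j = ms ! j"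
      using ms(1) by (metis good_def nth_mem)
    then show ?thesis using that by metis
  qed
  have E'c: "e \<in> carrier A" "e \<otimes>\<^bsub>A\<^esub> e = e" if "e \<in> E'" for e using E that by auto
  \<comment> \<open>Write an element of \<open>K'\<close> as \<open>b m + y\<close>. It suffices that every row \<open>f b\<close> sends \<open>m\<close> into \<open>K + list_span ns\<close>,
    and \<open>f b m\<close> is recovered by \<open>p\<close> from \<open>q b e m\<close>, where \<open>q b e\<close> lies in the corner.\<close>
  have determined: "K' \<inter> list_span ns \<subseteq> K"
    if "submodule K A M" "submodule K' A M" "K \<subseteq> K'" "good ns"
      "\<forall>j<length ns. \<exists>e\<in>E'. e \<odot> ns ! j = ns ! j \<and>
        \<psi> e (ns ! j) (drop (Suc j) ns) K = \<psi> e (ns ! j) (drop (Suc j) ns) K'" for K K' ns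
    using that
  proof (induction ns)
    case Nil
    then show ?case by (auto simp: submodule_closed)
  next
    case (Cons m ns)
    have ns: "good ns" "m \<in> carrier M" using Cons.prems(4) by (auto simp: good_def)
    have "\<forall>j<length ns. \<exists>e\<in>E'. e \<odot> ns ! j = ns ! j \<and>
        \<psi> e (ns ! j) (drop (Suc j) ns) K = \<psi> e (ns ! j) (drop (Suc j) ns) K'"
      using Cons.prems(5) by force
    then have IH: "K' \<inter> list_span ns \<subseteq> K" using Cons.IH Cons.prems ns by blast
    obtain e where e: "e \<in> E'" "e \<odot> m = m" "\<psi> e m ns K = \<psi> e m ns K'"
      using Cons.prems(5)[rule_format, of 0] by auto
    have S: "submodule (list_span ns) A M" using good_sub ns by blast
    have KS: "submodule (K <+>\<^bsub>M\<^esub> list_span ns) A M" and K'S: "submodule (K' <+>\<^bsub>M\<^esub> list_span ns) A M"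
      using submodule_set_add Cons.prems S by blast+
    show ?case
    proof
      fix x assume "x \<in> K' \<inter> list_span (m # ns)"
      then obtain b y where b: "b \<in> carrier A" and y: "y \<in> list_span ns"
        and x: "x \<in> K'" "x = b \<odot> m \<oplus> y"
        by (auto simp: mem_set_add)
      have c: "b \<odot> m \<in> carrier M" "y \<in> carrier M" "x \<in> carrier M"
        using b ns y S submodule_subset x(1) Cons.prems(2) by (auto simp: smult_closed)
      have "b \<odot> m = x \<oplus> \<ominus> y" using c x(2) by (simp add: M.a_assoc M.r_neg)
      then have bm: "b \<odot> m \<in> K' <+>\<^bsub>M\<^esub> list_span ns"
        using x(1) submodule_closed(3)[OF S y] by (auto simp: mem_set_add)
      have "b \<in> {b \<in> carrier A. b \<odot> m \<in> K <+>\<^bsub>M\<^esub> list_span ns}"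
      proof (rule detect[OF b additive_subgroup_transporter])
        show "additive_subgroup (K <+>\<^bsub>M\<^esub> list_span ns) M" using KS by (simp add: submodule_iff)
        fix f assume f: "f \<in> E"
        have fc: "f \<in> carrier A" "e \<in> carrier A" using E f e by auto
        have fb: "(f \<otimes>\<^bsub>A\<^esub> (b \<otimes>\<^bsub>A\<^esub> e)) \<odot> m = (f \<otimes>\<^bsub>A\<^esub> b) \<odot> m"
          using fc b ns e by (simp add: smult_assoc smult_closed A.m_closed)
        have "(f \<otimes>\<^bsub>A\<^esub> b) \<odot> m \<in> K <+>\<^bsub>M\<^esub> list_span ns"
        proof (cases "f \<otimes>\<^bsub>A\<^esub> (b \<otimes>\<^bsub>A\<^esub> e) = \<zero>\<^bsub>A\<^esub>")
          case True
          then have "(f \<otimes>\<^bsub>A\<^esub> b) \<odot> m = \<zero>" using fb ns by (simp add: smult_zero_left)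
          then show ?thesis using submodule_closed(1)[OF KS] by simp
        next
          case False
          then obtain p q where pq: "p \<in> carrier A" "q \<in> carrier A" "p \<otimes>\<^bsub>A\<^esub> q = f" "e \<otimes>\<^bsub>A\<^esub> q = q"
            using link[OF f e(1) b] by (auto simp: factors_through_def)
          define r where "r = q \<otimes>\<^bsub>A\<^esub> (b \<otimes>\<^bsub>A\<^esub> e)"
          have r: "r \<in> carrier A" using pq b fc by (simp add: r_def A.m_closed)
          have "e \<otimes>\<^bsub>A\<^esub> r = r" unfolding r_def
            using pq b fc by (simp add: A.m_closed A.m_assoc[symmetric])
          moreover have "r \<otimes>\<^bsub>A\<^esub> e = r" unfolding r_def
            using pq b fc E'c[OF e(1)] by (simp add: A.m_closed A.m_assoc)
          ultimately have rcorner: "r \<in> carrier (corner_ring A e)"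
            using r E'c[OF e(1)] by (simp add: A.carrier_corner)
          have "r \<odot> m = q \<odot> (b \<odot> m)"
            unfolding r_def using pq b fc ns e by (simp add: smult_assoc smult_closed A.m_closed)
          also have "\<dots> \<in> K' <+>\<^bsub>M\<^esub> list_span ns" using submodule_closed(4)[OF K'S pq(2) bm] .
          finally have "r \<in> \<psi> e m ns K'" using rcorner by (simp add: \<psi>_def)
          then have "r \<odot> m \<in> K <+>\<^bsub>M\<^esub> list_span ns" using e(3) by (auto simp: \<psi>_def)
          then have "p \<odot> (r \<odot> m) \<in> K <+>\<^bsub>M\<^esub> list_span ns" by (rule submodule_closed(4)[OF KS pq(1)])
          also have "p \<odot> (r \<odot> m) = (f \<otimes>\<^bsub>A\<^esub> (b \<otimes>\<^bsub>A\<^esub> e)) \<odot> m"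
          proof -
            have "p \<otimes>\<^bsub>A\<^esub> r = f \<otimes>\<^bsub>A\<^esub> (b \<otimes>\<^bsub>A\<^esub> e)"
              unfolding r_def pq(3)[symmetric] using pq b fc by (intro A.m_assoc[symmetric] A.m_closed)
            then show ?thesis using pq r ns smult_assoc[of p r m] by simp
          qed
          finally show ?thesis using fb by simp
        qed
        then show "f \<otimes>\<^bsub>A\<^esub> b \<in> {b \<in> carrier A. b \<odot> m \<in> K <+>\<^bsub>M\<^esub> list_span ns}"
          using fc b by (simp add: A.m_closed)
      qed (use ns in simp)
      then obtain k z where kz: "k \<in> K" "z \<in> list_span ns" "b \<odot> m = k \<oplus> z" by (auto simp: mem_set_add)
      have kzc: "k \<in> carrier M" "z \<in> carrier M"
        using kz submodule_subset[OF S] submodule_subset[OF Cons.prems(1)] by auto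
      have eq: "x = k \<oplus> (z \<oplus> y)" using x(2) kz(3) kzc c by (simp add: M.a_assoc)
      then have "z \<oplus> y = \<ominus> k \<oplus> x" using kzc c by (simp add: M.a_assoc[symmetric] M.l_neg)
      moreover have "\<ominus> k \<in> K'" using kz(1) submodule_closed(3)[OF Cons.prems(1)] Cons.prems(3) by auto
      ultimately have "z \<oplus> y \<in> K'" using submodule_closed(2)[OF Cons.prems(2)] x(1) by simp
      moreover have "z \<oplus> y \<in> list_span ns" using submodule_closed(2)[OF S kz(2) y] .
      ultimately have "z \<oplus> y \<in> K" using IH by blast
      then show "x \<in> K" using eq submodule_closed(2)[OF Cons.prems(1) kz(1)] by simp
    qed
  qed
  show ?thesis unfolding chain_module_def
  proof (rule satisfies_chain_embed[where I = "{..<length ms}"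
      and L' = "\<lambda>j. {I. left_ideal I (corner_ring A (\<epsilon> j))}"
      and \<phi> = "\<lambda>j. \<psi> (\<epsilon> j) (ms ! j) (drop (Suc j) ms)"])
    fix j assume "j \<in> {..<length ms}"
    then show "satisfies_chain c {I. left_ideal I (corner_ring A (\<epsilon> j))}" using corner \<epsilon> by simp
  next
    fix j and K :: "'b set" assume j: "j \<in> {..<length ms}" and K: "K \<in> {N. submodule N A M}"
    define e where "e = \<epsilon> j"
    have e: "e \<in> E'" using \<epsilon> j by (simp add: e_def)
    interpret C: nonunital_ring "corner_ring A e" by (rule A.corner_nonunital_ring[OF E'c[OF e]])
    have m: "ms ! j \<in> carrier M" using j ms(1) by (auto simp: good_def)
    define T where "T = K <+>\<^bsub>M\<^esub> list_span (drop (Suc j) ms)"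
    have T: "submodule T A M"
      unfolding T_def using K good_drop good_sub by (intro submodule_set_add) auto
    have cc: "b \<in> carrier A" if "b \<in> carrier (corner_ring A e)" for b
      using that E'c[OF e] by (simp add: A.carrier_corner)
    have "left_ideal {b \<in> carrier (corner_ring A e). b \<odot> ms ! j \<in> T} (corner_ring A e)"
      unfolding C.left_ideal_iff
    proof (intro conjI ballI)
      show "\<zero>\<^bsub>corner_ring A e\<^esub> \<in> {b \<in> carrier (corner_ring A e). b \<odot> ms ! j \<in> T}"
        using C.zero_closed submodule_closed(1)[OF T] m by (simp add: smult_zero_left)
      fix x assume x: "x \<in> {b \<in> carrier (corner_ring A e). b \<odot> ms ! j \<in> T}"
      then have xc: "x \<in> carrier A" using cc by simp
      show "\<ominus>\<^bsub>corner_ring A e\<^esub> x \<in> {b \<in> carrier (corner_ring A e). b \<odot> ms ! j \<in> T}"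
        using x C.a_inv_closed[of x] A.corner_a_inv[OF E'c[OF e], of x] xc m submodule_closed(3)[OF T]
        by (simp add: smult_minus_left)
      show "x \<oplus>\<^bsub>corner_ring A e\<^esub> y \<in> {b \<in> carrier (corner_ring A e). b \<odot> ms ! j \<in> T}"
        if y: "y \<in> {b \<in> carrier (corner_ring A e). b \<odot> ms ! j \<in> T}" for y
        using x y C.a_closed[of x y] cc[of y] xc m submodule_closed(2)[OF T]
        by (simp add: smult_l_distr)
      show "a \<otimes>\<^bsub>corner_ring A e\<^esub> x \<in> {b \<in> carrier (corner_ring A e). b \<odot> ms ! j \<in> T}"
        if a: "a \<in> carrier (corner_ring A e)" for a
        using x a C.m_closed[of a x] cc[of a] xc m submodule_closed(4)[OF T]
        by (simp add: smult_assoc)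
    qed auto
    then show "\<psi> (\<epsilon> j) (ms ! j) (drop (Suc j) ms) K \<in> {I. left_ideal I (corner_ring A (\<epsilon> j))}"
      by (simp add: \<psi>_def T_def e_def)
  next
    fix j and K K' :: "'b set" assume "K \<subseteq> K'"
    then show "\<psi> (\<epsilon> j) (ms ! j) (drop (Suc j) ms) K \<subseteq> \<psi> (\<epsilon> j) (ms ! j) (drop (Suc j) ms) K'"
      by (auto simp: \<psi>_def mem_set_add)
  next
    fix K K' :: "'b set" assume K: "K \<in> {N. submodule N A M}" "K' \<in> {N. submodule N A M}" "K \<subseteq> K'"
      and eq: "\<And>j. j \<in> {..<length ms} \<Longrightarrow>
        \<psi> (\<epsilon> j) (ms ! j) (drop (Suc j) ms) K = \<psi> (\<epsilon> j) (ms ! j) (drop (Suc j) ms) K'"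
    have "K' \<inter> list_span ms \<subseteq> K"
    proof (rule determined)
      show "\<forall>j<length ms. \<exists>e\<in>E'. e \<odot> ms ! j = ms ! j \<and>
          \<psi> e (ms ! j) (drop (Suc j) ms) K = \<psi> e (ms ! j) (drop (Suc j) ms) K'"
        using eq \<epsilon> by (metis lessThan_iff)
    qed (use K ms(1) in auto)
    then show "K = K'" using K submodule_subset[of K'] by (auto simp: span)
  qed simp
qed

end

section \<open>Convolution on a groupoid\<close>

context groupoid
begin

lemma arrow_inv_props:
  assumes g: "g \<in> arrows G"
  shows "arrow_inv G g \<in> arrows G" "src G (arrow_inv G g) = tgt G g" "tgt G (arrow_inv G g) = src G g"
    "arrow_inv G g \<cdot> g = src G g" "g \<cdot> arrow_inv G g = tgt G g"
proof -
  let ?P = "\<lambda>h. h \<in> arrows G \<and> src G h = tgt G g \<and> tgt G h = src G g \<and> h \<cdot> g = src G g \<and> g \<cdot> h = tgt G g"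
  obtain h where h: "?P h" using ex_inverse[OF g] by auto
  have "k = h" if k: "?P k" for k
  proof -
    have "k = k \<cdot> (g \<cdot> h)" using k h cmp_src[of k] by metis
    also have "\<dots> = (k \<cdot> g) \<cdot> h" using k h g cmp_assoc[of k g h] by metis
    also have "\<dots> = h" using k h tgt_cmp_self[of h] by metis
    finally show ?thesis .
  qed
  then have "?P (arrow_inv G g)" unfolding arrow_inv_def using h by (intro theI[of ?P h]) blast+
  then show "arrow_inv G g \<in> arrows G" "src G (arrow_inv G g) = tgt G g" "tgt G (arrow_inv G g) = src G g"
    "arrow_inv G g \<cdot> g = src G g" "g \<cdot> arrow_inv G g = tgt G g" by auto
qed

lemmas groupoid_simps = src_closed tgt_closed src_src tgt_src src_tgt tgt_tgt cmp_closed src_cmp tgt_cmp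
  cmp_src tgt_cmp_self arrow_inv_props

lemma inv_cmp_cancel:
  assumes g: "g \<in> arrows G" and h: "h \<in> arrows G"
  shows "tgt G g = tgt G h \<Longrightarrow> g \<cdot> (arrow_inv G g \<cdot> h) = h"
    and "src G g = tgt G h \<Longrightarrow> arrow_inv G g \<cdot> (g \<cdot> h) = h"
    and "src G g = src G h \<Longrightarrow> (g \<cdot> arrow_inv G h) \<cdot> h = g"
    and "src G g = tgt G h \<Longrightarrow> (g \<cdot> h) \<cdot> arrow_inv G h = g"
proof -
  note i = arrow_inv_props[OF g] arrow_inv_props[OF h]
  show "g \<cdot> (arrow_inv G g \<cdot> h) = h" if "tgt G g = tgt G h"
    using cmp_assoc[of g "arrow_inv G g" h] i g h that tgt_cmp_self[OF h] by simp
  show "arrow_inv G g \<cdot> (g \<cdot> h) = h" if "src G g = tgt G h"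
    using cmp_assoc[of "arrow_inv G g" g h] i g h that tgt_cmp_self[OF h] by simp
  show "(g \<cdot> arrow_inv G h) \<cdot> h = g" if "src G g = src G h"
    using cmp_assoc[of g "arrow_inv G h" h] i g h cmp_src[OF g] unfolding that by simp
  show "(g \<cdot> h) \<cdot> arrow_inv G h = g" if "src G g = tgt G h"
    using cmp_assoc[of g h "arrow_inv G h"] i g h cmp_src[OF g] unfolding that by simp
qed

lemma inv_unique:
  assumes "g \<in> arrows G" "h \<in> arrows G" "src G h = tgt G g" "h \<cdot> g = src G g"
  shows "arrow_inv G g = h"
proof -
  have "h = (h \<cdot> g) \<cdot> arrow_inv G g" using assms inv_cmp_cancel(4)[of h g] by simp
  then show ?thesis using assms(4) tgt_cmp_self[of "arrow_inv G g"] arrow_inv_props[OF assms(1)] by simp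
qed

lemma inv_inv: "g \<in> arrows G \<Longrightarrow> arrow_inv G (arrow_inv G g) = g"
  by (rule inv_unique) (auto simp: groupoid_simps)

lemma inv_cmp:
  assumes "g \<in> arrows G" "h \<in> arrows G" "src G g = tgt G h"
  shows "arrow_inv G (g \<cdot> h) = arrow_inv G h \<cdot> arrow_inv G g"
proof (rule inv_unique)
  have "(arrow_inv G h \<cdot> arrow_inv G g) \<cdot> (g \<cdot> h) = arrow_inv G h \<cdot> (arrow_inv G g \<cdot> (g \<cdot> h))"
    using assms by (intro cmp_assoc) (auto simp: groupoid_simps)
  then show "(arrow_inv G h \<cdot> arrow_inv G g) \<cdot> (g \<cdot> h) = src G (g \<cdot> h)"
    using assms by (simp add: inv_cmp_cancel groupoid_simps)
qed (use assms in \<open>auto simp: groupoid_simps\<close>)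

lemma unit_iff: "u \<in> unit_arrows G \<longleftrightarrow> u \<in> arrows G \<and> src G u = u" by (simp add: unit_arrows_def)

lemma unit_simps:
  assumes "u \<in> unit_arrows G"
  shows "u \<in> arrows G" "src G u = u" "tgt G u = u" "arrow_inv G u = u"
proof -
  show 1: "u \<in> arrows G" "src G u = u" using assms by (auto simp: unit_iff)
  show 2: "tgt G u = u" using 1 tgt_src by metis
  show "arrow_inv G u = u" by (rule inv_unique) (use 1 2 cmp_src[of u] in auto)
qed

lemma src_unit: "g \<in> arrows G \<Longrightarrow> src G g \<in> unit_arrows G"
  and tgt_unit: "g \<in> arrows G \<Longrightarrow> tgt G g \<in> unit_arrows G"
  by (auto simp: unit_iff groupoid_simps)

end

context abelian_monoid
begin

lemma finsum_support:
  assumes "finite Y" "{x \<in> X. f x \<noteq> \<zero>} \<subseteq> Y" "Y \<subseteq> X" "f \<in> Y \<rightarrow> carrier G"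
  shows "finsum G f {x \<in> X. f x \<noteq> \<zero>} = finsum G f Y"
  using assms by (intro add.finprod_mono_neutral_cong_left) auto

lemma finsum_swap:
  assumes "finite X" "finite Y" "\<And>x y. x \<in> X \<Longrightarrow> y \<in> Y \<Longrightarrow> f x y \<in> carrier G"
  shows "(\<Oplus>x\<in>X. \<Oplus>y\<in>Y. f x y) = (\<Oplus>y\<in>Y. \<Oplus>x\<in>X. f x y)"
  using assms(1,3)
proof (induction X)
  case empty
  then show ?case by simp
next
  case (insert x X)
  have "(\<Oplus>y\<in>Y. \<Oplus>x\<in>insert x X. f x y) = (\<Oplus>y\<in>Y. f x y \<oplus> (\<Oplus>x\<in>X. f x y))"
    using insert by (intro finsum_cong') (auto intro!: finsum_closed finsum_insert)
  also have "\<dots> = (\<Oplus>y\<in>Y. f x y) \<oplus> (\<Oplus>y\<in>Y. \<Oplus>x\<in>X. f x y)"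
    using insert by (intro finsum_addf) (auto intro!: finsum_closed)
  also have "\<dots> = (\<Oplus>x\<in>insert x X. \<Oplus>y\<in>Y. f x y)"
    using insert by (subst finsum_insert) (auto intro!: finsum_closed)
  finally show ?case by simp
qed

end

locale groupoid_coefficients = R?: cring R + G?: groupoid G
  for R :: "('r, 'm) ring_scheme" (structure) and G :: "'g groupoid"
begin

abbreviation Fun :: "('g \<Rightarrow> 'r) set" where "Fun \<equiv> arrows G \<rightarrow>\<^sub>E carrier R"
abbreviation conv where "conv \<equiv> groupoid_convolution R G"
abbreviation ginv where "ginv \<equiv> arrow_inv G"
abbreviation comp (infixl "\<star>" 70) where "comp \<equiv> cmp G"

text \<open>Functions with finite support on every source fibre play the role of column finite
  matrices.\<close>

definition fibre_finite :: "('g \<Rightarrow> 'r) set"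
  where "fibre_finite = {f \<in> Fun. \<forall>x. finite {g \<in> arrows G. src G g = x \<and> f g \<noteq> \<zero>}}"

definition conv_ring :: "('g \<Rightarrow> 'r) set \<Rightarrow> ('g \<Rightarrow> 'r) ring"
  where "conv_ring S = \<lparr>carrier = S, mult = conv, one = undefined, zero = (\<lambda>g\<in>arrows G. \<zero>),
    add = (\<lambda>f f'. \<lambda>g\<in>arrows G. f g \<oplus> f' g)\<rparr>"

lemma conv_ring_simps [simp]:
  "carrier (conv_ring S) = S" "mult (conv_ring S) = conv" "zero (conv_ring S) = (\<lambda>g\<in>arrows G. \<zero>)"
  "add (conv_ring S) = (\<lambda>f f'. \<lambda>g\<in>arrows G. f g \<oplus> f' g)"
  by (simp_all add: conv_ring_def)

lemma Fun_closed [simp, intro]: "f \<in> Fun \<Longrightarrow> g \<in> arrows G \<Longrightarrow> f g \<in> carrier R" by auto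

lemma Fun_eqI: "f \<in> Fun \<Longrightarrow> f' \<in> Fun \<Longrightarrow> (\<And>g. g \<in> arrows G \<Longrightarrow> f g = f' g) \<Longrightarrow> f = f'"
  by (rule PiE_ext)

lemma conv_term_closed:
  assumes "a \<in> Fun" "b \<in> Fun" "g \<in> arrows G" "h \<in> arrows G" "src G h = src G g"
  shows "a (g \<star> ginv h) \<otimes> b h \<in> carrier R"
  using assms by (intro m_closed Fun_closed) (auto simp: groupoid_simps)

lemma conv_in_Fun:
  assumes "a \<in> Fun" "b \<in> Fun" shows "conv a b \<in> Fun"
  unfolding groupoid_convolution_def using assms by (auto intro!: finsum_closed conv_term_closed)

lemma conv_eq_finsum:
  assumes "a \<in> Fun" "b \<in> Fun" "g \<in> arrows G" "finite Y"
    "Y \<subseteq> {h \<in> arrows G. src G h = src G g}"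
    "\<And>h. h \<in> arrows G \<Longrightarrow> src G h = src G g \<Longrightarrow> a (g \<star> ginv h) \<otimes> b h \<noteq> \<zero> \<Longrightarrow> h \<in> Y"
  shows "conv a b g = (\<Oplus>h\<in>Y. a (g \<star> ginv h) \<otimes> b h)"
proof -
  have "{h \<in> arrows G. src G h = src G g \<and> a (g \<star> ginv h) \<otimes> b h \<noteq> \<zero>} =
    {h \<in> {h \<in> arrows G. src G h = src G g}. a (g \<star> ginv h) \<otimes> b h \<noteq> \<zero>}" by auto
  moreover have "finsum R (\<lambda>h. a (g \<star> ginv h) \<otimes> b h) \<dots> = (\<Oplus>h\<in>Y. a (g \<star> ginv h) \<otimes> b h)"
    using assms by (intro finsum_support) (auto intro!: conv_term_closed)
  ultimately show ?thesis using assms(3) by (simp add: groupoid_convolution_def)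
qed

lemma conv_eq_zero:
  assumes "a \<in> Fun" "b \<in> Fun" "g \<in> arrows G"
    "\<And>h. h \<in> arrows G \<Longrightarrow> src G h = src G g \<Longrightarrow> a (g \<star> ginv h) \<otimes> b h = \<zero>"
  shows "conv a b g = \<zero>"
  using conv_eq_finsum[OF assms(1-3), of "{}"] assms(4) by auto

lemma conv_single_right:
  assumes "a \<in> Fun" "b \<in> Fun" "g \<in> arrows G" "u \<in> arrows G" "src G u = src G g"
    "\<And>h. h \<in> arrows G \<Longrightarrow> src G h = src G g \<Longrightarrow> h \<noteq> u \<Longrightarrow> b h = \<zero>"
  shows "conv a b g = a (g \<star> ginv u) \<otimes> b u"
proof -
  have "conv a b g = (\<Oplus>h\<in>{u}. a (g \<star> ginv h) \<otimes> b h)"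
  proof (rule conv_eq_finsum)
    fix h assume h: "h \<in> arrows G" "src G h = src G g" "a (g \<star> ginv h) \<otimes> b h \<noteq> \<zero>"
    have "a (g \<star> ginv h) \<in> carrier R" using h assms by (auto simp: groupoid_simps)
    then show "h \<in> {u}" using h assms(6)[of h] by (cases "h = u") auto
  qed (use assms in auto)
  then show ?thesis using conv_term_closed[OF assms(1-5)] by simp
qed

lemma conv_single_left:
  assumes "a \<in> Fun" "b \<in> Fun" "g \<in> arrows G" "u \<in> arrows G" "tgt G u = tgt G g"
    "\<And>h. h \<in> arrows G \<Longrightarrow> tgt G h = tgt G g \<Longrightarrow> h \<noteq> u \<Longrightarrow> a h = \<zero>"
  shows "conv a b g = a u \<otimes> b (ginv u \<star> g)"
proof -
  define v where "v = ginv u \<star> g"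
  have v: "v \<in> arrows G" "src G v = src G g" "tgt G v = src G u" "u \<star> v = g"
    using assms by (auto simp: v_def groupoid_simps inv_cmp_cancel)
  have gv: "g \<star> ginv v = u" using v assms inv_cmp_cancel(4)[of u v] by simp
  have "conv a b g = (\<Oplus>h\<in>{v}. a (g \<star> ginv h) \<otimes> b h)"
  proof (rule conv_eq_finsum)
    fix h assume h: "h \<in> arrows G" "src G h = src G g" "a (g \<star> ginv h) \<otimes> b h \<noteq> \<zero>"
    have "g \<star> ginv h = u"
    proof (rule ccontr)
      assume "g \<star> ginv h \<noteq> u"
      then have "a (g \<star> ginv h) = \<zero>" using h assms by (intro assms(6)) (auto simp: groupoid_simps)
      then show False using h assms by auto
    qed
    then have "u \<star> h = g" using inv_cmp_cancel(3)[of g h] h assms by simp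
    moreover have "src G u = tgt G h" using \<open>g \<star> ginv h = u\<close> h assms by (auto simp: groupoid_simps)
    ultimately have "h = v" using inv_cmp_cancel(2)[of u h] h assms by (simp add: v_def)
    then show "h \<in> {v}" by simp
  qed (use assms v in auto)
  then show ?thesis using v gv conv_term_closed[OF assms(1-3) v(1,2)] by (simp add: v_def[symmetric])
qed

lemma fibre_finiteD:
  assumes "f \<in> fibre_finite"
  shows "f \<in> Fun" "finite {g \<in> arrows G. src G g = x \<and> f g \<noteq> \<zero>}"
  using assms by (auto simp: fibre_finite_def)

lemma conv_eq_finsum_support:
  assumes "a \<in> Fun" "b \<in> fibre_finite" "g \<in> arrows G"
  shows "conv a b g = (\<Oplus>h\<in>{h \<in> arrows G. src G h = src G g \<and> b h \<noteq> \<zero>}. a (g \<star> ginv h) \<otimes> b h)"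
proof (rule conv_eq_finsum)
  fix h assume h: "h \<in> arrows G" "src G h = src G g" "a (g \<star> ginv h) \<otimes> b h \<noteq> \<zero>"
  have "a (g \<star> ginv h) \<in> carrier R" using h assms by (intro Fun_closed) (auto simp: groupoid_simps)
  then show "h \<in> {h \<in> arrows G. src G h = src G g \<and> b h \<noteq> \<zero>}" using h by auto
qed (use assms fibre_finiteD in auto)

lemma conv_support_fibre:
  assumes "a \<in> Fun" "b \<in> Fun" "g \<in> arrows G" "conv a b g \<noteq> \<zero>"
  obtains k h where "k \<in> arrows G" "h \<in> arrows G" "src G k = tgt G h" "k \<star> h = g" "a k \<noteq> \<zero>" "b h \<noteq> \<zero>"
proof -
  obtain h where h: "h \<in> arrows G" "src G h = src G g" "a (g \<star> ginv h) \<otimes> b h \<noteq> \<zero>"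
    using conv_eq_zero[OF assms(1-3)] assms(4) by blast
  have k: "g \<star> ginv h \<in> arrows G" "src G (g \<star> ginv h) = tgt G h" "(g \<star> ginv h) \<star> h = g"
    using h assms by (auto simp: groupoid_simps inv_cmp_cancel)
  moreover have "a (g \<star> ginv h) \<noteq> \<zero>" "b h \<noteq> \<zero>"
    using h k assms by (auto simp: Fun_closed)
  ultimately show thesis using that h by blast
qed

text \<open>The arrows that can contribute to a product on the fibre over \<open>x\<close>.\<close>

lemma finite_product_fibre:
  assumes "a \<in> fibre_finite" "b \<in> fibre_finite"
  shows "finite ((\<lambda>(h, k). k \<star> h) ` (SIGMA h:{h \<in> arrows G. src G h = x \<and> b h \<noteq> \<zero>}.
    {k \<in> arrows G. src G k = tgt G h \<and> a k \<noteq> \<zero>}))"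
  using assms fibre_finiteD(2) by (intro finite_imageI finite_SigmaI) auto

text \<open>Both sides are evaluated at \<open>g\<close> as sums over the finite set \<open>H \<times> L\<close>, where \<open>H\<close> is the support of \<open>c\<close> and
  \<open>L\<close> contains the support of \<open>b * c\<close>, each on the fibre of \<open>g\<close>. The inner product is reindexed by
  \<open>k = l h\<^sup>-\<^sup>1\<close>, after which only the order of summation differs.\<close>

lemma conv_assoc:
  assumes a: "a \<in> Fun" and b: "b \<in> fibre_finite" and c: "c \<in> fibre_finite"
  shows "conv (conv a b) c = conv a (conv b c)"
proof (rule Fun_eqI)
  have bF: "b \<in> Fun" and cF: "c \<in> Fun" using b c fibre_finiteD by auto
  show "conv (conv a b) c \<in> Fun" "conv a (conv b c) \<in> Fun" using a bF cF conv_in_Fun by auto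
  fix g assume g: "g \<in> arrows G"
  define H where "H = {h \<in> arrows G. src G h = src G g \<and> c h \<noteq> \<zero>}"
  define L where "L = (\<lambda>(h, k). k \<star> h) ` (SIGMA h:H. {k \<in> arrows G. src G k = tgt G h \<and> b k \<noteq> \<zero>})"
  have H: "finite H" using fibre_finiteD(2)[OF c] by (simp add: H_def)
  have L: "finite L" unfolding L_def H_def by (rule finite_product_fibre[OF b c])
  have LI: "k \<star> h \<in> L" if "h \<in> H" "k \<in> arrows G" "src G k = tgt G h" "b k \<noteq> \<zero>" for h k
    unfolding L_def using that by (intro image_eqI[of _ _ "(h, k)"]) auto
  have Hd: "h \<in> arrows G" "src G h = src G g" if "h \<in> H" for h using that by (auto simp: H_def)
  have Ld: "l \<in> arrows G" "src G l = src G g" if "l \<in> L" for l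
    using that by (auto simp: L_def H_def groupoid_simps)
  have cl: "a (g \<star> ginv l) \<in> carrier R" "b (l \<star> ginv h) \<in> carrier R" "c h \<in> carrier R" if "l \<in> L" "h \<in> H" for l h
    using a bF cF g Ld[OF that(1)] Hd[OF that(2)] by (auto intro!: Fun_closed simp: groupoid_simps)
  have inner: "conv a b (g \<star> ginv h) = (\<Oplus>l\<in>L. a (g \<star> ginv l) \<otimes> b (l \<star> ginv h))" if h: "h \<in> H" for h
  proof -
    have inj: "inj_on (\<lambda>l. l \<star> ginv h) L"
    proof (rule inj_onI)
      fix l l' assume "l \<in> L" "l' \<in> L" "l \<star> ginv h = l' \<star> ginv h"
      then show "l = l'" using inv_cmp_cancel(3)[of l h] inv_cmp_cancel(3)[of l' h] Ld Hd[OF h] by metis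
    qed
    have eq: "(g \<star> ginv h) \<star> ginv (l \<star> ginv h) = g \<star> ginv l" if l: "l \<in> L" for l
    proof -
      have "ginv (l \<star> ginv h) = h \<star> ginv l"
        using Ld[OF l] Hd[OF h] by (subst inv_cmp) (auto simp: groupoid_simps inv_inv)
      moreover have "(g \<star> ginv h) \<star> (h \<star> ginv l) = ((g \<star> ginv h) \<star> h) \<star> ginv l"
        using Ld[OF l] Hd[OF h] g by (subst cmp_assoc) (auto simp: groupoid_simps)
      ultimately show ?thesis using Hd[OF h] g by (simp add: inv_cmp_cancel)
    qed
    have "conv a b (g \<star> ginv h) = (\<Oplus>k\<in>(\<lambda>l. l \<star> ginv h) ` L. a ((g \<star> ginv h) \<star> ginv k) \<otimes> b k)"
    proof (rule conv_eq_finsum)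
      show "(\<lambda>l. l \<star> ginv h) ` L \<subseteq> {k \<in> arrows G. src G k = src G (g \<star> ginv h)}"
        using g Hd[OF h] Ld by (auto simp: groupoid_simps)
      fix k assume k: "k \<in> arrows G" "src G k = src G (g \<star> ginv h)" "a ((g \<star> ginv h) \<star> ginv k) \<otimes> b k \<noteq> \<zero>"
      have "a ((g \<star> ginv h) \<star> ginv k) \<in> carrier R"
        using a k g Hd[OF h] by (auto intro!: Fun_closed simp: groupoid_simps)
      then have "b k \<noteq> \<zero>" using k by auto
      moreover have "src G k = tgt G h" using k g Hd[OF h] by (auto simp: groupoid_simps)
      ultimately have "k \<star> h \<in> L" "(k \<star> h) \<star> ginv h = k"
        using LI[OF h] k Hd[OF h] by (auto simp: inv_cmp_cancel)
      then show "k \<in> (\<lambda>l. l \<star> ginv h) ` L" by force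
    qed (use a bF g L Hd[OF h] in \<open>auto simp: groupoid_simps\<close>)
    also have "\<dots> = (\<Oplus>l\<in>L. a ((g \<star> ginv h) \<star> ginv (l \<star> ginv h)) \<otimes> b (l \<star> ginv h))"
      using inj eq cl h by (subst finsum_reindex) (auto intro!: m_closed)
    also have "\<dots> = (\<Oplus>l\<in>L. a (g \<star> ginv l) \<otimes> b (l \<star> ginv h))"
      using eq cl h by (intro finsum_cong') (auto intro!: m_closed)
    finally show ?thesis .
  qed
  have "conv (conv a b) c g = (\<Oplus>h\<in>H. conv a b (g \<star> ginv h) \<otimes> c h)"
    unfolding H_def by (rule conv_eq_finsum_support) (use conv_in_Fun a bF c g in auto)
  also have "\<dots> = (\<Oplus>h\<in>H. \<Oplus>l\<in>L. a (g \<star> ginv l) \<otimes> b (l \<star> ginv h) \<otimes> c h)"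
  proof (rule finsum_cong'[OF refl])
    fix h assume h: "h \<in> H"
    have ch: "c h \<in> carrier R" using cF Hd[OF h] by auto
    show "conv a b (g \<star> ginv h) \<otimes> c h = (\<Oplus>l\<in>L. a (g \<star> ginv l) \<otimes> b (l \<star> ginv h) \<otimes> c h)"
      unfolding inner[OF h] using cl h ch L by (intro finsum_ldistr) auto
  qed (use cl in \<open>auto intro!: finsum_closed\<close>)
  also have "\<dots> = (\<Oplus>l\<in>L. \<Oplus>h\<in>H. a (g \<star> ginv l) \<otimes> b (l \<star> ginv h) \<otimes> c h)"
    using H L cl by (intro finsum_swap) auto
  also have "\<dots> = (\<Oplus>l\<in>L. a (g \<star> ginv l) \<otimes> conv b c l)"
  proof (rule finsum_cong'[OF refl])
    show "(\<lambda>l. a (g \<star> ginv l) \<otimes> conv b c l) \<in> L \<rightarrow> carrier R"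
      using a g conv_in_Fun[OF bF cF] Ld by (auto intro!: m_closed Fun_closed simp: groupoid_simps)
    fix l assume l: "l \<in> L"
    have "conv b c l = (\<Oplus>h\<in>H. b (l \<star> ginv h) \<otimes> c h)"
      using conv_eq_finsum_support[OF bF c Ld(1)[OF l]] Ld(2)[OF l] by (simp add: H_def)
    moreover have ne: "a (g \<star> ginv l) \<in> carrier R"
      using a g Ld[OF l] by (intro Fun_closed) (auto simp: groupoid_simps)
    moreover have "a (g \<star> ginv l) \<otimes> (\<Oplus>h\<in>H. b (l \<star> ginv h) \<otimes> c h) = (\<Oplus>h\<in>H. a (g \<star> ginv l) \<otimes> (b (l \<star> ginv h) \<otimes> c h))"
      using H ne cl[OF l] by (intro finsum_rdistr) auto
    moreover have "\<dots> = (\<Oplus>h\<in>H. a (g \<star> ginv l) \<otimes> b (l \<star> ginv h) \<otimes> c h)"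
      using cl[OF l] by (intro finsum_cong') (auto simp: m_assoc)
    ultimately show "(\<Oplus>h\<in>H. a (g \<star> ginv l) \<otimes> b (l \<star> ginv h) \<otimes> c h) = a (g \<star> ginv l) \<otimes> conv b c l" by simp
  qed
  also have "\<dots> = conv a (conv b c) g"
  proof (rule conv_eq_finsum[symmetric])
    fix l assume l: "l \<in> arrows G" "src G l = src G g" "a (g \<star> ginv l) \<otimes> conv b c l \<noteq> \<zero>"
    have "a (g \<star> ginv l) \<in> carrier R" using a g l by (intro Fun_closed) (auto simp: groupoid_simps)
    then have "conv b c l \<noteq> \<zero>" using l by auto
    then obtain k h where kh: "k \<in> arrows G" "h \<in> arrows G" "src G k = tgt G h" "k \<star> h = l" "b k \<noteq> \<zero>" "c h \<noteq> \<zero>"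
      using conv_support_fibre[OF bF cF l(1)] by blast
    moreover have "src G h = src G g" using kh l by (auto simp: groupoid_simps)
    ultimately show "l \<in> L" using LI[of h k] by (auto simp: H_def)
  qed (use a g L Ld conv_in_Fun[OF bF cF] in auto)
  finally show "conv (conv a b) c g = conv a (conv b c) g" .
qed

lemma fibre_finite_add:
  assumes "a \<in> fibre_finite" "b \<in> fibre_finite" shows "(\<lambda>g\<in>arrows G. a g \<oplus> b g) \<in> fibre_finite"
proof -
  have "finite {g \<in> arrows G. src G g = x \<and> (\<lambda>g\<in>arrows G. a g \<oplus> b g) g \<noteq> \<zero>}" for x
    by (rule finite_subset[OF _ finite_UnI[OF fibre_finiteD(2)[OF assms(1), of x] fibre_finiteD(2)[OF assms(2), of x]]])
      (use fibre_finiteD(1)[OF assms(1)] fibre_finiteD(1)[OF assms(2)] in \<open>auto simp: Fun_closed\<close>)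
  moreover have "(\<lambda>g\<in>arrows G. a g \<oplus> b g) \<in> Fun"
    using fibre_finiteD(1)[OF assms(1)] fibre_finiteD(1)[OF assms(2)] by auto
  ultimately show ?thesis by (simp add: fibre_finite_def)
qed

lemma conv_add_left:
  assumes "a \<in> Fun" "b \<in> Fun" "c \<in> fibre_finite"
  shows "conv (\<lambda>g\<in>arrows G. a g \<oplus> b g) c = (\<lambda>g\<in>arrows G. conv a c g \<oplus> conv b c g)"
proof (rule Fun_eqI)
  have cF: "c \<in> Fun" using assms fibre_finiteD by auto
  have abF: "(\<lambda>g\<in>arrows G. a g \<oplus> b g) \<in> Fun" using assms by auto
  show "conv (\<lambda>g\<in>arrows G. a g \<oplus> b g) c \<in> Fun" by (rule conv_in_Fun[OF abF cF])
  show "(\<lambda>g\<in>arrows G. conv a c g \<oplus> conv b c g) \<in> Fun"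
    using conv_in_Fun[OF assms(1) cF] conv_in_Fun[OF assms(2) cF] by auto
  fix g assume g: "g \<in> arrows G"
  define Y where "Y = {h \<in> arrows G. src G h = src G g \<and> c h \<noteq> \<zero>}"
  have cl: "a (g \<star> ginv h) \<in> carrier R" "b (g \<star> ginv h) \<in> carrier R" "c h \<in> carrier R" "g \<star> ginv h \<in> arrows G"
    if "h \<in> Y" for h
    using that assms cF g by (auto intro!: Fun_closed simp: groupoid_simps Y_def)
  have "conv (\<lambda>g\<in>arrows G. a g \<oplus> b g) c g = (\<Oplus>h\<in>Y. (\<lambda>g\<in>arrows G. a g \<oplus> b g) (g \<star> ginv h) \<otimes> c h)"
    unfolding Y_def by (rule conv_eq_finsum_support[OF abF assms(3) g])
  also have "\<dots> = (\<Oplus>h\<in>Y. a (g \<star> ginv h) \<otimes> c h \<oplus> b (g \<star> ginv h) \<otimes> c h)"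
    using cl by (intro finsum_cong') (auto simp: l_distr)
  also have "\<dots> = (\<Oplus>h\<in>Y. a (g \<star> ginv h) \<otimes> c h) \<oplus> (\<Oplus>h\<in>Y. b (g \<star> ginv h) \<otimes> c h)"
    using cl by (intro finsum_addf) auto
  also have "\<dots> = (\<lambda>g\<in>arrows G. conv a c g \<oplus> conv b c g) g"
    using g conv_eq_finsum_support[OF assms(1,3) g] conv_eq_finsum_support[OF assms(2,3) g] by (simp add: Y_def)
  finally show "conv (\<lambda>g\<in>arrows G. a g \<oplus> b g) c g = (\<lambda>g\<in>arrows G. conv a c g \<oplus> conv b c g) g" .
qed

lemma conv_add_right:
  assumes "c \<in> Fun" "a \<in> fibre_finite" "b \<in> fibre_finite"
  shows "conv c (\<lambda>g\<in>arrows G. a g \<oplus> b g) = (\<lambda>g\<in>arrows G. conv c a g \<oplus> conv c b g)"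
proof (rule Fun_eqI)
  have F: "a \<in> Fun" "b \<in> Fun" using assms fibre_finiteD by auto
  have abF: "(\<lambda>g\<in>arrows G. a g \<oplus> b g) \<in> Fun" using F by auto
  show "conv c (\<lambda>g\<in>arrows G. a g \<oplus> b g) \<in> Fun" by (rule conv_in_Fun[OF assms(1) abF])
  show "(\<lambda>g\<in>arrows G. conv c a g \<oplus> conv c b g) \<in> Fun"
    using conv_in_Fun[OF assms(1) F(1)] conv_in_Fun[OF assms(1) F(2)] by auto
  fix g assume g: "g \<in> arrows G"
  define Y where "Y = {h \<in> arrows G. src G h = src G g \<and> a h \<noteq> \<zero>} \<union> {h \<in> arrows G. src G h = src G g \<and> b h \<noteq> \<zero>}"
  have Y: "finite Y" "Y \<subseteq> {h \<in> arrows G. src G h = src G g}"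
    using fibre_finiteD(2) assms by (auto simp: Y_def)
  have cc: "c (g \<star> ginv h) \<in> carrier R" if "h \<in> arrows G" "src G h = src G g" for h
    using that assms g by (auto intro!: Fun_closed simp: groupoid_simps)
  have 1: "conv c a g = (\<Oplus>h\<in>Y. c (g \<star> ginv h) \<otimes> a h)"
    by (rule conv_eq_finsum[OF assms(1) F(1) g Y]) (use cc in \<open>auto simp: Y_def\<close>)
  have 2: "conv c b g = (\<Oplus>h\<in>Y. c (g \<star> ginv h) \<otimes> b h)"
    by (rule conv_eq_finsum[OF assms(1) F(2) g Y]) (use cc in \<open>auto simp: Y_def\<close>)
  have 3: "conv c (\<lambda>g\<in>arrows G. a g \<oplus> b g) g = (\<Oplus>h\<in>Y. c (g \<star> ginv h) \<otimes> (\<lambda>g\<in>arrows G. a g \<oplus> b g) h)"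
    by (rule conv_eq_finsum[OF assms(1) abF g Y]) (use cc in \<open>auto simp: Y_def\<close>)
  have cl: "c (g \<star> ginv h) \<in> carrier R" "a h \<in> carrier R" "b h \<in> carrier R" "h \<in> arrows G" if "h \<in> Y" for h
    using that Y(2) cc F by auto
  have "(\<Oplus>h\<in>Y. c (g \<star> ginv h) \<otimes> (\<lambda>g\<in>arrows G. a g \<oplus> b g) h) =
    (\<Oplus>h\<in>Y. c (g \<star> ginv h) \<otimes> a h \<oplus> c (g \<star> ginv h) \<otimes> b h)"
    using cl by (intro finsum_cong') (auto simp: r_distr)
  also have "\<dots> = (\<Oplus>h\<in>Y. c (g \<star> ginv h) \<otimes> a h) \<oplus> (\<Oplus>h\<in>Y. c (g \<star> ginv h) \<otimes> b h)"
    using cl by (intro finsum_addf) auto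
  finally show "conv c (\<lambda>g\<in>arrows G. a g \<oplus> b g) g = (\<lambda>g\<in>arrows G. conv c a g \<oplus> conv c b g) g"
    using g by (simp add: 1 2 3)
qed

lemma conv_ring_nonunital_ring:
  assumes S: "S \<subseteq> fibre_finite" "(\<lambda>g\<in>arrows G. \<zero>) \<in> S"
    "\<And>a b. a \<in> S \<Longrightarrow> b \<in> S \<Longrightarrow> (\<lambda>g\<in>arrows G. a g \<oplus> b g) \<in> S"
    "\<And>a. a \<in> S \<Longrightarrow> (\<lambda>g\<in>arrows G. \<ominus> a g) \<in> S"
    "\<And>a b. a \<in> S \<Longrightarrow> b \<in> S \<Longrightarrow> conv a b \<in> S"
  shows "nonunital_ring (conv_ring S)"
proof -
  have SF: "a \<in> fibre_finite" "a \<in> Fun" if "a \<in> S" for a using that S(1) fibre_finiteD by auto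
  have "abelian_group (conv_ring S)"
  proof (rule abelian_groupI)
    fix a b c assume a: "a \<in> carrier (conv_ring S)"
    then have aS: "a \<in> S" by simp
    note aF = SF(2)[OF aS]
    show "\<zero>\<^bsub>conv_ring S\<^esub> \<oplus>\<^bsub>conv_ring S\<^esub> a = a"
      by (rule Fun_eqI) (use aF in auto)
    show "\<exists>b\<in>carrier (conv_ring S). b \<oplus>\<^bsub>conv_ring S\<^esub> a = \<zero>\<^bsub>conv_ring S\<^esub>"
    proof (rule bexI)
      show "(\<lambda>g\<in>arrows G. \<ominus> a g) \<oplus>\<^bsub>conv_ring S\<^esub> a = \<zero>\<^bsub>conv_ring S\<^esub>"
        by (rule Fun_eqI) (use aF in \<open>auto simp: l_neg\<close>)
    qed (use S(4)[OF aS] in simp)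
    assume "b \<in> carrier (conv_ring S)"
    then have bS: "b \<in> S" by simp
    note bF = SF(2)[OF bS]
    show "a \<oplus>\<^bsub>conv_ring S\<^esub> b \<in> carrier (conv_ring S)" using aS bS S(3) by simp
    show "a \<oplus>\<^bsub>conv_ring S\<^esub> b = b \<oplus>\<^bsub>conv_ring S\<^esub> a"
      by (rule Fun_eqI) (use aF bF in \<open>auto simp: a_comm\<close>)
    assume "c \<in> carrier (conv_ring S)"
    then have cF: "c \<in> Fun" using SF(2) by simp
    show "a \<oplus>\<^bsub>conv_ring S\<^esub> b \<oplus>\<^bsub>conv_ring S\<^esub> c = a \<oplus>\<^bsub>conv_ring S\<^esub> (b \<oplus>\<^bsub>conv_ring S\<^esub> c)"
      by (rule Fun_eqI) (use aF bF cF in \<open>auto simp: a_assoc\<close>)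
  qed (use S(2) in simp)
  then show ?thesis
    by (intro nonunital_ring.intro nonunital_ring_axioms.intro)
      (use S(5) SF conv_assoc conv_add_left conv_add_right in auto)
qed

lemma conv_ring_a_inv:
  assumes "nonunital_ring (conv_ring S)" "S \<subseteq> Fun" "a \<in> S" "(\<lambda>g\<in>arrows G. \<ominus> a g) \<in> S"
  shows "\<ominus>\<^bsub>conv_ring S\<^esub> a = (\<lambda>g\<in>arrows G. \<ominus> a g)"
proof -
  interpret S: nonunital_ring "conv_ring S" by fact
  have aF: "a \<in> Fun" using assms by auto
  show ?thesis
  proof (rule S.minus_equality)
    show "(\<lambda>g\<in>arrows G. \<ominus> a g) \<oplus>\<^bsub>conv_ring S\<^esub> a = \<zero>\<^bsub>conv_ring S\<^esub>"
      by (rule Fun_eqI) (use aF in \<open>auto simp: l_neg\<close>)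
  qed (use assms in simp_all)
qed

end

section \<open>The algebra of a discrete groupoid\<close>

lemma nonunital_ring_transport:
  assumes A: "nonunital_ring A" and h: "bij_betw h (carrier A) (carrier B)"
    "\<And>a b. a \<in> carrier A \<Longrightarrow> b \<in> carrier A \<Longrightarrow> h (a \<oplus>\<^bsub>A\<^esub> b) = h a \<oplus>\<^bsub>B\<^esub> h b"
    "\<And>a b. a \<in> carrier A \<Longrightarrow> b \<in> carrier A \<Longrightarrow> h (a \<otimes>\<^bsub>A\<^esub> b) = h a \<otimes>\<^bsub>B\<^esub> h b"
    "h \<zero>\<^bsub>A\<^esub> = \<zero>\<^bsub>B\<^esub>"
  shows "nonunital_ring B"
proof -
  interpret A: nonunital_ring A by fact
  have img: "carrier B = h ` carrier A" using h(1) by (simp add: bij_betw_def)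
  note hom = h(2)[symmetric] h(3)[symmetric] h(4)[symmetric]
  have "abelian_group B"
  proof (rule abelian_groupI)
    show "\<exists>y\<in>carrier B. y \<oplus>\<^bsub>B\<^esub> x = \<zero>\<^bsub>B\<^esub>" if "x \<in> carrier B" for x
    proof -
      obtain a where a: "a \<in> carrier A" "x = h a" using \<open>x \<in> carrier B\<close> img by auto
      then have "h (\<ominus>\<^bsub>A\<^esub> a) \<oplus>\<^bsub>B\<^esub> x = \<zero>\<^bsub>B\<^esub>" using hom by (simp add: A.l_neg)
      then show ?thesis using a img by auto
    qed
  qed (auto simp: img hom A.a_ac)
  then show ?thesis
    by (intro nonunital_ring.intro nonunital_ring_axioms.intro)
      (auto simp: img hom A.m_closed A.m_assoc A.l_distr A.r_distr)
qed

context groupoid_coefficients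
begin

definition finite_support :: "('g \<Rightarrow> 'r) set"
  where "finite_support = {f \<in> Fun. finite {g \<in> arrows G. f g \<noteq> \<zero>}}"

abbreviation chi :: "'g set \<Rightarrow> 'g \<Rightarrow> 'r" where "chi \<equiv> char_fun R (arrows G)"

text \<open>Convolution with the characteristic function of a set of units: from the left for \<open>\<pi> = tgt\<close>, from the right
  for \<open>\<pi> = src\<close>.\<close>

definition restrict_fibre :: "('g \<Rightarrow> 'g) \<Rightarrow> 'g set \<Rightarrow> ('g \<Rightarrow> 'r) \<Rightarrow> 'g \<Rightarrow> 'r"
  where "restrict_fibre \<pi> V f = (\<lambda>g\<in>arrows G. if \<pi> g \<in> V then f g else \<zero>)"

lemma chi_in_Fun [simp]: "chi U \<in> Fun" by (auto simp: char_fun_def)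

lemma chi_apply [simp]: "g \<in> arrows G \<Longrightarrow> chi U g = (if g \<in> U then \<one> else \<zero>)" by (simp add: char_fun_def)

lemma chi_outside [simp]: "g \<notin> arrows G \<Longrightarrow> chi U g = undefined" by (simp add: char_fun_def)

lemma restrict_fibre_in_Fun: "f \<in> Fun \<Longrightarrow> restrict_fibre \<pi> V f \<in> Fun"
  by (auto simp: restrict_fibre_def)

lemma conv_chi_left:
  assumes V: "V \<subseteq> unit_arrows G" and f: "f \<in> Fun"
  shows "conv (chi V) f = restrict_fibre (tgt G) V f"
proof (rule Fun_eqI)
  fix g assume g: "g \<in> arrows G"
  have t: "tgt G g \<in> unit_arrows G" using g by (rule tgt_unit)
  have "conv (chi V) f g = chi V (tgt G g) \<otimes> f (ginv (tgt G g) \<star> g)"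
  proof (rule conv_single_left)
    fix h assume h: "h \<in> arrows G" "tgt G h = tgt G g" "h \<noteq> tgt G g"
    have "h \<notin> V" using h V unit_simps(3) by auto
    then show "chi V h = \<zero>" using h by simp
  qed (use f g t unit_simps in auto)
  also have "ginv (tgt G g) \<star> g = g" using unit_simps(4)[OF t] tgt_cmp_self[OF g] by simp
  finally show "conv (chi V) f g = restrict_fibre (tgt G) V f g"
    using g f t unit_simps by (simp add: restrict_fibre_def Fun_closed)
qed (use f in \<open>auto intro!: conv_in_Fun restrict_fibre_in_Fun\<close>)

lemma conv_chi_right:
  assumes V: "V \<subseteq> unit_arrows G" and f: "f \<in> Fun"
  shows "conv f (chi V) = restrict_fibre (src G) V f"
proof (rule Fun_eqI)
  fix g assume g: "g \<in> arrows G"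
  have t: "src G g \<in> unit_arrows G" using g by (rule src_unit)
  have "conv f (chi V) g = f (g \<star> ginv (src G g)) \<otimes> chi V (src G g)"
  proof (rule conv_single_right)
    fix h assume h: "h \<in> arrows G" "src G h = src G g" "h \<noteq> src G g"
    have "h \<notin> V" using h V unit_simps(2) by auto
    then show "chi V h = \<zero>" using h by simp
  qed (use f g t unit_simps in auto)
  also have "g \<star> ginv (src G g) = g" using unit_simps(4)[OF t] cmp_src[OF g] by simp
  finally show "conv f (chi V) g = restrict_fibre (src G) V f g"
    using g f t unit_simps by (simp add: restrict_fibre_def Fun_closed)
qed (use f in \<open>auto intro!: conv_in_Fun restrict_fibre_in_Fun\<close>)

lemma conv_chi_chi:
  assumes U: "U \<subseteq> arrows G" and V: "V \<subseteq> arrows G" "inj_on (src G) V"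
  shows "conv (chi U) (chi V) = chi {u \<star> v | u v. u \<in> U \<and> v \<in> V \<and> src G u = tgt G v}"
proof (rule Fun_eqI)
  fix g assume g: "g \<in> arrows G"
  let ?W = "{u \<star> v | u v. u \<in> U \<and> v \<in> V \<and> src G u = tgt G v}"
  show "conv (chi U) (chi V) g = chi ?W g"
  proof (cases "\<exists>v\<in>V. src G v = src G g")
    case True
    then obtain v where v: "v \<in> V" "src G v = src G g" by blast
    have va: "v \<in> arrows G" using v V by auto
    have "conv (chi U) (chi V) g = chi U (g \<star> ginv v) \<otimes> chi V v"
    proof (rule conv_single_right)
      fix h assume h: "h \<in> arrows G" "src G h = src G g" "h \<noteq> v"
      then have "h \<notin> V" using v inj_onD[OF V(2), of h v] by auto
      then show "chi V h = \<zero>" using h by simp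
    qed (use g va v in auto)
    moreover have gv: "g \<star> ginv v \<in> arrows G" "src G (g \<star> ginv v) = tgt G v" "(g \<star> ginv v) \<star> v = g"
      using g va v by (auto simp: groupoid_simps inv_cmp_cancel)
    moreover have "g \<in> ?W \<longleftrightarrow> g \<star> ginv v \<in> U"
    proof
      assume "g \<in> ?W"
      then obtain u w where uw: "g = u \<star> w" "u \<in> U" "w \<in> V" "src G u = tgt G w" by auto
      have a: "u \<in> arrows G" "w \<in> arrows G" using uw U V by auto
      then have "src G w = src G v" using uw v by (simp add: groupoid_simps)
      then have "w = v" using uw v inj_onD[OF V(2), of w v] by auto
      then show "g \<star> ginv v \<in> U" using uw a inv_cmp_cancel(4)[of u v] by simp
    next
      assume "g \<star> ginv v \<in> U"
      then show "g \<in> ?W" using gv v by force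
    qed
    ultimately show ?thesis using g va v by simp
  next
    case False
    have "conv (chi U) (chi V) g = \<zero>"
    proof (rule conv_eq_zero)
      fix h assume h: "h \<in> arrows G" "src G h = src G g"
      then show "chi U (g \<star> ginv h) \<otimes> chi V h = \<zero>"
        using False g by (auto simp: groupoid_simps)
    qed (use g in auto)
    moreover have "g \<notin> ?W" using False U V g by (auto simp: groupoid_simps subset_iff)
    ultimately show ?thesis using chi_apply[OF g, of ?W] by metis
  qed
qed (auto intro!: conv_in_Fun)

lemma finite_supportD: "f \<in> finite_support \<Longrightarrow> f \<in> Fun" "f \<in> finite_support \<Longrightarrow> finite {g \<in> arrows G. f g \<noteq> \<zero>}"
  by (auto simp: finite_support_def)

lemma finite_supportI:
  assumes "f \<in> Fun" "finite S" "\<And>g. g \<in> arrows G \<Longrightarrow> f g \<noteq> \<zero> \<Longrightarrow> g \<in> S"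
  shows "f \<in> finite_support"
  unfolding finite_support_def using assms(1) finite_subset[OF _ assms(2), of "{g \<in> arrows G. f g \<noteq> \<zero>}"] assms(3)
  by auto

lemma finite_support_fibre_finite: "finite_support \<subseteq> fibre_finite"
proof
  fix f assume f: "f \<in> finite_support"
  have "finite {g \<in> arrows G. src G g = x \<and> f g \<noteq> \<zero>}" for x
    by (rule finite_subset[OF _ finite_supportD(2)[OF f]]) auto
  then show "f \<in> fibre_finite" using finite_supportD(1)[OF f] by (simp add: fibre_finite_def)
qed

lemma restrict_fibre_finite_support:
  assumes "f \<in> finite_support" shows "restrict_fibre \<pi> V f \<in> finite_support"
proof (rule finite_supportI)
  show "restrict_fibre \<pi> V f \<in> Fun" by (rule restrict_fibre_in_Fun[OF finite_supportD(1)[OF assms]])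
  show "finite {g \<in> arrows G. f g \<noteq> \<zero>}" by (rule finite_supportD(2)[OF assms])
qed (auto simp: restrict_fibre_def split: if_splits)

lemma conv_finite_support:
  assumes a: "a \<in> finite_support" and b: "b \<in> finite_support" shows "conv a b \<in> finite_support"
proof (rule finite_supportI)
  note F = finite_supportD(1)[OF a] finite_supportD(1)[OF b]
  show "conv a b \<in> Fun" using F by (rule conv_in_Fun)
  show "finite ((\<lambda>(k, h). k \<star> h) ` ({g \<in> arrows G. a g \<noteq> \<zero>} \<times> {g \<in> arrows G. b g \<noteq> \<zero>}))"
    using a b finite_supportD(2) by auto
  fix g assume g: "g \<in> arrows G" "conv a b g \<noteq> \<zero>"
  obtain k h where "k \<in> arrows G" "h \<in> arrows G" "k \<star> h = g" "a k \<noteq> \<zero>" "b h \<noteq> \<zero>"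
    using conv_support_fibre[OF F g] by blast
  then show "g \<in> (\<lambda>(k, h). k \<star> h) ` ({g \<in> arrows G. a g \<noteq> \<zero>} \<times> {g \<in> arrows G. b g \<noteq> \<zero>})"
    by force
qed

lemma finite_support_zero: "(\<lambda>g\<in>arrows G. \<zero>) \<in> finite_support"
  by (rule finite_supportI[of _ "{}"]) auto

lemma finite_support_add:
  assumes a: "a \<in> finite_support" and b: "b \<in> finite_support"
  shows "(\<lambda>g\<in>arrows G. a g \<oplus> b g) \<in> finite_support"
proof (rule finite_supportI)
  note F = finite_supportD(1)[OF a] finite_supportD(1)[OF b]
  show "(\<lambda>g\<in>arrows G. a g \<oplus> b g) \<in> Fun" using F by auto
  show "finite ({g \<in> arrows G. a g \<noteq> \<zero>} \<union> {g \<in> arrows G. b g \<noteq> \<zero>})"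
    using finite_supportD(2)[OF a] finite_supportD(2)[OF b] by simp
qed auto

lemma finite_support_uminus:
  assumes a: "a \<in> finite_support" shows "(\<lambda>g\<in>arrows G. \<ominus> a g) \<in> finite_support"
  by (rule finite_supportI[OF _ finite_supportD(2)[OF a]]) (use finite_supportD(1)[OF a] in auto)

lemma nonunital_ring_finite_support: "nonunital_ring (conv_ring finite_support)"
  by (rule conv_ring_nonunital_ring)
    (use finite_support_fibre_finite finite_support_zero finite_support_add finite_support_uminus
      conv_finite_support in auto)

lemma chi_finite_support: "finite U \<Longrightarrow> chi U \<in> finite_support"
  by (rule finite_supportI[of _ U]) (auto split: if_splits)

text \<open>A function with finite support is the sum of its restrictions to the finitely many fibres of \<open>\<pi>\<close> that it
  meets; the induction removes one fibre at a time.\<close>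

lemma detect_by_fibres:
  assumes V: "additive_subgroup V (conv_ring finite_support)" and b: "b \<in> finite_support"
    and r: "\<And>x. x \<in> unit_arrows G \<Longrightarrow> restrict_fibre \<pi> {x} b \<in> V"
    and \<pi>: "\<And>g. g \<in> arrows G \<Longrightarrow> \<pi> g \<in> unit_arrows G"
  shows "b \<in> V"
proof -
  interpret A: nonunital_ring "conv_ring finite_support" by (rule nonunital_ring_finite_support)
  have Vc: "(\<lambda>g\<in>arrows G. \<zero>) \<in> V" "\<And>a b. a \<in> V \<Longrightarrow> b \<in> V \<Longrightarrow> (\<lambda>g\<in>arrows G. a g \<oplus> b g) \<in> V"
    using V by (auto simp: A.additive_subgroup_iff_closed)
  have "\<forall>b. b \<in> finite_support \<longrightarrow> (\<forall>x\<in>unit_arrows G. restrict_fibre \<pi> {x} b \<in> V) \<longrightarrow>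
    \<pi> ` {g \<in> arrows G. b g \<noteq> \<zero>} \<subseteq> X \<longrightarrow> b \<in> V" if "finite X" for X
    using that
  proof (induction X)
    case empty
    show ?case
    proof (intro allI impI)
      fix b assume "b \<in> finite_support" "\<pi> ` {g \<in> arrows G. b g \<noteq> \<zero>} \<subseteq> {}"
      then have "b = (\<lambda>g\<in>arrows G. \<zero>)" using finite_supportD(1) by (intro Fun_eqI) auto
      then show "b \<in> V" using Vc by simp
    qed
  next
    case (insert x X)
    show ?case
    proof (intro allI impI)
      fix b assume b: "b \<in> finite_support" "\<forall>x\<in>unit_arrows G. restrict_fibre \<pi> {x} b \<in> V"
        "\<pi> ` {g \<in> arrows G. b g \<noteq> \<zero>} \<subseteq> insert x X"
      note bF = finite_supportD(1)[OF b(1)]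
      define b' where "b' = restrict_fibre \<pi> (- {x}) b"
      have b': "b' \<in> finite_support" unfolding b'_def by (rule restrict_fibre_finite_support[OF b(1)])
      have "restrict_fibre \<pi> {y} b' \<in> V" if y: "y \<in> unit_arrows G" for y
      proof (cases "y = x")
        case True
        then have "restrict_fibre \<pi> {y} b' = (\<lambda>g\<in>arrows G. \<zero>)"
          by (auto simp: restrict_fibre_def b'_def intro!: restrict_ext)
        then show ?thesis using Vc by simp
      next
        case False
        then have "restrict_fibre \<pi> {y} b' = restrict_fibre \<pi> {y} b"
          by (auto simp: restrict_fibre_def b'_def intro!: restrict_ext)
        then show ?thesis using b(2) y by simp
      qed
      moreover have "\<pi> ` {g \<in> arrows G. b' g \<noteq> \<zero>} \<subseteq> X"
        using b(3) by (auto simp: b'_def restrict_fibre_def split: if_splits)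
      ultimately have b'V: "b' \<in> V" using insert.IH b' by blast
      show "b \<in> V"
      proof (cases "x \<in> unit_arrows G")
        case True
        have "b = (\<lambda>g\<in>arrows G. b' g \<oplus> restrict_fibre \<pi> {x} b g)"
          by (rule Fun_eqI) (use bF in \<open>auto simp: b'_def restrict_fibre_def Fun_closed\<close>)
        then show ?thesis using Vc(2)[OF b'V] b(2) True by metis
      next
        case False
        then have "b = b'"
          by (intro Fun_eqI) (use bF \<pi> in \<open>auto simp: b'_def restrict_fibre_def Fun_closed\<close>)
        then show ?thesis using b'V by simp
      qed
    qed
  qed
  from this[of "\<pi> ` {g \<in> arrows G. b g \<noteq> \<zero>}"] show ?thesis
    using b r finite_supportD(2)[OF b] by blast
qed

lemma mult_sided_chi:
  assumes "x \<in> unit_arrows G" "f \<in> Fun"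
  shows "chi {x} \<otimes>\<^bsub>sided s (conv_ring S)\<^esub> f = restrict_fibre (case s of LeftSided \<Rightarrow> tgt G | RightSided \<Rightarrow> src G) {x} f"
    and "f \<otimes>\<^bsub>sided s (conv_ring S)\<^esub> chi {x} = restrict_fibre (case s of LeftSided \<Rightarrow> src G | RightSided \<Rightarrow> tgt G) {x} f"
  using assms conv_chi_left[of "{x}"] conv_chi_right[of "{x}"] by (cases s; simp add: opposite_ring_def)+

lemma chi_idempotent: "x \<in> unit_arrows G \<Longrightarrow> conv (chi {x}) (chi {x}) = chi {x}"
  by (subst conv_chi_left) (auto simp: restrict_fibre_def unit_simps intro!: Fun_eqI)

text \<open>The point masses at \<open>g\<close> and at its inverse multiply to the point mass at \<open>tgt g\<close>. In the opposite ring they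
  exchange their roles.\<close>

lemma chi_factors_through:
  assumes g: "g \<in> arrows G"
  shows "factors_through (sided s (conv_ring finite_support)) (chi {tgt G g}) (chi {src G g})"
proof -
  have u: "ginv g \<in> arrows G" "src G (ginv g) = tgt G g" "tgt G (ginv g) = src G g" "g \<star> ginv g = tgt G g"
    using g by (auto simp: groupoid_simps)
  have f: "chi {g} \<in> finite_support" "chi {ginv g} \<in> finite_support" by (simp_all add: chi_finite_support)
  have pq: "conv (chi {g}) (chi {ginv g}) = chi {tgt G g}"
  proof -
    have "{k \<star> h |k h. k \<in> {g} \<and> h \<in> {ginv g} \<and> src G k = tgt G h} = {tgt G g}" using u by auto
    then show ?thesis using conv_chi_chi[of "{g}" "{ginv g}"] g u by simp
  qed
  have su: "src G g \<in> unit_arrows G" using g by (rule src_unit)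
  have 1: "conv (chi {src G g}) (chi {ginv g}) = chi {ginv g}"
    using su u by (subst conv_chi_left) (auto simp: restrict_fibre_def intro!: Fun_eqI)
  have 2: "conv (chi {g}) (chi {src G g}) = chi {g}"
    using su u by (subst conv_chi_right) (auto simp: restrict_fibre_def intro!: Fun_eqI)
  show ?thesis
  proof (cases s)
    case LeftSided
    then show ?thesis unfolding factors_through_def using f pq 1
      by (intro bexI[of _ "chi {g}"] bexI[of _ "chi {ginv g}"]) auto
  next
    case RightSided
    then show ?thesis unfolding factors_through_def using f pq 2
      by (intro bexI[of _ "chi {ginv g}"] bexI[of _ "chi {g}"]) (auto simp: opposite_ring_def)
  qed
qed

lemma isotropy_carrier: "carrier (isotropy_group G x) = {g \<in> arrows G. src G g = x \<and> tgt G g = x}"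
  by (simp add: isotropy_group_def)

lemma isotropy_simps [simp]: "mult (isotropy_group G x) = cmp G" "\<one>\<^bsub>isotropy_group G x\<^esub> = x"
  by (simp_all add: isotropy_group_def)

lemma isotropy_is_group:
  assumes x: "x \<in> unit_arrows G" shows "group (isotropy_group G x)"
proof (rule groupI)
  show "\<exists>h\<in>carrier (isotropy_group G x). h \<otimes>\<^bsub>isotropy_group G x\<^esub> g = \<one>\<^bsub>isotropy_group G x\<^esub>"
    if "g \<in> carrier (isotropy_group G x)" for g
    using that by (intro bexI[of _ "ginv g"]) (auto simp: isotropy_carrier groupoid_simps)
  show "\<one>\<^bsub>isotropy_group G x\<^esub> \<otimes>\<^bsub>isotropy_group G x\<^esub> g = g" if "g \<in> carrier (isotropy_group G x)" for g
    using that tgt_cmp_self[of g] by (auto simp: isotropy_carrier)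
qed (use unit_simps[OF x] in \<open>auto simp: isotropy_carrier groupoid_simps cmp_assoc\<close>)

lemma isotropy_inv:
  assumes x: "x \<in> unit_arrows G" and g: "g \<in> carrier (isotropy_group G x)"
  shows "inv\<^bsub>isotropy_group G x\<^esub> g = ginv g"
proof -
  interpret H: group "isotropy_group G x" by (rule isotropy_is_group[OF x])
  show ?thesis
    by (rule H.inv_equality) (use g in \<open>auto simp: isotropy_carrier groupoid_simps\<close>)
qed

end

locale group_coefficients = R?: cring R + H?: group H
  for R :: "('r, 'm) ring_scheme" (structure) and H :: "('h, 'n) monoid_scheme"

text \<open>A group is a groupoid with one unit, so facts about convolution carry over to group rings.\<close>

definition one_object_groupoid :: "('h, 'n) monoid_scheme \<Rightarrow> 'h groupoid"
  where "one_object_groupoid H = \<lparr>arrows = carrier H, src = (\<lambda>_. \<one>\<^bsub>H\<^esub>), tgt = (\<lambda>_. \<one>\<^bsub>H\<^esub>), cmp = mult H\<rparr>"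

lemma one_object_groupoid_simps [simp]:
  "arrows (one_object_groupoid H) = carrier H" "src (one_object_groupoid H) g = \<one>\<^bsub>H\<^esub>"
  "tgt (one_object_groupoid H) g = \<one>\<^bsub>H\<^esub>" "cmp (one_object_groupoid H) = mult H"
  by (simp_all add: one_object_groupoid_def)

lemma (in group) groupoid_one_object: "groupoid (one_object_groupoid G)"
  by unfold_locales (auto simp: m_assoc intro!: bexI[of _ "inv _"])

lemma group_ring_simps [simp]:
  "carrier (group_ring R H) = {f \<in> carrier H \<rightarrow>\<^sub>E carrier R. finite {h \<in> carrier H. f h \<noteq> \<zero>\<^bsub>R\<^esub>}}"
  "zero (group_ring R H) = (\<lambda>h\<in>carrier H. \<zero>\<^bsub>R\<^esub>)"
  "add (group_ring R H) = (\<lambda>f f'. \<lambda>h\<in>carrier H. f h \<oplus>\<^bsub>R\<^esub> f' h)"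
  by (simp_all add: group_ring_def)

context group_coefficients
begin

sublocale OG: groupoid_coefficients R "one_object_groupoid H"
  by (intro groupoid_coefficients.intro R.cring_axioms H.groupoid_one_object)

lemma OG_inv: "h \<in> carrier H \<Longrightarrow> OG.ginv h = inv\<^bsub>H\<^esub> h"
  by (rule OG.inv_unique) auto

lemma group_ring_carrier: "carrier (group_ring R H) = OG.finite_support"
  by (simp add: OG.finite_support_def)

lemma group_ring_mult:
  assumes "a \<in> carrier H \<rightarrow>\<^sub>E carrier R" "b \<in> carrier H \<rightarrow>\<^sub>E carrier R"
  shows "a \<otimes>\<^bsub>group_ring R H\<^esub> b = OG.conv a b"
proof (rule OG.Fun_eqI)
  have eq: "(a \<otimes>\<^bsub>group_ring R H\<^esub> b) g = OG.conv a b g" if g: "g \<in> carrier H" for g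
  proof -
    have "{h \<in> carrier H. a (g \<otimes>\<^bsub>H\<^esub> inv\<^bsub>H\<^esub> h) \<otimes> b h \<noteq> \<zero>} =
      {h \<in> carrier H. a (g \<otimes>\<^bsub>H\<^esub> OG.ginv h) \<otimes> b h \<noteq> \<zero>}" using OG_inv by auto
    moreover have "a (g \<otimes>\<^bsub>H\<^esub> inv\<^bsub>H\<^esub> h) \<in> carrier R" "b h \<in> carrier R" if "h \<in> carrier H" for h
      using that assms g by auto
    ultimately show ?thesis
      using g by (auto simp: group_ring_def groupoid_convolution_def OG_inv intro!: R.finsum_cong')
  qed
  show 1: "OG.conv a b \<in> OG.Fun" using assms by (intro OG.conv_in_Fun) auto
  have "(a \<otimes>\<^bsub>group_ring R H\<^esub> b) g \<in> carrier R" if "g \<in> carrier H" for g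
    using eq[OF that] OG.Fun_closed[OF 1] that by simp
  then show "a \<otimes>\<^bsub>group_ring R H\<^esub> b \<in> OG.Fun" by (auto simp: group_ring_def)
  show "\<And>g. g \<in> arrows (one_object_groupoid H) \<Longrightarrow> (a \<otimes>\<^bsub>group_ring R H\<^esub> b) g = OG.conv a b g" using eq by simp
qed

lemma nonunital_group_ring: "nonunital_ring (group_ring R H)"
proof (rule nonunital_ring_transport[OF OG.nonunital_ring_finite_support, where h = "\<lambda>f. f"])
  show "bij_betw (\<lambda>f. f) (carrier (OG.conv_ring OG.finite_support)) (carrier (group_ring R H))"
    by (simp add: bij_betw_def OG.finite_support_def)
qed (use group_ring_mult OG.finite_supportD in auto)

end

context groupoid_coefficients
begin

lemma isotropy_group_coefficients: "x \<in> unit_arrows G \<Longrightarrow> group_coefficients R (isotropy_group G x)"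
  by (intro group_coefficients.intro isotropy_is_group) unfold_locales

text \<open>The corner consists of the functions that vanish outside the isotropy group at \<open>x\<close>.\<close>

lemma corner_isomorphic_group_ring:
  assumes x: "x \<in> unit_arrows G"
  shows "rng_isomorphic (corner_ring (conv_ring finite_support) (chi {x})) (group_ring R (isotropy_group G x))"
proof -
  let ?C = "corner_ring (conv_ring finite_support) (chi {x})" and ?I = "isotropy_group G x"
  interpret A: nonunital_ring "conv_ring finite_support" by (rule nonunital_ring_finite_support)
  interpret I: group_coefficients R ?I by (rule isotropy_group_coefficients[OF x])
  have I: "carrier ?I = {g \<in> arrows G. src G g = x \<and> tgt G g = x}" by (rule isotropy_carrier)
  have e: "chi {x} \<in> carrier (conv_ring finite_support)"
    "chi {x} \<otimes>\<^bsub>conv_ring finite_support\<^esub> chi {x} = chi {x}"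
    using x by (simp_all add: chi_finite_support chi_idempotent)
  have C: "f \<in> carrier ?C \<longleftrightarrow> f \<in> finite_support \<and> (\<forall>g\<in>arrows G. g \<notin> carrier ?I \<longrightarrow> f g = \<zero>)" for f
  proof
    assume "f \<in> carrier ?C"
    then have f: "f \<in> finite_support" "restrict_fibre (tgt G) {x} f = f" "restrict_fibre (src G) {x} f = f"
      using x finite_supportD(1) by (auto simp: A.carrier_corner[OF e] conv_chi_left conv_chi_right)
    have "f g = \<zero>" if "g \<in> arrows G" "g \<notin> carrier ?I" for g
      using fun_cong[OF f(2), of g] fun_cong[OF f(3), of g] that
      by (auto simp: restrict_fibre_def I split: if_splits)
    then show "f \<in> finite_support \<and> (\<forall>g\<in>arrows G. g \<notin> carrier ?I \<longrightarrow> f g = \<zero>)" using f by blast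
  next
    assume f: "f \<in> finite_support \<and> (\<forall>g\<in>arrows G. g \<notin> carrier ?I \<longrightarrow> f g = \<zero>)"
    then have fF: "f \<in> Fun" using finite_supportD by auto
    have "restrict_fibre (tgt G) {x} f = f"
      using f fF by (intro Fun_eqI restrict_fibre_in_Fun) (auto simp: restrict_fibre_def I)
    moreover have "restrict_fibre (src G) {x} f = f"
      using f fF by (intro Fun_eqI restrict_fibre_in_Fun) (auto simp: restrict_fibre_def I)
    ultimately show "f \<in> carrier ?C"
      using f fF x by (simp add: A.carrier_corner[OF e] conv_chi_left conv_chi_right)
  qed
  define h where "h f = restrict f (carrier ?I)" for f :: "'g \<Rightarrow> 'r"
  define k where "k f = (\<lambda>g\<in>arrows G. if g \<in> carrier ?I then f g else \<zero>)" for f :: "'g \<Rightarrow> 'r"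
  have hc: "h f \<in> carrier (group_ring R ?I)" if "f \<in> carrier ?C" for f
  proof -
    have f: "f \<in> Fun" "finite {g \<in> arrows G. f g \<noteq> \<zero>}" using that C finite_supportD by auto
    have "finite {g \<in> carrier ?I. h f g \<noteq> \<zero>}"
      by (rule finite_subset[OF _ f(2)]) (auto simp: h_def I)
    then show ?thesis using f(1) by (auto simp: h_def I)
  qed
  have kc: "k f \<in> carrier ?C" if "f \<in> carrier (group_ring R ?I)" for f
  proof -
    have "k f \<in> finite_support"
      by (rule finite_supportI[of _ "{g \<in> carrier ?I. f g \<noteq> \<zero>}"]) (use that in \<open>auto simp: k_def split: if_splits\<close>)
    then show ?thesis by (auto simp: C k_def)
  qed
  have bij: "bij_betw h (carrier ?C) (carrier (group_ring R ?I))"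
  proof (rule bij_betwI[where g = k])
    show "h \<in> carrier ?C \<rightarrow> carrier (group_ring R ?I)" using hc by blast
    show "k \<in> carrier (group_ring R ?I) \<rightarrow> carrier ?C" using kc by blast
    show "k (h f) = f" if "f \<in> carrier ?C" for f
    proof (rule Fun_eqI)
      show "k (h f) \<in> Fun" "f \<in> Fun" using kc[OF hc[OF that]] that C finite_supportD by auto
    qed (use that C in \<open>auto simp: k_def h_def\<close>)
    show "h (k f) = f" if "f \<in> carrier (group_ring R ?I)" for f
      by (rule I.OG.Fun_eqI) (use that hc[OF kc[OF that]] in \<open>auto simp: k_def h_def I\<close>)
  qed
  have add: "h (a \<oplus>\<^bsub>?C\<^esub> b) = h a \<oplus>\<^bsub>group_ring R ?I\<^esub> h b" if "a \<in> carrier ?C" "b \<in> carrier ?C" for a b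
    by (auto simp: h_def I)
  have mult: "h (a \<otimes>\<^bsub>?C\<^esub> b) = h a \<otimes>\<^bsub>group_ring R ?I\<^esub> h b" if ab: "a \<in> carrier ?C" "b \<in> carrier ?C" for a b
  proof
    fix g
    have F: "a \<in> Fun" "b \<in> Fun" and b0: "\<And>g. g \<in> arrows G \<Longrightarrow> g \<notin> carrier ?I \<Longrightarrow> b g = \<zero>"
      using ab C finite_supportD by auto
    show "h (a \<otimes>\<^bsub>?C\<^esub> b) g = (h a \<otimes>\<^bsub>group_ring R ?I\<^esub> h b) g"
    proof (cases "g \<in> carrier ?I")
      case False
      then show ?thesis by (simp add: h_def group_ring_def)
    next
      case g: True
      have ga: "g \<in> arrows G" "src G g = x" using g I by auto
      have cl: "a (g \<star> ginv h) \<in> carrier R" "b h \<in> carrier R" if "h \<in> arrows G" "src G h = x" for h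
        using that ga F by (auto intro!: Fun_closed simp: groupoid_simps)
      have gI: "g \<star> ginv k \<in> carrier ?I" if "k \<in> carrier ?I" for k
        using that g by (auto simp: I groupoid_simps)
      have "{h \<in> arrows G. src G h = src G g \<and> a (g \<star> ginv h) \<otimes> b h \<noteq> \<zero>} =
        {k \<in> carrier ?I. h a (g \<otimes>\<^bsub>?I\<^esub> inv\<^bsub>?I\<^esub> k) \<otimes> h b k \<noteq> \<zero>}" (is "?X = ?Y")
      proof (rule Set.set_eqI)
        fix k
        have "a (g \<star> ginv k) \<otimes> b k = \<zero>" if "k \<in> arrows G" "src G k = x" "k \<notin> carrier ?I"
          using cl that b0 by simp
        moreover have "h a (g \<otimes>\<^bsub>?I\<^esub> inv\<^bsub>?I\<^esub> k) \<otimes> h b k = a (g \<star> ginv k) \<otimes> b k" if "k \<in> carrier ?I"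
          using that gI isotropy_inv[OF x that] by (simp add: h_def)
        moreover have "k \<in> arrows G \<and> src G k = x" if "k \<in> carrier ?I" using that I by simp
        ultimately show "k \<in> ?X \<longleftrightarrow> k \<in> ?Y"
          using ga(2) by (cases "k \<in> carrier ?I") auto
      qed
      moreover have "finsum R (\<lambda>h. a (g \<star> ginv h) \<otimes> b h) ?Y = finsum R (\<lambda>k. h a (g \<otimes>\<^bsub>?I\<^esub> inv\<^bsub>?I\<^esub> k) \<otimes> h b k) ?Y"
      proof (rule finsum_cong'[OF refl])
        fix k assume "k \<in> ?Y"
        then have k: "k \<in> carrier ?I" by simp
        show "a (g \<star> ginv k) \<otimes> b k = h a (g \<otimes>\<^bsub>?I\<^esub> inv\<^bsub>?I\<^esub> k) \<otimes> h b k"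
          using k gI isotropy_inv[OF x k] by (simp add: h_def)
      next
        show "(\<lambda>k. h a (g \<otimes>\<^bsub>?I\<^esub> inv\<^bsub>?I\<^esub> k) \<otimes> h b k) \<in> ?Y \<rightarrow> carrier R"
          using gI isotropy_inv[OF x] cl I by (auto simp: h_def)
      qed
      ultimately show ?thesis using g ga by (simp add: h_def groupoid_convolution_def group_ring_def)
    qed
  qed
  show ?thesis unfolding rng_isomorphic_def using bij add mult by blast
qed

text \<open>The point masses at units serve as matrix units: two of them are linked exactly when an arrow joins the
  units, so it suffices that \<open>X\<close> meets every orbit.\<close>

theorem finite_support_categorically_chain:
  assumes X: "X \<subseteq> unit_arrows G"
    and rep: "\<And>y. y \<in> unit_arrows G \<Longrightarrow> \<exists>g\<in>arrows G. src G g \<in> X \<and> tgt G g = y"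
    and chain: "\<And>x. x \<in> X \<Longrightarrow> chain_ring c s (group_ring R (isotropy_group G x))"
  shows "categorically_chain c s (conv_ring finite_support)"
  unfolding categorically_chain_def
proof (intro allI impI, elim conjE)
  let ?A = "conv_ring finite_support"
  fix M :: "('g \<Rightarrow> 'r, (nat \<Rightarrow> 'g \<Rightarrow> 'r) set) module"
  assume un: "unitary_left_module (sided s ?A) M" and fg: "finitely_generated_module (sided s ?A) M"
  interpret A: nonunital_ring ?A by (rule nonunital_ring_finite_support)
  interpret M: left_module "sided s ?A" M using un by (simp add: unitary_left_module_def)
  let ?\<pi> = "case s of LeftSided \<Rightarrow> tgt G | RightSided \<Rightarrow> src G"
  let ?\<rho> = "case s of LeftSided \<Rightarrow> src G | RightSided \<Rightarrow> tgt G"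
  have unit: "x \<in> arrows G" if "x \<in> unit_arrows G" for x using that unit_simps by auto
  have fs: "chi {x} \<in> finite_support" for x by (simp add: chi_finite_support)
  show "chain_module c (sided s ?A) M"
  proof (rule M.chain_module_if_matrix_like[OF _ _ _ _ _ _ _ un fg,
        where E = "(\<lambda>x. chi {x}) ` unit_arrows G" and E' = "(\<lambda>x. chi {x}) ` X"])
    show "f \<otimes>\<^bsub>sided s ?A\<^esub> f = f" if "f \<in> (\<lambda>x. chi {x}) ` unit_arrows G" for f
      using that chi_idempotent by (cases s) (auto simp: opposite_ring_def)
    show "b \<in> V" if b: "b \<in> carrier (sided s ?A)" and V: "additive_subgroup V (sided s ?A)"
      and d: "\<And>f. f \<in> (\<lambda>x. chi {x}) ` unit_arrows G \<Longrightarrow> f \<otimes>\<^bsub>sided s ?A\<^esub> b \<in> V" for b V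
    proof (rule detect_by_fibres[where \<pi> = ?\<pi>])
      show "restrict_fibre ?\<pi> {x} b \<in> V" if "x \<in> unit_arrows G" for x
        using d[of "chi {x}"] that b mult_sided_chi(1)[OF that, of b] finite_supportD(1) by simp
      show "?\<pi> g \<in> unit_arrows G" if "g \<in> arrows G" for g
        using that src_unit tgt_unit by (cases s) auto
    qed (use b V in simp_all)
    show "factors_through (sided s ?A) f e"
      if asm: "f \<in> (\<lambda>x. chi {x}) ` unit_arrows G" "e \<in> (\<lambda>x. chi {x}) ` X" "b \<in> carrier (sided s ?A)"
        "f \<otimes>\<^bsub>sided s ?A\<^esub> (b \<otimes>\<^bsub>sided s ?A\<^esub> e) \<noteq> \<zero>\<^bsub>sided s ?A\<^esub>" for f e b
    proof -
      obtain x y where xy: "f = chi {y}" "e = chi {x}" "y \<in> unit_arrows G" "x \<in> unit_arrows G"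
        using asm(1,2) X by blast
      have bF: "b \<in> Fun" using asm(3) finite_supportD(1) by simp
      have "restrict_fibre ?\<pi> {y} (restrict_fibre ?\<rho> {x} b) \<noteq> (\<lambda>g\<in>arrows G. \<zero>)"
        using asm(4) unfolding xy mult_sided_chi(2)[OF xy(4) bF]
          mult_sided_chi(1)[OF xy(3) restrict_fibre_in_Fun[OF bF]] by simp
      then obtain g where g: "g \<in> arrows G" "?\<pi> g = y" "?\<rho> g = x"
        by (auto simp: restrict_fibre_def fun_eq_iff split: if_splits)
      obtain g' where g': "g' \<in> arrows G" "tgt G g' = y" "src G g' = x"
      proof (cases s)
        case LeftSided
        then show ?thesis using g that by auto
      next
        case RightSided
        then show ?thesis using g that[of "ginv g"] by (simp add: groupoid_simps)
      qed
      then show ?thesis using chi_factors_through[of g' s] xy by simp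
    qed
    show "\<exists>e\<in>(\<lambda>x. chi {x}) ` X. factors_through (sided s ?A) f e"
      if f: "f \<in> (\<lambda>x. chi {x}) ` unit_arrows G" for f
    proof -
      obtain y where y: "f = chi {y}" "y \<in> unit_arrows G" using f by auto
      then obtain g where "g \<in> arrows G" "src G g \<in> X" "tgt G g = y" using rep by blast
      then show ?thesis using chi_factors_through[of g s] y by auto
    qed
    show "satisfies_chain c {I. left_ideal I (corner_ring (sided s ?A) e)}" if ee: "e \<in> (\<lambda>x. chi {x}) ` X" for e
    proof -
      obtain x where x: "e = chi {x}" "x \<in> X" "x \<in> unit_arrows G" using ee X by auto
      interpret I: group_coefficients R "isotropy_group G x" by (rule isotropy_group_coefficients[OF x(3)])
      have "nonunital_ring (corner_ring ?A e)"
        by (rule A.corner_nonunital_ring) (use x fs chi_idempotent in simp_all)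
      then have "chain_ring c s (corner_ring ?A e)"
        using chain_ring_isomorphic[OF _ I.nonunital_group_ring] corner_isomorphic_group_ring[OF x(3)] chain[OF x(2)] x(1)
        by blast
      then show ?thesis
        unfolding chain_ring_def using A.sided_corner_ring[of e s] x fs by simp
    qed
  qed (use X fs in auto)
qed

end

section \<open>Compact open bisections\<close>

lemma local_homeomorphism_continuous:
  assumes "local_homeomorphism X Y f" shows "continuous_map X Y f"
  unfolding continuous_map_def
proof (intro conjI allI impI)
  have loc: "\<exists>U. x \<in> U \<and> openin X U \<and> openin Y (f ` U) \<and> continuous_map (subtopology X U) (subtopology Y (f ` U)) f"
    if "x \<in> topspace X" for x
    using assms that unfolding local_homeomorphism_def by (metis homeomorphic_imp_continuous_map)
  show "f \<in> topspace X \<rightarrow> topspace Y"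
  proof
    fix x assume "x \<in> topspace X"
    then obtain U where "x \<in> U" "openin Y (f ` U)" using loc by blast
    then show "f x \<in> topspace Y" using openin_subset by blast
  qed
  fix W assume W: "openin Y W"
  show "openin X {x \<in> topspace X. f x \<in> W}"
  proof (subst openin_subopen, intro ballI)
    fix x assume x: "x \<in> {x \<in> topspace X. f x \<in> W}"
    then obtain U where U: "x \<in> U" "openin X U" "openin Y (f ` U)"
      "continuous_map (subtopology X U) (subtopology Y (f ` U)) f" using loc by blast
    have UX: "U \<subseteq> topspace X" using U(2) openin_subset by blast
    have "openin (subtopology Y (f ` U)) (W \<inter> f ` U)" using W by (rule openin_subtopology_Int)
    from openin_continuous_map_preimage[OF U(4) this]
    have "openin X {u \<in> U. f u \<in> W \<inter> f ` U}"
      using U(2) UX by (simp add: openin_open_subtopology Int_absorb1 topspace_subtopology_subset)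
    moreover have "x \<in> {u \<in> U. f u \<in> W \<inter> f ` U}" using U(1) x by auto
    ultimately show "\<exists>T. openin X T \<and> x \<in> T \<and> T \<subseteq> {x \<in> topspace X. f x \<in> W}"
      using UX by (intro exI[of _ "{u \<in> U. f u \<in> W \<inter> f ` U}"]) auto
  qed
qed

lemma local_homeomorphism_open_image:
  assumes "local_homeomorphism X Y f" "openin X V" shows "openin Y (f ` V)"
proof (subst openin_subopen, intro ballI)
  fix y assume "y \<in> f ` V"
  then obtain x where x: "x \<in> V" "y = f x" by auto
  then have "x \<in> topspace X" using assms(2) openin_subset by blast
  then obtain U where U: "x \<in> U" "openin X U" "openin Y (f ` U)"
      "homeomorphic_map (subtopology X U) (subtopology Y (f ` U)) f"
    using assms(1) unfolding local_homeomorphism_def by blast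
  have "openin (subtopology X U) (V \<inter> U)" using assms(2) by (rule openin_subtopology_Int)
  then have "openin (subtopology Y (f ` U)) (f ` (V \<inter> U))"
    using homeomorphic_imp_open_map[OF U(4)] by (simp add: open_map_def)
  then have "openin Y (f ` (V \<inter> U))" using U(3) by (rule openin_trans_full)
  then show "\<exists>T. openin Y T \<and> y \<in> T \<and> T \<subseteq> f ` V"
    using x U(1) by (intro exI[of _ "f ` (V \<inter> U)"]) auto
qed

context ample_groupoid
begin

lemma continuous_src: "continuous_map T (subtopology T (unit_arrows G)) (src G)"
  and continuous_tgt: "continuous_map T (subtopology T (unit_arrows G)) (tgt G)"
  using local_homeomorphism_src local_homeomorphism_tgt local_homeomorphism_continuous by blast+

lemma continuous_src_T: "continuous_map T T (src G)" and continuous_tgt_T: "continuous_map T T (tgt G)"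
  using continuous_src continuous_tgt continuous_map_in_subtopology by blast+

lemma open_arrows: "openin T U \<Longrightarrow> U \<subseteq> arrows G"
  using openin_subset topspace_arrows by blast

text \<open>Near a unit \<open>x\<close> the source map is injective on an open \<open>U\<close>. If \<open>g\<close> and \<open>src g\<close> both lie in \<open>U\<close>, they have the
  same source and are therefore equal.\<close>

lemma open_units: "openin T (unit_arrows G)"
proof (subst openin_subopen, intro ballI)
  fix x assume x: "x \<in> unit_arrows G"
  then have "x \<in> topspace T" using unit_simps topspace_arrows by simp
  then obtain U where U: "x \<in> U" "openin T U"
      "homeomorphic_map (subtopology T U) (subtopology (subtopology T (unit_arrows G)) (src G ` U)) (src G)"
    using local_homeomorphism_src unfolding local_homeomorphism_def by blast
  have inj: "inj_on (src G) U"
    using homeomorphic_imp_injective_map[OF U(3)] openin_subset[OF U(2)] by (simp add: Int_absorb1)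
  let ?V = "{g \<in> U. src G g \<in> U}"
  have "openin T ?V" by (rule openin_continuous_map_preimage_gen[OF continuous_src_T U(2) U(2)])
  moreover have "x \<in> ?V" using U(1) unit_simps(2)[OF x] by simp
  moreover have "?V \<subseteq> unit_arrows G"
  proof
    fix g assume g: "g \<in> ?V"
    then have ga: "g \<in> arrows G" using open_arrows[OF U(2)] by auto
    then have "src G (src G g) = src G g" by (rule src_src)
    then have "src G g = g" using inj_onD[OF inj] g by auto
    then show "g \<in> unit_arrows G" using ga by (simp add: unit_iff)
  qed
  ultimately show "\<exists>V. openin T V \<and> x \<in> V \<and> V \<subseteq> unit_arrows G" by blast
qed

lemma open_in_units: "openin (subtopology T (unit_arrows G)) W \<Longrightarrow> openin T W"
  using open_units by (rule openin_trans_full[rotated])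

lemma open_tgt_image: "openin T U \<Longrightarrow> openin T (tgt G ` U)"
  using local_homeomorphism_open_image local_homeomorphism_tgt open_in_units by blast

lemma basis_neighbourhood:
  assumes "openin T W" "x \<in> W"
  obtains U where "compact_open_bisection G T U" "x \<in> U" "U \<subseteq> W"
proof -
  obtain \<U> where "\<U> \<subseteq> Collect (compact_open_bisection G T)" "\<Union>\<U> = W"
    using assms(1) basis by (auto simp: union_of_def arbitrary_def)
  then show thesis using that assms(2) by blast
qed

text \<open>On a bisection \<open>U\<close> the target map has a continuous inverse \<open>\<sigma>\<close>, and \<open>k\<close> lies in the product
  \<open>U V\<close> if and only if \<open>\<sigma> (tgt k)\<^sup>-\<^sup>1 k\<close> is defined and lies in \<open>V\<close>.\<close>

lemma open_bisection_product:
  assumes U: "openin T U" "inj_on (tgt G) U" and V: "openin T V"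
  shows "openin T {u \<cdot> v | u v. u \<in> U \<and> v \<in> V \<and> src G u = tgt G v}"
proof -
  have Ua: "U \<subseteq> arrows G" and Va: "V \<subseteq> arrows G" using U V open_arrows by auto
  define \<sigma> where "\<sigma> = inv_into U (tgt G)"
  have \<sigma>: "\<sigma> (tgt G u) = u" if "u \<in> U" for u using U(2) that by (simp add: \<sigma>_def)
  define D where "D = {k \<in> arrows G. tgt G k \<in> tgt G ` U}"
  have Dopen: "openin T D"
    using openin_continuous_map_preimage[OF continuous_tgt_T open_tgt_image[OF U(1)]]
    by (simp add: D_def topspace_arrows)
  have \<sigma>D: "\<sigma> (tgt G k) \<in> U" "tgt G (\<sigma> (tgt G k)) = tgt G k" if "k \<in> D" for k
    using that \<sigma> by (auto simp: D_def)
  have topD: "topspace (subtopology T D) = D" using openin_subset[OF Dopen] by (simp add: Int_absorb1)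
  have cont_\<sigma>: "continuous_map (subtopology T D) T (\<lambda>k. \<sigma> (tgt G k))"
    unfolding continuous_map_def topD
  proof (intro conjI allI impI)
    show "(\<lambda>k. \<sigma> (tgt G k)) \<in> D \<rightarrow> topspace T" using \<sigma>D Ua topspace_arrows by auto
    fix W assume W: "openin T W"
    have "openin T {k \<in> topspace T. tgt G k \<in> tgt G ` (U \<inter> W)}"
      by (intro openin_continuous_map_preimage[OF continuous_tgt_T] open_tgt_image openin_Int U W)
    moreover have "{k \<in> topspace T. tgt G k \<in> tgt G ` (U \<inter> W)} = {k \<in> D. \<sigma> (tgt G k) \<in> W}"
    proof (intro equalityI subsetI)
      fix k assume "k \<in> {k \<in> topspace T. tgt G k \<in> tgt G ` (U \<inter> W)}"
      then obtain u where "k \<in> arrows G" "u \<in> U" "u \<in> W" "tgt G k = tgt G u" by (auto simp: topspace_arrows)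
      then show "k \<in> {k \<in> D. \<sigma> (tgt G k) \<in> W}" using \<sigma> by (auto simp: D_def)
    next
      fix k assume k: "k \<in> {k \<in> D. \<sigma> (tgt G k) \<in> W}"
      then have "tgt G k = tgt G (\<sigma> (tgt G k))" "\<sigma> (tgt G k) \<in> U \<inter> W" using \<sigma>D by auto
      then show "k \<in> {k \<in> topspace T. tgt G k \<in> tgt G ` (U \<inter> W)}"
        using k by (auto simp: D_def topspace_arrows)
    qed
    ultimately show "openin (subtopology T D) {k \<in> D. \<sigma> (tgt G k) \<in> W}"
      using Dopen by (auto simp: openin_open_subtopology)
  qed
  let ?\<iota> = "\<lambda>k. arrow_inv G (\<sigma> (tgt G k))"
  have "continuous_map (subtopology T D) T ?\<iota>"
    using continuous_map_compose[OF cont_\<sigma> continuous_inv] by (simp add: o_def)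
  moreover have "continuous_map (subtopology T D) T (\<lambda>k. k)"
    using continuous_map_from_subtopology[OF continuous_map_id[of T]] by (simp add: id_def)
  ultimately have "continuous_map (subtopology T D) (prod_topology T T) (\<lambda>k. (?\<iota> k, k))"
    by (rule continuous_map_pairedI)
  moreover have "(\<lambda>k. (?\<iota> k, k)) \<in> topspace (subtopology T D) \<rightarrow> composable_pairs G"
  proof
    fix k assume "k \<in> topspace (subtopology T D)"
    then have k: "k \<in> D" by (simp add: topD)
    then have "k \<in> arrows G" "\<sigma> (tgt G k) \<in> arrows G" using \<sigma>D Ua by (auto simp: D_def)
    then show "(?\<iota> k, k) \<in> composable_pairs G"
      using \<sigma>D(2)[OF k] by (simp add: composable_pairs_def arrow_inv_props)
  qed
  ultimately have "continuous_map (subtopology T D) (subtopology (prod_topology T T) (composable_pairs G)) (\<lambda>k. (?\<iota> k, k))"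
    by (simp add: continuous_map_in_subtopology)
  from continuous_map_compose[OF this continuous_cmp]
  have "continuous_map (subtopology T D) T (\<lambda>k. ?\<iota> k \<cdot> k)" by (simp add: o_def)
  from openin_continuous_map_preimage[OF this V, unfolded topD]
  have "openin T {k \<in> D. ?\<iota> k \<cdot> k \<in> V}" using Dopen by (rule openin_trans_full)
  moreover have "{k \<in> D. ?\<iota> k \<cdot> k \<in> V} = {u \<cdot> v | u v. u \<in> U \<and> v \<in> V \<and> src G u = tgt G v}"
  proof (intro equalityI subsetI)
    fix k assume k: "k \<in> {k \<in> D. ?\<iota> k \<cdot> k \<in> V}"
    define u where "u = \<sigma> (tgt G k)"
    have u: "u \<in> U" "u \<in> arrows G" "k \<in> arrows G" "tgt G u = tgt G k"
      using k \<sigma>D[of k] Ua by (auto simp: u_def D_def)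
    have "k = u \<cdot> (arrow_inv G u \<cdot> k)" "src G u = tgt G (arrow_inv G u \<cdot> k)"
      using u by (simp_all add: inv_cmp_cancel groupoid_simps)
    then show "k \<in> {u \<cdot> v | u v. u \<in> U \<and> v \<in> V \<and> src G u = tgt G v}"
      using u k unfolding u_def by blast
  next
    fix k assume "k \<in> {u \<cdot> v | u v. u \<in> U \<and> v \<in> V \<and> src G u = tgt G v}"
    then obtain u v where uv: "k = u \<cdot> v" "u \<in> U" "v \<in> V" "src G u = tgt G v" by auto
    have a: "u \<in> arrows G" "v \<in> arrows G" using uv Ua Va by auto
    then show "k \<in> {k \<in> D. ?\<iota> k \<cdot> k \<in> V}"
      using uv \<sigma>[OF uv(2)] by (auto simp: D_def groupoid_simps inv_cmp_cancel)
  qed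
  ultimately show ?thesis by simp
qed

text \<open>The product is the image of \<open>(U \<times> V) \<inter> composable_pairs G\<close>, a closed part of a compact set: composability
  equates two continuous maps into the Hausdorff unit space. The space of arrows itself is not assumed to be
  Hausdorff.\<close>

lemma compact_product:
  assumes U: "compactin T U" and V: "compactin T V"
  shows "compactin T {u \<cdot> v | u v. u \<in> U \<and> v \<in> V \<and> src G u = tgt G v}"
proof -
  have Ua: "U \<subseteq> arrows G" "V \<subseteq> arrows G" using U V compactin_subset_topspace topspace_arrows by blast+
  have "continuous_map (prod_topology T T) (subtopology T (unit_arrows G)) (src G \<circ> fst)"
    "continuous_map (prod_topology T T) (subtopology T (unit_arrows G)) (tgt G \<circ> snd)"
    using continuous_map_compose[OF continuous_map_fst continuous_src]
      continuous_map_compose[OF continuous_map_snd continuous_tgt] by blast+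
  from closedin_continuous_maps_eq[OF Hausdorff_units this]
  have "closedin (prod_topology T T) (composable_pairs G)"
    by (rule back_subst[of "closedin (prod_topology T T)"])
      (auto simp: composable_pairs_def topspace_arrows)
  then have "compactin (prod_topology T T) ((U \<times> V) \<inter> composable_pairs G)"
    using U V by (intro compact_Int_closedin) (auto simp: compactin_Times)
  then have "compactin (subtopology (prod_topology T T) (composable_pairs G)) ((U \<times> V) \<inter> composable_pairs G)"
    by (simp add: compactin_subtopology)
  from image_compactin[OF this continuous_cmp]
  show ?thesis
    by (rule back_subst[of "compactin T"]) (use Ua in \<open>auto simp: composable_pairs_def image_iff\<close>)
qed

lemma compact_open_bisection_product:
  assumes U: "compact_open_bisection G T U" and V: "compact_open_bisection G T V"
  shows "compact_open_bisection G T {u \<cdot> v | u v. u \<in> U \<and> v \<in> V \<and> src G u = tgt G v}"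
proof -
  have Ua: "U \<subseteq> arrows G" "V \<subseteq> arrows G" using U V open_arrows by (auto simp: compact_open_bisection_def)
  have inj: "inj_on (src G) U" "inj_on (tgt G) U" "inj_on (src G) V" "inj_on (tgt G) V"
    using U V by (auto simp: compact_open_bisection_def)
  have "inj_on (src G) {u \<cdot> v | u v. u \<in> U \<and> v \<in> V \<and> src G u = tgt G v}"
  proof (rule inj_onI, clarify)
    fix u v u' v' assume uv: "u \<in> U" "v \<in> V" "src G u = tgt G v" "u' \<in> U" "v' \<in> V" "src G u' = tgt G v'"
      "src G (u \<cdot> v) = src G (u' \<cdot> v')"
    then have "src G v = src G v'" using Ua by (simp add: src_cmp subset_iff)
    then have "v = v'" using inj_onD[OF inj(3)] uv by blast
    then have "u = u'" using inj_onD[OF inj(1), of u u'] uv by simp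
    then show "u \<cdot> v = u' \<cdot> v'" using \<open>v = v'\<close> by simp
  qed
  moreover have "inj_on (tgt G) {u \<cdot> v | u v. u \<in> U \<and> v \<in> V \<and> src G u = tgt G v}"
  proof (rule inj_onI, clarify)
    fix u v u' v' assume uv: "u \<in> U" "v \<in> V" "src G u = tgt G v" "u' \<in> U" "v' \<in> V" "src G u' = tgt G v'"
      "tgt G (u \<cdot> v) = tgt G (u' \<cdot> v')"
    then have "tgt G u = tgt G u'" using Ua by (simp add: tgt_cmp subset_iff)
    then have "u = u'" using inj_onD[OF inj(2)] uv by blast
    then have "v = v'" using inj_onD[OF inj(4), of v v'] uv by simp
    then show "u \<cdot> v = u' \<cdot> v'" using \<open>u = u'\<close> by simp
  qed
  ultimately show ?thesis
    using open_bisection_product[of U V] compact_product[of U V] U V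
    unfolding compact_open_bisection_def by blast
qed

lemma isolated_unit:
  assumes x: "x \<in> V" and V: "compact_open_bisection G T V" "V \<subseteq> unit_arrows G"
    and min: "\<And>W. compact_open_bisection G T W \<Longrightarrow> x \<in> W \<Longrightarrow> W \<subseteq> V \<Longrightarrow> W = V"
  shows "V = {x}"
proof (rule ccontr)
  assume "V \<noteq> {x}"
  then obtain y where y: "y \<in> V" "y \<noteq> x" using x by auto
  have "topspace (subtopology T (unit_arrows G)) = unit_arrows G"
    using openin_subset[OF open_units] by (simp add: Int_absorb1)
  then obtain P Q where PQ: "openin (subtopology T (unit_arrows G)) P" "x \<in> P" "y \<in> Q" "disjnt P Q"
    using Hausdorff_units x y V(2) unfolding Hausdorff_space_def by (metis subsetD)
  have "openin T (P \<inter> V)" using open_in_units[OF PQ(1)] V(1) by (auto simp: compact_open_bisection_def)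
  then obtain W where W: "compact_open_bisection G T W" "x \<in> W" "W \<subseteq> P \<inter> V"
    using basis_neighbourhood[of "P \<inter> V" x] PQ(2) x by blast
  then have "W = V" using min by blast
  then show False using W(3) y PQ(3,4) by (auto simp: disjnt_iff)
qed

text \<open>The arrows of a bisection are separated by their sources.\<close>

lemma discrete_if_isolated_units:
  assumes "\<And>x. x \<in> unit_arrows G \<Longrightarrow> openin T {x}"
  shows "T = discrete_topology (arrows G)"
proof -
  have "openin T {g}" if g: "g \<in> arrows G" for g
  proof -
    have "openin T (arrows G)" using topspace_arrows openin_topspace by metis
    then obtain B where B: "compact_open_bisection G T B" "g \<in> B"
      using basis_neighbourhood g by blast
    have "openin T {k \<in> B. src G k \<in> {src G g}}"
      by (rule openin_continuous_map_preimage_gen[OF continuous_src_T])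
        (use B assms src_unit[OF g] in \<open>auto simp: compact_open_bisection_def\<close>)
    moreover have "{k \<in> B. src G k \<in> {src G g}} = {g}"
      using B by (auto simp: compact_open_bisection_def dest: inj_onD)
    ultimately show ?thesis by simp
  qed
  then have "discrete_topology (arrows G) = T" using topspace_arrows by (simp add: discrete_topology_unique)
  then show ?thesis by simp
qed

end

section \<open>The algebra of an ample groupoid\<close>

context groupoid_coefficients
begin

lemma left_module_function_module: "left_module R (function_module R (arrows G))"
proof -
  let ?M = "function_module R (arrows G)"
  have sel [simp]: "carrier ?M = Fun" "\<zero>\<^bsub>?M\<^esub> = (\<lambda>g\<in>arrows G. \<zero>)" "add ?M = (\<lambda>f f'. \<lambda>g\<in>arrows G. f g \<oplus> f' g)"
    "smult ?M = (\<lambda>r f. \<lambda>g\<in>arrows G. r \<otimes> f g)" by (simp_all add: function_module_def)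
  have "abelian_group ?M"
  proof (rule abelian_groupI)
    show "\<exists>y\<in>carrier ?M. y \<oplus>\<^bsub>?M\<^esub> x = \<zero>\<^bsub>?M\<^esub>" if "x \<in> carrier ?M" for x
      using that by (intro bexI[of _ "\<lambda>g\<in>arrows G. \<ominus> x g"]) (auto simp: l_neg intro!: restrict_ext)
  qed (auto simp: a_ac Fun_closed intro!: restrict_ext Fun_eqI)
  then interpret M: abelian_group ?M .
  show ?thesis
    by unfold_locales (auto simp: m_assoc l_distr r_distr Fun_closed intro!: restrict_ext)
qed

lemma submodule_function_module_iff:
  "submodule N R (function_module R (arrows G)) \<longleftrightarrow> N \<subseteq> Fun \<and> (\<lambda>g\<in>arrows G. \<zero>) \<in> N \<and>
    (\<forall>a\<in>N. \<forall>b\<in>N. (\<lambda>g\<in>arrows G. a g \<oplus> b g) \<in> N) \<and> (\<forall>r\<in>carrier R. \<forall>a\<in>N. (\<lambda>g\<in>arrows G. r \<otimes> a g) \<in> N)"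
proof -
  let ?M = "function_module R (arrows G)"
  have sel [simp]: "carrier ?M = Fun" "\<zero>\<^bsub>?M\<^esub> = (\<lambda>g\<in>arrows G. \<zero>)" "add ?M = (\<lambda>f f'. \<lambda>g\<in>arrows G. f g \<oplus> f' g)"
    "smult ?M = (\<lambda>r f. \<lambda>g\<in>arrows G. r \<otimes> f g)" by (simp_all add: function_module_def)
  interpret M: left_module R ?M by (rule left_module_function_module)
  have neg: "\<ominus>\<^bsub>?M\<^esub> a = (\<lambda>g\<in>arrows G. (\<ominus> \<one>) \<otimes> a g)" if "a \<in> Fun" for a
  proof (rule M.M.minus_equality)
    show "(\<lambda>g\<in>arrows G. (\<ominus> \<one>) \<otimes> a g) \<oplus>\<^bsub>?M\<^esub> a = \<zero>\<^bsub>?M\<^esub>"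
      by (rule Fun_eqI) (use that in \<open>auto simp: l_minus l_neg\<close>)
  qed (use that in auto)
  show ?thesis
    unfolding M.submodule_iff M.additive_subgroup_iff
    by (simp, safe; simp add: neg subset_iff)
qed

lemma conv_smult_left:
  assumes "r \<in> carrier R" "a \<in> Fun" "b \<in> fibre_finite"
  shows "conv (\<lambda>g\<in>arrows G. r \<otimes> a g) b = (\<lambda>g\<in>arrows G. r \<otimes> conv a b g)"
proof (rule Fun_eqI)
  have bF: "b \<in> Fun" using assms(3) fibre_finiteD by auto
  have raF: "(\<lambda>g\<in>arrows G. r \<otimes> a g) \<in> Fun" using assms by auto
  show "conv (\<lambda>g\<in>arrows G. r \<otimes> a g) b \<in> Fun" by (rule conv_in_Fun[OF raF bF])
  show "(\<lambda>g\<in>arrows G. r \<otimes> conv a b g) \<in> Fun" using assms(1) conv_in_Fun[OF assms(2) bF] by auto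
  fix g assume g: "g \<in> arrows G"
  define Y where "Y = {h \<in> arrows G. src G h = src G g \<and> b h \<noteq> \<zero>}"
  have Y: "finite Y" using fibre_finiteD(2)[OF assms(3)] by (simp add: Y_def)
  have cl: "a (g \<star> ginv h) \<in> carrier R" "b h \<in> carrier R" "g \<star> ginv h \<in> arrows G" if "h \<in> Y" for h
    using that g assms bF by (auto simp: Y_def groupoid_simps intro!: Fun_closed)
  have "conv (\<lambda>g\<in>arrows G. r \<otimes> a g) b g = (\<Oplus>h\<in>Y. (\<lambda>g\<in>arrows G. r \<otimes> a g) (g \<star> ginv h) \<otimes> b h)"
    unfolding Y_def by (rule conv_eq_finsum_support[OF raF assms(3) g])
  also have "\<dots> = (\<Oplus>h\<in>Y. r \<otimes> (a (g \<star> ginv h) \<otimes> b h))"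
    using cl assms(1) by (intro finsum_cong') (auto simp: m_assoc)
  also have "\<dots> = r \<otimes> (\<Oplus>h\<in>Y. a (g \<star> ginv h) \<otimes> b h)"
    using cl assms(1) Y by (intro finsum_rdistr[symmetric]) auto
  finally show "conv (\<lambda>g\<in>arrows G. r \<otimes> a g) b g = (\<lambda>g\<in>arrows G. r \<otimes> conv a b g) g"
    using g conv_eq_finsum_support[OF assms(2,3) g] by (simp add: Y_def)
qed

lemma conv_smult_right:
  assumes "r \<in> carrier R" "a \<in> Fun" "b \<in> fibre_finite"
  shows "conv a (\<lambda>g\<in>arrows G. r \<otimes> b g) = (\<lambda>g\<in>arrows G. r \<otimes> conv a b g)"
proof (rule Fun_eqI)
  have bF: "b \<in> Fun" using assms(3) fibre_finiteD by auto
  have rbF: "(\<lambda>g\<in>arrows G. r \<otimes> b g) \<in> Fun" using assms bF by auto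
  show "conv a (\<lambda>g\<in>arrows G. r \<otimes> b g) \<in> Fun" by (rule conv_in_Fun[OF assms(2) rbF])
  show "(\<lambda>g\<in>arrows G. r \<otimes> conv a b g) \<in> Fun" using assms(1) conv_in_Fun[OF assms(2) bF] by auto
  fix g assume g: "g \<in> arrows G"
  define Y where "Y = {h \<in> arrows G. src G h = src G g \<and> b h \<noteq> \<zero>}"
  have Y: "finite Y" "Y \<subseteq> {h \<in> arrows G. src G h = src G g}"
    using fibre_finiteD(2)[OF assms(3)] by (auto simp: Y_def)
  have cl: "a (g \<star> ginv h) \<in> carrier R" "b h \<in> carrier R" "h \<in> arrows G" if "h \<in> Y" for h
    using that g assms bF by (auto simp: Y_def groupoid_simps intro!: Fun_closed)
  have cla: "a (g \<star> ginv h) \<in> carrier R" if "h \<in> arrows G" "src G h = src G g" for h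
    using that g assms by (auto simp: groupoid_simps intro!: Fun_closed)
  have "conv a (\<lambda>g\<in>arrows G. r \<otimes> b g) g = (\<Oplus>h\<in>Y. a (g \<star> ginv h) \<otimes> (\<lambda>g\<in>arrows G. r \<otimes> b g) h)"
    by (rule conv_eq_finsum[OF assms(2) rbF g Y]) (use cla assms(1) in \<open>auto simp: Y_def\<close>)
  also have "\<dots> = (\<Oplus>h\<in>Y. r \<otimes> (a (g \<star> ginv h) \<otimes> b h))"
    using cl assms(1) by (intro finsum_cong') (auto simp: m_lcomm)
  also have "\<dots> = r \<otimes> (\<Oplus>h\<in>Y. a (g \<star> ginv h) \<otimes> b h)"
    using cl assms(1) Y by (intro finsum_rdistr[symmetric]) auto
  finally show "conv a (\<lambda>g\<in>arrows G. r \<otimes> b g) g = (\<lambda>g\<in>arrows G. r \<otimes> conv a b g) g"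
    using g conv_eq_finsum_support[OF assms(2,3) g] by (simp add: Y_def)
qed

lemma finite_support_submodule: "submodule finite_support R (function_module R (arrows G))"
  unfolding submodule_function_module_iff
proof (intro conjI ballI)
  show "(\<lambda>g\<in>arrows G. r \<otimes> a g) \<in> finite_support" if "r \<in> carrier R" "a \<in> finite_support" for r a
    by (rule finite_supportI[OF _ finite_supportD(2)[OF that(2)]])
      (use that(1) finite_supportD(1)[OF that(2)] in auto)
qed (use finite_support_zero finite_support_add finite_supportD(1) in blast)+

lemma finite_support_minimal:
  assumes N: "submodule N R (function_module R (arrows G))" "\<And>g. g \<in> arrows G \<Longrightarrow> chi {g} \<in> N"
  shows "finite_support \<subseteq> N"
proof -
  have Nc: "(\<lambda>g\<in>arrows G. \<zero>) \<in> N" "\<And>a b. a \<in> N \<Longrightarrow> b \<in> N \<Longrightarrow> (\<lambda>g\<in>arrows G. a g \<oplus> b g) \<in> N"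
    "\<And>r a. r \<in> carrier R \<Longrightarrow> a \<in> N \<Longrightarrow> (\<lambda>g\<in>arrows G. r \<otimes> a g) \<in> N"
    using N(1) by (auto simp: submodule_function_module_iff)
  have "\<forall>f\<in>finite_support. {g \<in> arrows G. f g \<noteq> \<zero>} \<subseteq> X \<longrightarrow> f \<in> N" if "finite X" for X
    using that
  proof (induction X)
    case empty
    have "f = (\<lambda>g\<in>arrows G. \<zero>)" if "f \<in> finite_support" "{g \<in> arrows G. f g \<noteq> \<zero>} \<subseteq> {}" for f
      by (rule Fun_eqI) (use that finite_supportD(1) in auto)
    then show ?case using Nc(1) by blast
  next
    case (insert k X)
    show ?case
    proof (intro ballI impI)
      fix f assume f: "f \<in> finite_support" "{g \<in> arrows G. f g \<noteq> \<zero>} \<subseteq> insert k X"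
      note fF = finite_supportD(1)[OF f(1)]
      show "f \<in> N"
      proof (cases "k \<in> arrows G")
        case True
        define f' where "f' = (\<lambda>g\<in>arrows G. if g = k then \<zero> else f g)"
        have "f' \<in> finite_support"
          by (rule finite_supportI[OF _ finite_supportD(2)[OF f(1)]]) (use fF in \<open>auto simp: f'_def split: if_splits\<close>)
        moreover have "{g \<in> arrows G. f' g \<noteq> \<zero>} \<subseteq> X" using f(2) by (auto simp: f'_def)
        ultimately have f': "f' \<in> N" using insert.IH by blast
        have "(\<lambda>g\<in>arrows G. f k \<otimes> chi {k} g) \<in> N"
          using N(2) Nc(3) fF True by blast
        from Nc(2)[OF f' this]
        have "(\<lambda>g\<in>arrows G. f' g \<oplus> (\<lambda>g\<in>arrows G. f k \<otimes> chi {k} g) g) \<in> N" .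
        also have "(\<lambda>g\<in>arrows G. f' g \<oplus> (\<lambda>g\<in>arrows G. f k \<otimes> chi {k} g) g) = f"
          by (rule Fun_eqI) (use fF True in \<open>auto simp: f'_def Fun_closed\<close>)
        finally show ?thesis .
      next
        case False
        then have "{g \<in> arrows G. f g \<noteq> \<zero>} \<subseteq> X" using f(2) by auto
        then show ?thesis using insert.IH f(1) by blast
      qed
    qed
  qed
  then show ?thesis using finite_supportD(2) by blast
qed

lemma fibre_finite_submodule: "submodule fibre_finite R (function_module R (arrows G))"
  unfolding submodule_function_module_iff
proof (intro conjI ballI)
  show "(\<lambda>g\<in>arrows G. \<zero>) \<in> fibre_finite"
    using finite_support_zero finite_support_fibre_finite by blast
  show "(\<lambda>g\<in>arrows G. r \<otimes> a g) \<in> fibre_finite" if "r \<in> carrier R" "a \<in> fibre_finite" for r a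
  proof -
    have "finite {g \<in> arrows G. src G g = x \<and> (\<lambda>g\<in>arrows G. r \<otimes> a g) g \<noteq> \<zero>}" for x
      by (rule finite_subset[OF _ fibre_finiteD(2)[OF that(2), of x]]) (use that(1) in auto)
    then show ?thesis using that(1) fibre_finiteD(1)[OF that(2)] by (auto simp: fibre_finite_def)
  qed
qed (use fibre_finiteD(1) fibre_finite_add in blast)+

lemma chi_fibre_finite:
  assumes "inj_on (src G) U" shows "chi U \<in> fibre_finite"
proof -
  have "finite {g \<in> arrows G. src G g = x \<and> chi U g \<noteq> \<zero>}" for x
  proof (rule inj_on_finite[of "src G" _ "{x}"])
    show "inj_on (src G) {g \<in> arrows G. src G g = x \<and> chi U g \<noteq> \<zero>}"
      by (rule inj_on_subset[OF assms]) (auto split: if_splits)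
  qed auto
  then show ?thesis by (simp add: fibre_finite_def)
qed

end

locale ample_coefficients = R?: cring R + A?: ample_groupoid G T
  for R :: "('r, 'm) ring_scheme" (structure) and G :: "'g groupoid" and T :: "'g topology"

sublocale ample_coefficients \<subseteq> groupoid_coefficients R G
  by (intro groupoid_coefficients.intro R.cring_axioms A.groupoid_axioms)

context ample_coefficients
begin

definition Alg :: "('g \<Rightarrow> 'r) set"
  where "Alg = (\<lambda>N. submodule N R (function_module R (arrows G))) hull
    {chi U | U. compact_open_bisection G T U}"

lemma groupoid_algebra_eq: "groupoid_algebra R G T = conv_ring Alg"
  by (simp add: groupoid_algebra_def conv_ring_def Alg_def)

lemma Alg_minimal:
  assumes "\<And>U. compact_open_bisection G T U \<Longrightarrow> chi U \<in> N" "submodule N R (function_module R (arrows G))"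
  shows "Alg \<subseteq> N"
  unfolding Alg_def by (rule hull_minimal) (use assms in auto)

lemma Alg_fibre_finite: "Alg \<subseteq> fibre_finite"
  by (rule Alg_minimal) (auto simp: compact_open_bisection_def intro!: chi_fibre_finite fibre_finite_submodule)

lemma chi_Alg: "compact_open_bisection G T U \<Longrightarrow> chi U \<in> Alg"
  unfolding Alg_def by (rule hull_inc) blast

lemma Alg_submodule: "submodule Alg R (function_module R (arrows G))"
proof (rule submodule_function_module_iff[THEN iffD2], intro conjI)
  show "Alg \<subseteq> Fun" using Alg_fibre_finite fibre_finiteD(1) by blast
qed (auto simp: Alg_def hull_def submodule_function_module_iff)

lemma Alg_closed:
  "(\<lambda>g\<in>arrows G. \<zero>) \<in> Alg" "a \<in> Alg \<Longrightarrow> b \<in> Alg \<Longrightarrow> (\<lambda>g\<in>arrows G. a g \<oplus> b g) \<in> Alg"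
  "r \<in> carrier R \<Longrightarrow> a \<in> Alg \<Longrightarrow> (\<lambda>g\<in>arrows G. r \<otimes> a g) \<in> Alg" "a \<in> Alg \<Longrightarrow> a \<in> Fun"
  using Alg_submodule unfolding submodule_function_module_iff by blast+

text \<open>Products of characteristic functions of compact open bisections are again of this form, and convolution is
  bilinear; the two arguments are extended to the span one after the other.\<close>

lemma conv_Alg:
  assumes "a \<in> Alg" "b \<in> Alg" shows "conv a b \<in> Alg"
proof -
  have ff: "a \<in> fibre_finite" if "a \<in> Alg" for a using that Alg_fibre_finite by blast
  have 1: "conv a (chi V) \<in> Alg" if "a \<in> Alg" "compact_open_bisection G T V" for a V
  proof -
    have "Alg \<subseteq> {a \<in> Alg. conv a (chi V) \<in> Alg}"
    proof (rule Alg_minimal)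
      fix U assume U: "compact_open_bisection G T U"
      have "conv (chi U) (chi V) = chi {u \<star> v | u v. u \<in> U \<and> v \<in> V \<and> src G u = tgt G v}"
        using U that(2) by (intro conv_chi_chi open_arrows) (auto simp: compact_open_bisection_def)
      then show "chi U \<in> {a \<in> Alg. conv a (chi V) \<in> Alg}"
        using compact_open_bisection_product[OF U that(2)] U chi_Alg by simp
    next
      have Vf: "chi V \<in> fibre_finite" using ff chi_Alg that(2) by blast
      show "submodule {a \<in> Alg. conv a (chi V) \<in> Alg} R (function_module R (arrows G))"
        unfolding submodule_function_module_iff
      proof (intro conjI ballI)
        show "(\<lambda>g\<in>arrows G. \<zero>) \<in> {a \<in> Alg. conv a (chi V) \<in> Alg}"
        proof -
          have "conv (\<lambda>g\<in>arrows G. \<zero>) (chi V) = (\<lambda>g\<in>arrows G. \<zero>)"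
            by (rule Fun_eqI) (auto intro!: conv_in_Fun conv_eq_zero simp: groupoid_simps)
          then show ?thesis using Alg_closed(1) by simp
        qed
        show "{a \<in> Alg. conv a (chi V) \<in> Alg} \<subseteq> Fun" using Alg_closed(4) by blast
      qed (use Alg_closed Vf in \<open>auto simp: conv_add_left conv_smult_left\<close>)
    qed
    then show ?thesis using that(1) by blast
  qed
  have "Alg \<subseteq> {b \<in> Alg. conv a b \<in> Alg}"
  proof (rule Alg_minimal)
    show "chi U \<in> {b \<in> Alg. conv a b \<in> Alg}" if "compact_open_bisection G T U" for U
      using 1[OF assms(1) that] chi_Alg[OF that] by blast
    show "submodule {b \<in> Alg. conv a b \<in> Alg} R (function_module R (arrows G))"
      unfolding submodule_function_module_iff
    proof (intro conjI ballI)
      have aF: "a \<in> Fun" using Alg_closed(4) assms(1) by blast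
      have "conv a (\<lambda>g\<in>arrows G. \<zero>) = (\<lambda>g\<in>arrows G. \<zero>)"
        by (rule Fun_eqI)
          (use aF in \<open>auto intro!: conv_in_Fun conv_eq_zero simp: groupoid_simps Fun_closed\<close>)
      then show "(\<lambda>g\<in>arrows G. \<zero>) \<in> {b \<in> Alg. conv a b \<in> Alg}" using Alg_closed(1) by simp
      show "{b \<in> Alg. conv a b \<in> Alg} \<subseteq> Fun" using Alg_closed(4) by blast
    qed (use Alg_closed ff assms(1) in \<open>auto simp: conv_add_right conv_smult_right\<close>)
  qed
  then show ?thesis using assms(2) by blast
qed

lemma Alg_uminus:
  assumes "a \<in> Alg" shows "(\<lambda>g\<in>arrows G. \<ominus> a g) \<in> Alg"
proof -
  have aF: "a \<in> Fun" using Alg_closed(4) assms by blast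
  have "(\<lambda>g\<in>arrows G. \<ominus> \<one> \<otimes> a g) = (\<lambda>g\<in>arrows G. \<ominus> a g)"
    by (rule Fun_eqI) (use aF in \<open>auto simp: l_minus Fun_closed\<close>)
  moreover have "(\<lambda>g\<in>arrows G. \<ominus> \<one> \<otimes> a g) \<in> Alg" using assms by (intro Alg_closed(3)) auto
  ultimately show ?thesis by simp
qed

theorem nonunital_ring_groupoid_algebra: "nonunital_ring (groupoid_algebra R G T)"
  unfolding groupoid_algebra_eq
  by (rule conv_ring_nonunital_ring[OF Alg_fibre_finite Alg_closed(1) Alg_closed(2) Alg_uminus conv_Alg])

lemma Alg_discrete:
  assumes T: "T = discrete_topology (arrows G)" shows "Alg = finite_support"
proof
  have "finite U" if "compact_open_bisection G T U" for U
    using that T by (simp add: compact_open_bisection_def compactin_discrete_topology)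
  then show "Alg \<subseteq> finite_support"
    using chi_finite_support finite_support_submodule by (intro Alg_minimal) blast+
  have "compact_open_bisection G T {g}" if "g \<in> arrows G" for g
    using that T by (auto simp: compact_open_bisection_def compactin_discrete_topology)
  then show "finite_support \<subseteq> Alg"
    using chi_Alg Alg_submodule by (intro finite_support_minimal) blast+
qed

text \<open>The family \<open>\<V>\<close> of compact open neighbourhoods of \<open>x\<close> inside \<open>U\<close> has a minimal element, since the
  characteristic functions of a descending sequence in \<open>\<V>\<close> are descending idempotents in the corner at \<open>U\<close>.\<close>

theorem discrete_if_locally_chain:
  assumes ne: "\<one> \<noteq> \<zero>" and loc: "locally_chain c s (groupoid_algebra R G T)"
  shows "T = discrete_topology (arrows G)"
proof (rule discrete_if_isolated_units)
  fix x assume x: "x \<in> unit_arrows G"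
  interpret B: nonunital_ring "conv_ring Alg"
    using nonunital_ring_groupoid_algebra by (simp add: groupoid_algebra_eq)
  obtain U where U: "compact_open_bisection G T U" "x \<in> U" "U \<subseteq> unit_arrows G"
    using basis_neighbourhood[OF open_units x] .
  define \<V> where "\<V> = {V. compact_open_bisection G T V \<and> x \<in> V \<and> V \<subseteq> U}"
  have \<V>: "chi V \<in> Alg" "V \<subseteq> unit_arrows G" "V \<subseteq> arrows G" if "V \<in> \<V>" for V
    using that U chi_Alg unit_simps(1) by (auto simp: \<V>_def)
  have U\<V>: "U \<in> \<V>" using U by (simp add: \<V>_def)
  have chi_Int: "conv (chi V) (chi W) = chi (V \<inter> W)" if "V \<in> \<V>" "W \<in> \<V>" for V W
  proof (rule Fun_eqI)
    fix g assume g: "g \<in> arrows G"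
    have "tgt G g = g" if "g \<in> W" using unit_simps(3) \<V>(2)[OF \<open>W \<in> \<V>\<close>] that by blast
    then show "conv (chi V) (chi W) g = chi (V \<inter> W) g"
      using g conv_chi_left[OF \<V>(2)[OF that(1)] chi_in_Fun] by (auto simp: restrict_fibre_def)
  next
    show "conv (chi V) (chi W) \<in> Fun" by (rule conv_in_Fun[OF chi_in_Fun chi_in_Fun])
  qed (rule chi_in_Fun)
  define e where "e = chi U"
  have e: "e \<in> Alg" "conv e e = e" using chi_Int[OF U\<V> U\<V>] chi_Alg[OF U(1)] by (auto simp: e_def)
  have "\<exists>V\<in>\<V>. \<forall>W\<in>\<V>. W \<subseteq> V \<longrightarrow> W = V"
  proof (rule ccontr)
    assume "\<not> ?thesis"
    then have "\<forall>V\<in>\<V>. \<exists>W\<in>\<V>. W \<subset> V" by (meson psubsetI)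
    then obtain f where f: "\<And>V. V \<in> \<V> \<Longrightarrow> f V \<in> \<V> \<and> f V \<subset> V" by metis
    define V where "V n = (f ^^ n) U" for n
    have V: "V n \<in> \<V>" for n by (induction n) (use f U in \<open>auto simp: V_def \<V>_def\<close>)
    have Vs: "V (Suc n) \<subset> V n" for n using f[OF V[of n]] by (simp add: V_def)
    then have Vm: "V m \<subseteq> V n" if "n \<le> m" for m n
      using lift_Suc_antimono_le[of V n m] that by (simp add: psubset_imp_subset)
    have VU: "V n \<subseteq> U" for n using V by (auto simp: \<V>_def)
    let ?C = "sided s (corner_ring (conv_ring Alg) e)"
    interpret C: nonunital_ring ?C
      by (intro nonunital_ring_sided B.corner_nonunital_ring) (use e in simp_all)
    have cC: "carrier ?C = {a \<in> Alg. conv e a = a \<and> conv a e = a}"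
      using B.carrier_corner[of e] e by simp
    have mC: "a \<otimes>\<^bsub>?C\<^esub> b = (case s of LeftSided \<Rightarrow> conv a b | RightSided \<Rightarrow> conv b a)" for a b
      by (cases s) (simp_all add: opposite_ring_def)
    have cc: "conv (chi (V m)) (chi (V n)) = chi (V m \<inter> V n)" for m n by (rule chi_Int[OF V V])
    have "\<exists>n. \<forall>m\<ge>n. chi (V m) = chi (V n)"
    proof (rule C.descending_idempotents_stabilize[of e])
      show "satisfies_chain c {I. left_ideal I ?C}"
        using loc e unfolding locally_chain_def groupoid_algebra_eq chain_ring_def by simp
      show "chi (V n) \<in> carrier ?C" for n
        unfolding cC using \<V>(1)[OF V] chi_Int[OF V U\<V>] chi_Int[OF U\<V> V] VU[of n]
        by (simp add: e_def Int_absorb1 Int_absorb2)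
      fix m n :: nat assume "n \<le> m"
      then have "V m \<inter> V n = V m" "V n \<inter> V m = V m" using Vm by auto
      then show "chi (V n) \<otimes>\<^bsub>?C\<^esub> chi (V m) = chi (V m)" "chi (V m) \<otimes>\<^bsub>?C\<^esub> chi (V n) = chi (V m)"
        unfolding mC using cc[of m n] cc[of n m] by (cases s; simp)+
    next
      show "e \<in> carrier ?C" unfolding cC using e by simp
      show "e \<otimes>\<^bsub>?C\<^esub> a = a" if "a \<in> carrier ?C" for a using that unfolding mC cC by (cases s) auto
    qed
    then obtain n where "chi (V (Suc n)) = chi (V n)" by (metis le_SucI order_refl)
    moreover obtain g where g: "g \<in> V n" "g \<notin> V (Suc n)" using Vs by blast
    moreover have "g \<in> arrows G" using g \<V>(3)[OF V] by auto
    ultimately show False using ne by (metis chi_apply)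
  qed
  then obtain V where V: "V \<in> \<V>" "\<And>W. W \<in> \<V> \<Longrightarrow> W \<subseteq> V \<Longrightarrow> W = V" by blast
  have "V = {x}"
  proof (rule isolated_unit)
    show "x \<in> V" "compact_open_bisection G T V" "V \<subseteq> unit_arrows G"
      using V(1) \<V>(2) by (auto simp: \<V>_def)
    fix W assume "compact_open_bisection G T W" "x \<in> W" "W \<subseteq> V"
    moreover from this V(1) have "W \<in> \<V>" by (auto simp: \<V>_def)
    ultimately show "W = V" using V(2) by blast
  qed
  then show "openin T {x}" using V(1) by (auto simp: \<V>_def compact_open_bisection_def)
qed

theorem isotropy_chain_if_locally_chain:
  assumes T: "T = discrete_topology (arrows G)" and loc: "locally_chain c s (groupoid_algebra R G T)"
    and x: "x \<in> unit_arrows G"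
  shows "chain_ring c s (group_ring R (isotropy_group G x))"
proof -
  let ?A = "conv_ring finite_support"
  interpret B: nonunital_ring ?A by (rule nonunital_ring_finite_support)
  interpret I: group_coefficients R "isotropy_group G x" by (rule isotropy_group_coefficients[OF x])
  have e: "chi {x} \<in> carrier ?A" "chi {x} \<otimes>\<^bsub>?A\<^esub> chi {x} = chi {x}"
    using x by (simp_all add: chi_finite_support chi_idempotent)
  have "chain_ring c s (corner_ring ?A (chi {x}))"
    using loc e unfolding groupoid_algebra_eq Alg_discrete[OF T] locally_chain_def by blast
  moreover have C: "nonunital_ring (corner_ring ?A (chi {x}))" by (rule B.corner_nonunital_ring[OF e])
  moreover have "rng_isomorphic (group_ring R (isotropy_group G x)) (corner_ring ?A (chi {x}))"
    by (rule nonunital_ring.rng_isomorphic_sym[OF C corner_isomorphic_group_ring[OF x]])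
  ultimately show ?thesis using chain_ring_isomorphic[OF I.nonunital_group_ring] by blast
qed

end

section \<open>Decomposition into matrix rings over isotropy group rings\<close>

lemma (in group_coefficients) group_ring_finsum_apply:
  assumes "finite W" "\<And>w. w \<in> W \<Longrightarrow> F w \<in> carrier (group_ring R H)" "g \<in> carrier H"
  shows "finsum (group_ring R H) F W g = (\<Oplus>w\<in>W. F w g)"
proof -
  interpret S: nonunital_ring "group_ring R H" by (rule nonunital_group_ring)
  show ?thesis using assms(1,2)
  proof (induction W)
    case empty
    show ?case using assms(3) S.finsum_empty by simp
  next
    case (insert w W)
    have "finsum (group_ring R H) F (insert w W) = F w \<oplus>\<^bsub>group_ring R H\<^esub> finsum (group_ring R H) F W"
      using insert by (intro S.finsum_insert) auto
    moreover have "F v g \<in> carrier R" if "v \<in> insert w W" for v using insert.prems[OF that] assms(3) by auto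
    ultimately show ?case using insert assms(3) by (simp add: Pi_iff)
  qed
qed

locale orbit_coefficients = groupoid_coefficients R G
  for R :: "('r, 'm) ring_scheme" (structure) and G :: "'g groupoid" +
  fixes J :: "'j set" and x :: "'j \<Rightarrow> 'g"
  assumes reps: "orbit_representatives G J x"
begin

abbreviation Orb where "Orb \<alpha> \<equiv> groupoid_orbit G (x \<alpha>)"
abbreviation Iso where "Iso \<alpha> \<equiv> isotropy_group G (x \<alpha>)"
abbreviation IsoRing where "IsoRing \<alpha> \<equiv> group_ring R (Iso \<alpha>)"
abbreviation MatSum where "MatSum \<equiv> direct_sum_ring J (\<lambda>\<alpha>. matrix_ring (Orb \<alpha>) (IsoRing \<alpha>))"

lemma rep_unit: "\<alpha> \<in> J \<Longrightarrow> x \<alpha> \<in> unit_arrows G"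
  using reps by (auto simp: orbit_representatives_def)

lemma orbit_unit: "y \<in> Orb \<alpha> \<Longrightarrow> y \<in> unit_arrows G" by (simp add: groupoid_orbit_def)

lemma orbit_unique: "\<alpha> \<in> J \<Longrightarrow> \<beta> \<in> J \<Longrightarrow> y \<in> Orb \<alpha> \<Longrightarrow> y \<in> Orb \<beta> \<Longrightarrow> \<alpha> = \<beta>"
  using reps orbit_unit unfolding orbit_representatives_def by blast

text \<open>The unit \<open>y\<close> belongs to the orbit of the representative \<open>x (index y)\<close>, \<open>path \<alpha> y\<close> is a chosen arrow from
  \<open>x \<alpha>\<close> to \<open>y\<close>, and \<open>glue\<close> and \<open>unglue\<close> are the mutually inverse passages between elements of the isotropy
  group with a pair (target, source) and arrows.\<close>

definition index :: "'g \<Rightarrow> 'j" where "index y = (THE \<alpha>. \<alpha> \<in> J \<and> y \<in> Orb \<alpha>)"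

lemma index: assumes "y \<in> unit_arrows G" shows "index y \<in> J" "y \<in> Orb (index y)"
  using theI'[of "\<lambda>\<alpha>. \<alpha> \<in> J \<and> y \<in> Orb \<alpha>"] reps assms
  unfolding index_def orbit_representatives_def by blast+

lemma index_eq: "\<alpha> \<in> J \<Longrightarrow> y \<in> Orb \<alpha> \<Longrightarrow> index y = \<alpha>"
  using index[OF orbit_unit] orbit_unique by blast

lemma orbit_arrow:
  assumes "k \<in> arrows G" shows "src G k \<in> Orb \<alpha> \<longleftrightarrow> tgt G k \<in> Orb \<alpha>"
proof
  assume "src G k \<in> Orb \<alpha>"
  then obtain g where "g \<in> arrows G" "src G g = x \<alpha>" "tgt G g = src G k" by (auto simp: groupoid_orbit_def)
  then show "tgt G k \<in> Orb \<alpha>" using assms tgt_unit[OF assms] unfolding groupoid_orbit_def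
    by (auto intro!: bexI[of _ "k \<star> g"] simp: groupoid_simps)
next
  assume "tgt G k \<in> Orb \<alpha>"
  then obtain g where "g \<in> arrows G" "src G g = x \<alpha>" "tgt G g = tgt G k" by (auto simp: groupoid_orbit_def)
  then show "src G k \<in> Orb \<alpha>" using assms src_unit[OF assms] unfolding groupoid_orbit_def
    by (auto intro!: bexI[of _ "ginv k \<star> g"] simp: groupoid_simps)
qed

definition path :: "'j \<Rightarrow> 'g \<Rightarrow> 'g"
  where "path \<alpha> y = (SOME g. g \<in> arrows G \<and> src G g = x \<alpha> \<and> tgt G g = y)"

lemma path: assumes "y \<in> Orb \<alpha>" shows "path \<alpha> y \<in> arrows G" "src G (path \<alpha> y) = x \<alpha>" "tgt G (path \<alpha> y) = y"
proof -
  have "\<exists>g. g \<in> arrows G \<and> src G g = x \<alpha> \<and> tgt G g = y" using assms by (auto simp: groupoid_orbit_def)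
  from someI_ex[OF this] show "path \<alpha> y \<in> arrows G" "src G (path \<alpha> y) = x \<alpha>" "tgt G (path \<alpha> y) = y"
    by (simp_all add: path_def)
qed

definition glue :: "'j \<Rightarrow> 'g \<times> 'g \<Rightarrow> 'g \<Rightarrow> 'g"
  where "glue \<alpha> q g = path \<alpha> (fst q) \<star> (g \<star> ginv (path \<alpha> (snd q)))"

definition unglue :: "'j \<Rightarrow> 'g \<Rightarrow> 'g"
  where "unglue \<alpha> k = ginv (path \<alpha> (tgt G k)) \<star> (k \<star> path \<alpha> (src G k))"

lemma glue:
  assumes "q \<in> Orb \<alpha> \<times> Orb \<alpha>" "g \<in> carrier (Iso \<alpha>)"
  shows "glue \<alpha> q g \<in> arrows G" "src G (glue \<alpha> q g) = snd q" "tgt G (glue \<alpha> q g) = fst q"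
    "unglue \<alpha> (glue \<alpha> q g) = g"
proof -
  obtain y z where q: "q = (y, z)" by (cases q)
  note p = path[of y \<alpha>] path[of z \<alpha>]
  have g: "g \<in> arrows G" "src G g = x \<alpha>" "tgt G g = x \<alpha>" using assms by (auto simp: isotropy_carrier)
  have yz: "y \<in> Orb \<alpha>" "z \<in> Orb \<alpha>" using assms q by auto
  show 1: "glue \<alpha> q g \<in> arrows G" "src G (glue \<alpha> q g) = snd q" "tgt G (glue \<alpha> q g) = fst q"
    using p yz g q by (simp_all add: glue_def groupoid_simps)
  have "glue \<alpha> q g \<star> path \<alpha> z = path \<alpha> y \<star> ((g \<star> ginv (path \<alpha> z)) \<star> path \<alpha> z)"
    unfolding glue_def q using p yz g by (subst cmp_assoc) (auto simp: groupoid_simps)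
  also have "\<dots> = path \<alpha> y \<star> g" using p yz g by (simp add: inv_cmp_cancel)
  finally show "unglue \<alpha> (glue \<alpha> q g) = g"
    unfolding unglue_def 1(2,3) using p yz g q by (simp add: inv_cmp_cancel)
qed

lemma unglue:
  assumes k: "k \<in> arrows G" "src G k \<in> Orb \<alpha>"
  shows "unglue \<alpha> k \<in> carrier (Iso \<alpha>)" "glue \<alpha> (tgt G k, src G k) (unglue \<alpha> k) = k"
proof -
  have t: "tgt G k \<in> Orb \<alpha>" using orbit_arrow k by blast
  note p = path[OF t] path[OF k(2)]
  show "unglue \<alpha> k \<in> carrier (Iso \<alpha>)"
    using p k by (simp add: unglue_def isotropy_carrier groupoid_simps)
  have "unglue \<alpha> k \<star> ginv (path \<alpha> (src G k)) = ginv (path \<alpha> (tgt G k)) \<star> ((k \<star> path \<alpha> (src G k)) \<star> ginv (path \<alpha> (src G k)))"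
    unfolding unglue_def using p k by (subst cmp_assoc) (auto simp: groupoid_simps)
  also have "\<dots> = ginv (path \<alpha> (tgt G k)) \<star> k" using p k by (simp add: inv_cmp_cancel)
  finally show "glue \<alpha> (tgt G k, src G k) (unglue \<alpha> k) = k"
    unfolding glue_def using p k by (simp add: inv_cmp_cancel)
qed

lemma glue_div:
  assumes "y \<in> Orb \<alpha>" "w \<in> Orb \<alpha>" "z \<in> Orb \<alpha>" "g \<in> carrier (Iso \<alpha>)" "h \<in> carrier (Iso \<alpha>)"
  shows "glue \<alpha> (y, z) g \<star> ginv (glue \<alpha> (w, z) h) = glue \<alpha> (y, w) (g \<star> ginv h)"
proof -
  note p = path[OF assms(1)] path[OF assms(2)] path[OF assms(3)]
  have g: "g \<in> arrows G" "src G g = x \<alpha>" "tgt G g = x \<alpha>" "h \<in> arrows G" "src G h = x \<alpha>" "tgt G h = x \<alpha>"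
    using assms by (auto simp: isotropy_carrier)
  have "ginv (glue \<alpha> (w, z) h) = (path \<alpha> z \<star> ginv h) \<star> ginv (path \<alpha> w)"
    unfolding glue_def using p g by (simp add: inv_cmp inv_inv groupoid_simps)
  then have "glue \<alpha> (y, z) g \<star> ginv (glue \<alpha> (w, z) h) =
    path \<alpha> y \<star> ((g \<star> ginv (path \<alpha> z)) \<star> ((path \<alpha> z \<star> ginv h) \<star> ginv (path \<alpha> w)))"
    unfolding glue_def using p g by (simp add: cmp_assoc groupoid_simps)
  also have "(g \<star> ginv (path \<alpha> z)) \<star> ((path \<alpha> z \<star> ginv h) \<star> ginv (path \<alpha> w)) = (g \<star> ginv h) \<star> ginv (path \<alpha> w)"
    using p g by (simp add: cmp_assoc groupoid_simps inv_cmp_cancel)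
  finally show ?thesis by (simp add: glue_def)
qed

definition matrices :: "('g \<Rightarrow> 'r) \<Rightarrow> 'j \<Rightarrow> 'g \<times> 'g \<Rightarrow> 'g \<Rightarrow> 'r"
  where "matrices f = (\<lambda>\<alpha>\<in>J. \<lambda>q\<in>Orb \<alpha> \<times> Orb \<alpha>. \<lambda>g\<in>carrier (Iso \<alpha>). f (glue \<alpha> q g))"

lemma matrices_apply:
  "\<alpha> \<in> J \<Longrightarrow> q \<in> Orb \<alpha> \<times> Orb \<alpha> \<Longrightarrow> g \<in> carrier (Iso \<alpha>) \<Longrightarrow> matrices f \<alpha> q g = f (glue \<alpha> q g)"
  by (simp add: matrices_def)

lemma MatSum_simps:
  "carrier MatSum = {F \<in> (\<Pi>\<^sub>E \<alpha>\<in>J. {A \<in> Orb \<alpha> \<times> Orb \<alpha> \<rightarrow>\<^sub>E carrier (IsoRing \<alpha>).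
      finite {p \<in> Orb \<alpha> \<times> Orb \<alpha>. A p \<noteq> \<zero>\<^bsub>IsoRing \<alpha>\<^esub>}}).
    finite {\<alpha> \<in> J. F \<alpha> \<noteq> (\<lambda>p\<in>Orb \<alpha> \<times> Orb \<alpha>. \<zero>\<^bsub>IsoRing \<alpha>\<^esub>)}}"
  by (simp add: direct_sum_ring_def matrix_ring_def)

lemma matrices_entry_closed:
  assumes f: "f \<in> finite_support" and \<alpha>: "\<alpha> \<in> J" and q: "q \<in> Orb \<alpha> \<times> Orb \<alpha>"
  shows "matrices f \<alpha> q \<in> carrier (IsoRing \<alpha>)"
proof -
  have "{g \<in> carrier (Iso \<alpha>). matrices f \<alpha> q g \<noteq> \<zero>} \<subseteq> unglue \<alpha> ` {k \<in> arrows G. f k \<noteq> \<zero>}"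
  proof
    fix g assume "g \<in> {g \<in> carrier (Iso \<alpha>). matrices f \<alpha> q g \<noteq> \<zero>}"
    then have "g \<in> carrier (Iso \<alpha>)" "f (glue \<alpha> q g) \<noteq> \<zero>" using matrices_apply[OF \<alpha> q] by auto
    then show "g \<in> unglue \<alpha> ` {k \<in> arrows G. f k \<noteq> \<zero>}" using glue[OF q] by force
  qed
  then have "finite {g \<in> carrier (Iso \<alpha>). matrices f \<alpha> q g \<noteq> \<zero>}"
    using finite_supportD(2)[OF f] finite_subset by blast
  moreover have "matrices f \<alpha> q \<in> carrier (Iso \<alpha>) \<rightarrow>\<^sub>E carrier R"
    using \<alpha> q glue[OF q] finite_supportD(1)[OF f] by (auto simp: matrices_def)
  ultimately show ?thesis by simp
qed

lemma matrices_closed: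
  assumes f: "f \<in> finite_support" shows "matrices f \<in> carrier MatSum"
proof -
  let ?S = "{k \<in> arrows G. f k \<noteq> \<zero>}"
  have fin: "finite ?S" by (rule finite_supportD(2)[OF f])
  have nz: "\<exists>k\<in>?S. q = (tgt G k, src G k)"
    if asm: "\<alpha> \<in> J" "q \<in> Orb \<alpha> \<times> Orb \<alpha>" "matrices f \<alpha> q \<noteq> \<zero>\<^bsub>IsoRing \<alpha>\<^esub>" for \<alpha> q
  proof -
    have "\<exists>g\<in>carrier (Iso \<alpha>). matrices f \<alpha> q g \<noteq> \<zero>"
    proof (rule ccontr)
      assume "\<not> ?thesis"
      then have "matrices f \<alpha> q = \<zero>\<^bsub>IsoRing \<alpha>\<^esub>"
        using matrices_entry_closed[OF f asm(1,2)] by (intro PiE_ext[of _ "carrier (Iso \<alpha>)" "\<lambda>_. carrier R"]) auto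
      then show False using asm by blast
    qed
    then obtain g where g: "g \<in> carrier (Iso \<alpha>)" "f (glue \<alpha> q g) \<noteq> \<zero>" using matrices_apply[OF asm(1,2)] by auto
    then show ?thesis using glue[OF asm(2) g(1)] by (intro bexI[of _ "glue \<alpha> q g"]) auto
  qed
  have "finite {q \<in> Orb \<alpha> \<times> Orb \<alpha>. matrices f \<alpha> q \<noteq> \<zero>\<^bsub>IsoRing \<alpha>\<^esub>}" if "\<alpha> \<in> J" for \<alpha>
    by (rule finite_subset[of _ "(\<lambda>k. (tgt G k, src G k)) ` ?S"]) (use nz that fin in \<open>blast+\<close>)
  moreover have "finite {\<alpha> \<in> J. matrices f \<alpha> \<noteq> (\<lambda>p\<in>Orb \<alpha> \<times> Orb \<alpha>. \<zero>\<^bsub>IsoRing \<alpha>\<^esub>)}"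
  proof (rule finite_subset)
    show "{\<alpha> \<in> J. matrices f \<alpha> \<noteq> (\<lambda>p\<in>Orb \<alpha> \<times> Orb \<alpha>. \<zero>\<^bsub>IsoRing \<alpha>\<^esub>)} \<subseteq> (\<lambda>k. index (src G k)) ` ?S"
    proof
      fix \<alpha> assume a: "\<alpha> \<in> {\<alpha> \<in> J. matrices f \<alpha> \<noteq> (\<lambda>p\<in>Orb \<alpha> \<times> Orb \<alpha>. \<zero>\<^bsub>IsoRing \<alpha>\<^esub>)}"
      then have "\<exists>q\<in>Orb \<alpha> \<times> Orb \<alpha>. matrices f \<alpha> q \<noteq> \<zero>\<^bsub>IsoRing \<alpha>\<^esub>"
        by (auto simp: matrices_def fun_eq_iff restrict_def split: if_splits)
      then obtain q where q: "q \<in> Orb \<alpha> \<times> Orb \<alpha>" "matrices f \<alpha> q \<noteq> \<zero>\<^bsub>IsoRing \<alpha>\<^esub>" by blast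
      then obtain k where "k \<in> ?S" "q = (tgt G k, src G k)" using nz a by blast
      then show "\<alpha> \<in> (\<lambda>k. index (src G k)) ` ?S" using index_eq[of \<alpha> "src G k"] a q by auto
    qed
  qed (use fin in simp)
  moreover have "matrices f \<in> extensional J" "\<And>\<alpha>. \<alpha> \<in> J \<Longrightarrow> matrices f \<alpha> \<in> extensional (Orb \<alpha> \<times> Orb \<alpha>)"
    by (simp_all add: matrices_def)
  ultimately show ?thesis
    unfolding MatSum_simps using matrices_entry_closed[OF f] by (auto simp: PiE_def Pi_iff simp del: group_ring_simps)
qed

lemma matrices_inj: "inj_on matrices finite_support"
proof (rule inj_onI)
  fix f f' assume f: "f \<in> finite_support" "f' \<in> finite_support" "matrices f = matrices f'"
  show "f = f'"
  proof (rule Fun_eqI)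
    fix k assume k: "k \<in> arrows G"
    define \<alpha> where "\<alpha> = index (src G k)"
    have \<alpha>: "\<alpha> \<in> J" "src G k \<in> Orb \<alpha>" using index[OF src_unit[OF k]] by (auto simp: \<alpha>_def)
    have q: "(tgt G k, src G k) \<in> Orb \<alpha> \<times> Orb \<alpha>" using \<alpha> orbit_arrow[OF k] by auto
    show "f k = f' k"
      using matrices_apply[OF \<alpha>(1) q unglue(1)[OF k \<alpha>(2)]] unglue(2)[OF k \<alpha>(2)] f(3) by metis
  qed (use f finite_supportD in auto)
qed

lemma matrices_surj:
  assumes F: "F \<in> carrier MatSum" shows "F \<in> matrices ` finite_support"
proof -
  define f where "f = (\<lambda>k\<in>arrows G. F (index (src G k)) (tgt G k, src G k) (unglue (index (src G k)) k))"
  have FM: "F \<in> extensional J" "finite {\<alpha> \<in> J. F \<alpha> \<noteq> (\<lambda>p\<in>Orb \<alpha> \<times> Orb \<alpha>. \<zero>\<^bsub>IsoRing \<alpha>\<^esub>)}"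
    using F unfolding MatSum_simps by (auto simp: PiE_def)
  have FA: "F \<alpha> \<in> extensional (Orb \<alpha> \<times> Orb \<alpha>)" "finite {p \<in> Orb \<alpha> \<times> Orb \<alpha>. F \<alpha> p \<noteq> \<zero>\<^bsub>IsoRing \<alpha>\<^esub>}" if "\<alpha> \<in> J" for \<alpha>
    using F that unfolding MatSum_simps by (auto simp: PiE_def Pi_iff)
  have Fe: "F \<alpha> q \<in> carrier (IsoRing \<alpha>)" if "\<alpha> \<in> J" "q \<in> Orb \<alpha> \<times> Orb \<alpha>" for \<alpha> q
    using F that unfolding MatSum_simps by (auto simp: PiE_def Pi_iff)
  have idx: "index (src G k) \<in> J" "src G k \<in> Orb (index (src G k))"
    "(tgt G k, src G k) \<in> Orb (index (src G k)) \<times> Orb (index (src G k))"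
    "unglue (index (src G k)) k \<in> carrier (Iso (index (src G k)))" if k: "k \<in> arrows G" for k
    using index[OF src_unit[OF k]] orbit_arrow[OF k] unglue(1)[OF k] by auto
  have Fe': "F (index (src G k)) (tgt G k, src G k) (unglue (index (src G k)) k) \<in> carrier R"
    if k: "k \<in> arrows G" for k
    using Fe[OF idx(1,3)[OF k]] idx(4)[OF k] by auto
  then have fF: "f \<in> Fun" by (simp add: f_def)
  define Z where "Z = (\<Union>\<alpha>\<in>{\<alpha> \<in> J. F \<alpha> \<noteq> (\<lambda>p\<in>Orb \<alpha> \<times> Orb \<alpha>. \<zero>\<^bsub>IsoRing \<alpha>\<^esub>)}.
    \<Union>q\<in>{q \<in> Orb \<alpha> \<times> Orb \<alpha>. F \<alpha> q \<noteq> \<zero>\<^bsub>IsoRing \<alpha>\<^esub>}. glue \<alpha> q ` {g \<in> carrier (Iso \<alpha>). F \<alpha> q g \<noteq> \<zero>})"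
  have "finite Z" unfolding Z_def
    using FM FA Fe by (intro finite_UN_I) auto
  have "f \<in> finite_support"
  proof (rule finite_supportI[OF fF \<open>finite Z\<close>])
    fix k assume k: "k \<in> arrows G" "f k \<noteq> \<zero>"
    define \<alpha> q g where "\<alpha> = index (src G k)" "q = (tgt G k, src G k)" "g = unglue \<alpha> k"
    have a: "\<alpha> \<in> J" "q \<in> Orb \<alpha> \<times> Orb \<alpha>" "g \<in> carrier (Iso \<alpha>)" "glue \<alpha> q g = k"
      using idx[OF k(1)] unglue(2)[OF k(1)] by (auto simp: \<alpha>_q_g_def)
    have nz: "F \<alpha> q g \<noteq> \<zero>" using k by (simp add: f_def \<alpha>_q_g_def)
    then have 1: "F \<alpha> q \<noteq> \<zero>\<^bsub>IsoRing \<alpha>\<^esub>" using a by auto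
    then have 2: "F \<alpha> \<noteq> (\<lambda>p\<in>Orb \<alpha> \<times> Orb \<alpha>. \<zero>\<^bsub>IsoRing \<alpha>\<^esub>)" using a by auto
    show "k \<in> Z" unfolding Z_def using a nz 1 2 by blast
  qed
  moreover have "matrices f = F"
  proof (rule extensionalityI)
    show "matrices f \<in> extensional J" by (simp add: matrices_def)
    show "F \<in> extensional J" by (rule FM)
    fix \<alpha> assume \<alpha>: "\<alpha> \<in> J"
    show "matrices f \<alpha> = F \<alpha>"
    proof (rule extensionalityI)
      show "matrices f \<alpha> \<in> extensional (Orb \<alpha> \<times> Orb \<alpha>)" using \<alpha> by (simp add: matrices_def)
      show "F \<alpha> \<in> extensional (Orb \<alpha> \<times> Orb \<alpha>)" by (rule FA[OF \<alpha>])
      fix q assume q: "q \<in> Orb \<alpha> \<times> Orb \<alpha>"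
      show "matrices f \<alpha> q = F \<alpha> q"
      proof (rule extensionalityI)
        show "matrices f \<alpha> q \<in> extensional (carrier (Iso \<alpha>))" using \<alpha> q by (simp add: matrices_def)
        show "F \<alpha> q \<in> extensional (carrier (Iso \<alpha>))" using Fe[OF \<alpha> q] by (auto simp: PiE_def)
        fix g assume g: "g \<in> carrier (Iso \<alpha>)"
        note gl = glue[OF q g]
        have "index (snd q) = \<alpha>" using index_eq[OF \<alpha>, of "snd q"] q by auto
        then show "matrices f \<alpha> q g = F \<alpha> q g"
          using gl matrices_apply[OF \<alpha> q g] by (simp add: f_def)
      qed
    qed
  qed
  ultimately show ?thesis by blast
qed

text \<open>Both sides are sums over the arrows \<open>l\<close> with source \<open>z\<close> in the support of \<open>b\<close>. Sorting them by their targets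
  \<open>w\<close> gives the outer sum of the matrix product, and \<open>unglue\<close> turns the arrows with target \<open>w\<close> into the inner
  sum, which is the product in the group ring.\<close>

lemma matrices_conv:
  assumes a: "a \<in> finite_support" and b: "b \<in> finite_support" and \<alpha>: "\<alpha> \<in> J"
    and y: "y \<in> Orb \<alpha>" and z: "z \<in> Orb \<alpha>" and g: "g \<in> carrier (Iso \<alpha>)"
  shows "matrices (conv a b) \<alpha> (y, z) g = (\<Oplus>\<^bsub>IsoRing \<alpha>\<^esub>w\<in>{w \<in> Orb \<alpha>.
    matrices a \<alpha> (y, w) \<otimes>\<^bsub>IsoRing \<alpha>\<^esub> matrices b \<alpha> (w, z) \<noteq> \<zero>\<^bsub>IsoRing \<alpha>\<^esub>}.
    matrices a \<alpha> (y, w) \<otimes>\<^bsub>IsoRing \<alpha>\<^esub> matrices b \<alpha> (w, z)) g"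
proof -
  let ?S = "IsoRing \<alpha>"
  interpret I: group_coefficients R "Iso \<alpha>" by (rule isotropy_group_coefficients[OF rep_unit[OF \<alpha>]])
  interpret S: nonunital_ring ?S by (rule I.nonunital_group_ring)
  note aF = finite_supportD(1)[OF a] and bF = finite_supportD(1)[OF b]
  define H where "H w = {h \<in> carrier (Iso \<alpha>). b (glue \<alpha> (w, z) h) \<noteq> \<zero>}" for w
  define W where "W = tgt G ` {l \<in> arrows G. src G l = z \<and> b l \<noteq> \<zero>}"
  have W: "finite W" "W \<subseteq> Orb \<alpha>"
  proof -
    show "finite W" unfolding W_def
      by (rule finite_imageI[OF finite_subset[OF _ finite_supportD(2)[OF b]]]) auto
    show "W \<subseteq> Orb \<alpha>" using orbit_arrow z by (auto simp: W_def)
  qed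
  have ent: "matrices a \<alpha> (y, w) \<in> carrier ?S" "matrices b \<alpha> (w, z) \<in> carrier ?S" if "w \<in> Orb \<alpha>" for w
    using matrices_entry_closed[OF a \<alpha>] matrices_entry_closed[OF b \<alpha>] y z that by auto
  have qwz: "(w, z) \<in> Orb \<alpha> \<times> Orb \<alpha>" "(y, w) \<in> Orb \<alpha> \<times> Orb \<alpha>" if "w \<in> Orb \<alpha>" for w
    using that y z by auto
  have H: "finite (H w)" if "w \<in> Orb \<alpha>" for w
  proof -
    have "H w = {h \<in> carrier (Iso \<alpha>). matrices b \<alpha> (w, z) h \<noteq> \<zero>}"
      using matrices_apply[OF \<alpha> qwz(1)[OF that]] by (auto simp: H_def)
    then show ?thesis using ent(2)[OF that] by simp
  qed
  have fib: "{l \<in> arrows G. src G l = z \<and> b l \<noteq> \<zero>} = (\<Union>w\<in>W. glue \<alpha> (w, z) ` H w)"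
  proof (intro equalityI subsetI)
    fix l assume l: "l \<in> {l \<in> arrows G. src G l = z \<and> b l \<noteq> \<zero>}"
    then have "glue \<alpha> (tgt G l, z) (unglue \<alpha> l) = l" "unglue \<alpha> l \<in> carrier (Iso \<alpha>)"
      using unglue[of l \<alpha>] z by auto
    then have "l \<in> glue \<alpha> (tgt G l, z) ` H (tgt G l)" "tgt G l \<in> W"
      using l by (auto simp: H_def W_def intro!: image_eqI[of l _ "unglue \<alpha> l"])
    then show "l \<in> (\<Union>w\<in>W. glue \<alpha> (w, z) ` H w)" by blast
  next
    fix l assume "l \<in> (\<Union>w\<in>W. glue \<alpha> (w, z) ` H w)"
    then obtain w h where "w \<in> W" "h \<in> H w" "l = glue \<alpha> (w, z) h" by auto
    then show "l \<in> {l \<in> arrows G. src G l = z \<and> b l \<noteq> \<zero>}"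
      using glue[OF qwz(1)[of w], of h] W by (auto simp: H_def)
  qed
  note gg = glue[OF qwz(2)[OF z] g]
  have clos: "a (glue \<alpha> (y, z) g \<star> ginv l) \<otimes> b l \<in> carrier R" if "l \<in> arrows G" "src G l = z" for l
    using that gg aF bF by (intro m_closed Fun_closed) (auto simp: groupoid_simps)
  have entry: "(matrices a \<alpha> (y, w) \<otimes>\<^bsub>?S\<^esub> matrices b \<alpha> (w, z)) g =
    (\<Oplus>l\<in>glue \<alpha> (w, z) ` H w. a (glue \<alpha> (y, z) g \<star> ginv l) \<otimes> b l)" if w: "w \<in> Orb \<alpha>" for w
  proof -
    have inj: "inj_on (glue \<alpha> (w, z)) (H w)"
      by (rule inj_on_inverseI[where g = "unglue \<alpha>"]) (use glue[OF qwz(1)[OF w]] in \<open>auto simp: H_def\<close>)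
    have fs: "matrices a \<alpha> (y, w) \<in> I.OG.Fun" "matrices b \<alpha> (w, z) \<in> I.OG.fibre_finite" "matrices b \<alpha> (w, z) \<in> I.OG.Fun"
      using ent[OF w] I.OG.finite_support_fibre_finite I.OG.finite_supportD(1) I.group_ring_carrier by auto
    have HI: "h \<in> carrier (Iso \<alpha>)" "g \<star> ginv h \<in> carrier (Iso \<alpha>)" if "h \<in> H w" for h
      using that g by (auto simp: H_def isotropy_carrier groupoid_simps)
    have eqt: "matrices a \<alpha> (y, w) (g \<star> ginv h) \<otimes> matrices b \<alpha> (w, z) h =
      a (glue \<alpha> (y, z) g \<star> ginv (glue \<alpha> (w, z) h)) \<otimes> b (glue \<alpha> (w, z) h)" if "h \<in> H w" for h
      using HI[OF that] glue_div[OF y w z g] matrices_apply[OF \<alpha> qwz(1)[OF w]] matrices_apply[OF \<alpha> qwz(2)[OF w]] by simp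
    have glH: "glue \<alpha> (w, z) h \<in> arrows G" "src G (glue \<alpha> (w, z) h) = z" if "h \<in> H w" for h
      using glue[OF qwz(1)[OF w] HI(1)[OF that]] by auto
    have Hset: "{h \<in> arrows (one_object_groupoid (Iso \<alpha>)). src (one_object_groupoid (Iso \<alpha>)) h = src (one_object_groupoid (Iso \<alpha>)) g
        \<and> matrices b \<alpha> (w, z) h \<noteq> \<zero>} = H w"
      using matrices_apply[OF \<alpha> qwz(1)[OF w]] by (auto simp: H_def)
    have "(matrices a \<alpha> (y, w) \<otimes>\<^bsub>?S\<^esub> matrices b \<alpha> (w, z)) g = I.OG.conv (matrices a \<alpha> (y, w)) (matrices b \<alpha> (w, z)) g"
      using I.group_ring_mult fs by simp
    also have "\<dots> = (\<Oplus>h\<in>H w. matrices a \<alpha> (y, w) (g \<otimes>\<^bsub>Iso \<alpha>\<^esub> I.OG.ginv h) \<otimes> matrices b \<alpha> (w, z) h)"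
      using I.OG.conv_eq_finsum_support[OF fs(1,2), of g] g unfolding Hset by simp
    also have "\<dots> = (\<Oplus>h\<in>H w. a (glue \<alpha> (y, z) g \<star> ginv (glue \<alpha> (w, z) h)) \<otimes> b (glue \<alpha> (w, z) h))"
    proof (rule finsum_cong'[OF refl])
      fix h assume h: "h \<in> H w"
      have "I.OG.ginv h = ginv h" using I.OG_inv isotropy_inv[OF rep_unit[OF \<alpha>]] HI(1)[OF h] by simp
      then show "matrices a \<alpha> (y, w) (g \<otimes>\<^bsub>Iso \<alpha>\<^esub> I.OG.ginv h) \<otimes> matrices b \<alpha> (w, z) h =
        a (glue \<alpha> (y, z) g \<star> ginv (glue \<alpha> (w, z) h)) \<otimes> b (glue \<alpha> (w, z) h)"
        using eqt[OF h] by simp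
    qed (use clos glH in auto)
    also have "\<dots> = (\<Oplus>l\<in>glue \<alpha> (w, z) ` H w. a (glue \<alpha> (y, z) g \<star> ginv l) \<otimes> b l)"
      by (rule finsum_reindex[OF _ inj, symmetric]) (use clos glH in auto)
    finally show ?thesis .
  qed
  have "matrices (conv a b) \<alpha> (y, z) g = conv a b (glue \<alpha> (y, z) g)"
    by (rule matrices_apply[OF \<alpha> qwz(2)[OF z] g])
  also have "\<dots> = (\<Oplus>l\<in>(\<Union>w\<in>W. glue \<alpha> (w, z) ` H w). a (glue \<alpha> (y, z) g \<star> ginv l) \<otimes> b l)"
    using conv_eq_finsum_support[OF aF subsetD[OF finite_support_fibre_finite b] gg(1)] gg(2) fib by simp
  also have "\<dots> = (\<Oplus>w\<in>W. \<Oplus>l\<in>glue \<alpha> (w, z) ` H w. a (glue \<alpha> (y, z) g \<star> ginv l) \<otimes> b l)"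
  proof (rule add.finprod_UN_disjoint)
    show "pairwise (\<lambda>i j. disjnt (glue \<alpha> (i, z) ` H i) (glue \<alpha> (j, z) ` H j)) W"
    proof (rule pairwiseI)
      fix w w' assume w: "w \<in> W" "w' \<in> W" "w \<noteq> w'"
      have t: "tgt G (glue \<alpha> (w, z) h) = w" if "w \<in> W" "h \<in> H w" for w h
        using glue(3)[OF qwz(1), of w h] that W by (auto simp: H_def)
      have "glue \<alpha> (w, z) h \<noteq> glue \<alpha> (w', z) h'" if "h \<in> H w" "h' \<in> H w'" for h h'
        using t[OF w(1) that(1)] t[OF w(2) that(2)] w(3) by metis
      then show "disjnt (glue \<alpha> (w, z) ` H w) (glue \<alpha> (w', z) ` H w')"
        unfolding disjnt_iff by blast
    qed
    fix w l assume "w \<in> W" "l \<in> glue \<alpha> (w, z) ` H w"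
    then have "l \<in> {l \<in> arrows G. src G l = z \<and> b l \<noteq> \<zero>}" unfolding fib by blast
    then show "a (glue \<alpha> (y, z) g \<star> ginv l) \<otimes> b l \<in> carrier R" using clos by blast
  qed (use W H in auto)
  also have "\<dots> = (\<Oplus>w\<in>W. (matrices a \<alpha> (y, w) \<otimes>\<^bsub>?S\<^esub> matrices b \<alpha> (w, z)) g)"
  proof (rule finsum_cong'[OF refl])
    have "matrices a \<alpha> (y, w) \<otimes>\<^bsub>?S\<^esub> matrices b \<alpha> (w, z) \<in> carrier ?S" if "w \<in> W" for w
      using S.m_closed ent that W by blast
    then show "(\<lambda>w. (matrices a \<alpha> (y, w) \<otimes>\<^bsub>?S\<^esub> matrices b \<alpha> (w, z)) g) \<in> W \<rightarrow> carrier R"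
      using g by fastforce
    fix w assume "w \<in> W"
    then show "(\<Oplus>l\<in>glue \<alpha> (w, z) ` H w. a (glue \<alpha> (y, z) g \<star> ginv l) \<otimes> b l) =
      (matrices a \<alpha> (y, w) \<otimes>\<^bsub>?S\<^esub> matrices b \<alpha> (w, z)) g" using entry W by auto
  qed
  also have "\<dots> = (\<Oplus>\<^bsub>?S\<^esub>w\<in>W. matrices a \<alpha> (y, w) \<otimes>\<^bsub>?S\<^esub> matrices b \<alpha> (w, z)) g"
    by (rule I.group_ring_finsum_apply[symmetric]) (use W S.m_closed ent g in blast)+
  also have "(\<Oplus>\<^bsub>?S\<^esub>w\<in>W. matrices a \<alpha> (y, w) \<otimes>\<^bsub>?S\<^esub> matrices b \<alpha> (w, z)) =
    (\<Oplus>\<^bsub>?S\<^esub>w\<in>{w \<in> Orb \<alpha>. matrices a \<alpha> (y, w) \<otimes>\<^bsub>?S\<^esub> matrices b \<alpha> (w, z) \<noteq> \<zero>\<^bsub>?S\<^esub>}.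
      matrices a \<alpha> (y, w) \<otimes>\<^bsub>?S\<^esub> matrices b \<alpha> (w, z))"
  proof (rule S.finsum_support[symmetric, OF W(1) _ W(2)])
    show "{w \<in> Orb \<alpha>. matrices a \<alpha> (y, w) \<otimes>\<^bsub>?S\<^esub> matrices b \<alpha> (w, z) \<noteq> \<zero>\<^bsub>?S\<^esub>} \<subseteq> W"
    proof (rule subsetI, rule ccontr)
      fix w assume w: "w \<in> {w \<in> Orb \<alpha>. matrices a \<alpha> (y, w) \<otimes>\<^bsub>?S\<^esub> matrices b \<alpha> (w, z) \<noteq> \<zero>\<^bsub>?S\<^esub>}" "w \<notin> W"
      have "matrices b \<alpha> (w, z) h = \<zero>" if "h \<in> carrier (Iso \<alpha>)" for h
        using w that glue[OF qwz(1) that, of w] matrices_apply[OF \<alpha> qwz(1) that, of w] by (force simp: W_def)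
      then have "matrices b \<alpha> (w, z) = \<zero>\<^bsub>?S\<^esub>"
        using ent(2) w(1) by (intro PiE_ext[of _ "carrier (Iso \<alpha>)" "\<lambda>_. carrier R"]) auto
      moreover have "w \<in> Orb \<alpha>" using w(1) by blast
      ultimately have "matrices a \<alpha> (y, w) \<otimes>\<^bsub>?S\<^esub> matrices b \<alpha> (w, z) = \<zero>\<^bsub>?S\<^esub>"
        using S.r_null[OF ent(1)[of w]] by (simp only:)
      then show False using w(1) by blast
    qed
  qed (use W S.m_closed ent in blast)
  finally show ?thesis .
qed

theorem finite_support_isomorphic_matrices: "rng_isomorphic (conv_ring finite_support) MatSum"
  unfolding rng_isomorphic_def
proof (intro exI[of _ matrices] conjI ballI)
  show "bij_betw matrices (carrier (conv_ring finite_support)) (carrier MatSum)"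
    using matrices_inj matrices_closed matrices_surj by (auto simp: bij_betw_def)
next
  fix a b assume "a \<in> carrier (conv_ring finite_support)" "b \<in> carrier (conv_ring finite_support)"
  then have a: "a \<in> finite_support" and b: "b \<in> finite_support" by auto
  show "matrices (a \<oplus>\<^bsub>conv_ring finite_support\<^esub> b) = matrices a \<oplus>\<^bsub>MatSum\<^esub> matrices b"
    by (auto simp: matrices_def direct_sum_ring_def matrix_ring_def fun_eq_iff glue)
  have ab: "conv a b \<in> finite_support" using a b by (rule conv_finite_support)
  show "matrices (a \<otimes>\<^bsub>conv_ring finite_support\<^esub> b) = matrices a \<otimes>\<^bsub>MatSum\<^esub> matrices b"
  proof (rule extensionalityI)
    show "matrices (a \<otimes>\<^bsub>conv_ring finite_support\<^esub> b) \<in> extensional J" by (simp add: matrices_def)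
    show "matrices a \<otimes>\<^bsub>MatSum\<^esub> matrices b \<in> extensional J" by (simp add: direct_sum_ring_def)
    fix \<alpha> assume \<alpha>: "\<alpha> \<in> J"
    interpret I: group_coefficients R "Iso \<alpha>" by (rule isotropy_group_coefficients[OF rep_unit[OF \<alpha>]])
    interpret S: nonunital_ring "IsoRing \<alpha>" by (rule I.nonunital_group_ring)
    have prod: "(matrices a \<otimes>\<^bsub>MatSum\<^esub> matrices b) \<alpha> = (\<lambda>(i, j)\<in>Orb \<alpha> \<times> Orb \<alpha>.
       \<Oplus>\<^bsub>IsoRing \<alpha>\<^esub>k\<in>{k \<in> Orb \<alpha>. matrices a \<alpha> (i, k) \<otimes>\<^bsub>IsoRing \<alpha>\<^esub> matrices b \<alpha> (k, j) \<noteq> \<zero>\<^bsub>IsoRing \<alpha>\<^esub>}.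
       matrices a \<alpha> (i, k) \<otimes>\<^bsub>IsoRing \<alpha>\<^esub> matrices b \<alpha> (k, j))"
      using \<alpha> by (simp add: direct_sum_ring_def matrix_ring_def del: group_ring_simps)
    show "matrices (a \<otimes>\<^bsub>conv_ring finite_support\<^esub> b) \<alpha> = (matrices a \<otimes>\<^bsub>MatSum\<^esub> matrices b) \<alpha>"
      unfolding prod
    proof (rule extensionalityI)
      show "matrices (a \<otimes>\<^bsub>conv_ring finite_support\<^esub> b) \<alpha> \<in> extensional (Orb \<alpha> \<times> Orb \<alpha>)"
        using \<alpha> by (simp add: matrices_def)
      fix q assume "q \<in> Orb \<alpha> \<times> Orb \<alpha>"
      then obtain y z where q: "q = (y, z)" "y \<in> Orb \<alpha>" "z \<in> Orb \<alpha>" by auto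
      let ?P = "\<Oplus>\<^bsub>IsoRing \<alpha>\<^esub>k\<in>{k \<in> Orb \<alpha>. matrices a \<alpha> (y, k) \<otimes>\<^bsub>IsoRing \<alpha>\<^esub> matrices b \<alpha> (k, z) \<noteq> \<zero>\<^bsub>IsoRing \<alpha>\<^esub>}.
        matrices a \<alpha> (y, k) \<otimes>\<^bsub>IsoRing \<alpha>\<^esub> matrices b \<alpha> (k, z)"
      have "matrices a \<alpha> (y, k) \<otimes>\<^bsub>IsoRing \<alpha>\<^esub> matrices b \<alpha> (k, z) \<in> carrier (IsoRing \<alpha>)" if "k \<in> Orb \<alpha>" for k
        using matrices_entry_closed[OF a \<alpha>] matrices_entry_closed[OF b \<alpha>] q that by (intro S.m_closed) auto
      then have P: "?P \<in> carrier (IsoRing \<alpha>)" by (intro S.finsum_closed) auto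
      have ext: "carrier (IsoRing \<alpha>) \<subseteq> extensional (carrier (Iso \<alpha>))" by (auto simp: PiE_def)
      have "matrices (conv a b) \<alpha> (y, z) = ?P"
      proof (rule extensionalityI)
        show "matrices (conv a b) \<alpha> (y, z) \<in> extensional (carrier (Iso \<alpha>))" using \<alpha> q by (simp add: matrices_def)
        show "?P \<in> extensional (carrier (Iso \<alpha>))" using P ext by blast
      qed (rule matrices_conv[OF a b \<alpha> q(2,3)])
      then show "matrices (a \<otimes>\<^bsub>conv_ring finite_support\<^esub> b) \<alpha> q =
        (\<lambda>(i, j)\<in>Orb \<alpha> \<times> Orb \<alpha>. \<Oplus>\<^bsub>IsoRing \<alpha>\<^esub>k\<in>{k \<in> Orb \<alpha>. matrices a \<alpha> (i, k) \<otimes>\<^bsub>IsoRing \<alpha>\<^esub> matrices b \<alpha> (k, j) \<noteq> \<zero>\<^bsub>IsoRing \<alpha>\<^esub>}.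
         matrices a \<alpha> (i, k) \<otimes>\<^bsub>IsoRing \<alpha>\<^esub> matrices b \<alpha> (k, j)) q"
        using q by (simp del: group_ring_simps)
    qed (simp del: group_ring_simps)
  qed
qed

end

section \<open>Infinite groups whose proper subgroups are finite\<close>

text \<open>An infinite cyclic group has the squares of its generator as a proper infinite subgroup.\<close>

lemma (in group) finite_cyclic_if_proper_finite:
  assumes proper: "\<And>K. subgroup K G \<Longrightarrow> infinite K \<Longrightarrow> K = carrier G" and g: "g \<in> carrier G"
  shows "finite (generate G {g})"
proof (rule ccontr)
  assume inf: "infinite (generate G {g})"
  have sub: "subgroup (generate G {a}) G" if "a \<in> carrier G" for a
    using that by (intro generate_is_subgroup) auto
  have o: "ord g = 0" using generate_pow_card[OF g] inf by simp
  have gg: "g \<otimes> g \<in> carrier G" using g by simp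
  have sq: "(g \<otimes> g) [^] k = g [^] (2 * k)" for k :: int
  proof -
    have "g \<otimes> g = g [^] (2 :: int)" using g int_pow_mult[of g 1 1] by (simp add: int_pow_1)
    then show ?thesis using int_pow_pow[OF g] by simp
  qed
  have "infinite (generate G {g \<otimes> g})"
  proof
    assume "finite (generate G {g \<otimes> g})"
    moreover have "generate G {g \<otimes> g} \<noteq> {}" using generate.one by blast
    ultimately have "ord (g \<otimes> g) \<noteq> 0" using generate_pow_card[OF gg] by simp
    moreover have "g [^] (2 * int (ord (g \<otimes> g))) = \<one>"
      using sq[of "int (ord (g \<otimes> g))"] pow_ord_eq_1[OF gg] by (simp add: int_pow_int)
    ultimately show False using int_pow_eq_id[OF g] o by simp
  qed
  then have "g \<in> generate G {g \<otimes> g}" using proper[OF sub[OF gg]] g by simp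
  then obtain k :: int where "g = (g \<otimes> g) [^] k" using generate_pow[OF gg] by auto
  then have "g [^] (1 :: int) = g [^] (2 * k)" using sq g by (simp add: int_pow_1)
  then have "int (ord g) dvd 2 * k - 1" using int_pow_eq[OF g] by blast
  then have "2 * k - 1 = 0" using o by simp
  then show False by presburger
qed

text \<open>If the centralizer of \<open>g\<close> is infinite, it is everything, so \<open>g\<close> is central. As \<open>g\<close> generates a finite group,
  its product with \<open>N\<close> is a larger finite normal subgroup.\<close>

lemma (in group) finite_centralizer_if_proper_finite:
  assumes proper: "\<And>K. subgroup K G \<Longrightarrow> infinite K \<Longrightarrow> K = carrier G"
    and N: "N \<lhd> G" "finite N" "\<And>M. M \<lhd> G \<Longrightarrow> finite M \<Longrightarrow> N \<subseteq> M \<Longrightarrow> M = N"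
    and g: "g \<in> carrier G" "g \<notin> N"
  shows "finite {x \<in> carrier G. x \<otimes> g = g \<otimes> x}"
proof (rule ccontr)
  assume inf: "infinite {x \<in> carrier G. x \<otimes> g = g \<otimes> x}"
  have centralizer: "subgroup {x \<in> carrier G. x \<otimes> a = a \<otimes> x} G" if a: "a \<in> carrier G" for a
  proof (rule subgroupI)
    show "{x \<in> carrier G. x \<otimes> a = a \<otimes> x} \<noteq> {}" using a by (auto intro!: exI[of _ \<one>])
    show "inv x \<in> {x \<in> carrier G. x \<otimes> a = a \<otimes> x}" if "x \<in> {x \<in> carrier G. x \<otimes> a = a \<otimes> x}" for x
    proof -
      have x: "x \<in> carrier G" "x \<otimes> a = a \<otimes> x" using that by auto
      have "inv x \<otimes> a = inv x \<otimes> (a \<otimes> x) \<otimes> inv x" using x a by (simp add: m_assoc)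
      also have "\<dots> = a \<otimes> inv x" using x a by (simp add: m_assoc[symmetric] flip: x(2))
      finally show ?thesis using x by simp
    qed
    show "x \<otimes> y \<in> {x \<in> carrier G. x \<otimes> a = a \<otimes> x}"
      if "x \<in> {x \<in> carrier G. x \<otimes> a = a \<otimes> x}" "y \<in> {x \<in> carrier G. x \<otimes> a = a \<otimes> x}" for x y
      using that a by (auto simp: m_assoc) (metis m_assoc)
  qed auto
  have "{x \<in> carrier G. x \<otimes> g = g \<otimes> x} = carrier G" by (rule proper[OF centralizer[OF g(1)] inf])
  then have central: "x \<otimes> g = g \<otimes> x" if "x \<in> carrier G" for x using that by blast
  have Zc: "z \<in> carrier G" "x \<otimes> z = z \<otimes> x" if "z \<in> generate G {g}" "x \<in> carrier G" for z x
  proof -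
    have "generate G {g} \<subseteq> {z \<in> carrier G. z \<otimes> x = x \<otimes> z}"
      by (rule generate_subgroup_incl[OF _ centralizer[OF that(2)]]) (use g central that in auto)
    then show "z \<in> carrier G" "x \<otimes> z = z \<otimes> x" using that by auto
  qed
  interpret N: normal N G by (rule N(1))
  have Zsub: "subgroup (generate G {g}) G" using g by (intro generate_is_subgroup) auto
  define M where "M = N <#> generate G {g}"
  have M_iff: "m \<in> M \<longleftrightarrow> (\<exists>n\<in>N. \<exists>z\<in>generate G {g}. m = n \<otimes> z)" for m
    by (auto simp: M_def set_mult_def)
  have "M \<lhd> G"
    unfolding normal_inv_iff
  proof (intro conjI ballI)
    show "subgroup M G" unfolding M_def by (rule mult_norm_subgroup[OF N(1) Zsub])
    fix x m assume x: "x \<in> carrier G" and "m \<in> M"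
    then obtain n z where nz: "n \<in> N" "z \<in> generate G {g}" "m = n \<otimes> z" by (auto simp: M_iff)
    have c: "n \<in> carrier G" "z \<in> carrier G" using nz Zc x by auto
    have "x \<otimes> m \<otimes> inv x = x \<otimes> n \<otimes> (z \<otimes> inv x)" using x c nz by (simp add: m_assoc)
    also have "\<dots> = x \<otimes> n \<otimes> inv x \<otimes> z" using x c Zc(2)[OF nz(2), of "inv x"] by (simp add: m_assoc)
    finally show "x \<otimes> m \<otimes> inv x \<in> M" using N.inv_op_closed2[OF x nz(1)] nz(2) by (auto simp: M_iff)
  qed
  moreover have "finite M"
  proof -
    have "M = (\<lambda>(n, z). n \<otimes> z) ` (N \<times> generate G {g})" by (auto simp: M_def set_mult_def)
    then show ?thesis using N(2) finite_cyclic_if_proper_finite[OF proper g(1)] by simp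
  qed
  moreover have "N \<subseteq> M"
  proof
    fix n assume n: "n \<in> N"
    then have "n = n \<otimes> \<one>" by simp
    then show "n \<in> M" using n generate.one unfolding M_iff by blast
  qed
  ultimately have "M = N" by (rule N(3))
  moreover have "g \<in> M" unfolding M_iff
    using g generate.incl[of g "{g}" G] by (intro bexI[of _ \<one>] bexI[of _ g]) auto
  ultimately show False using g by simp
qed

section \<open>Artinian group rings\<close>

context group_coefficients
begin

abbreviation FS :: "('h \<Rightarrow> 'r) set" where "FS \<equiv> OG.finite_support"
abbreviation GA :: "('h \<Rightarrow> 'r) ring" where "GA \<equiv> OG.conv_ring OG.finite_support"
abbreviation \<delta> :: "'h \<Rightarrow> 'h \<Rightarrow> 'r" where "\<delta> h \<equiv> char_fun R (carrier H) {h}"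
abbreviation hmult (infixl "\<circ>\<^sub>H" 70) where "a \<circ>\<^sub>H b \<equiv> a \<otimes>\<^bsub>H\<^esub> b"
abbreviation hinv where "hinv a \<equiv> inv\<^bsub>H\<^esub> a"

definition translate :: "'h \<Rightarrow> ('h \<Rightarrow> 'r) \<Rightarrow> 'h \<Rightarrow> 'r"
  where "translate h f = (\<lambda>g\<in>carrier H. f (hinv h \<circ>\<^sub>H g))"

lemma FS_fun: "f \<in> FS \<Longrightarrow> g \<in> carrier H \<Longrightarrow> f g \<in> carrier R"
  using OG.finite_supportD(1) by auto

lemma \<delta>_FS: "\<delta> h \<in> FS" using OG.chi_finite_support[of "{h}"] by simp

lemma \<delta>_apply [simp]: "g \<in> carrier H \<Longrightarrow> \<delta> h g = (if g = h then \<one> else \<zero>)" by (simp add: char_fun_def)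

lemma \<delta>_Fun: "\<delta> h \<in> carrier H \<rightarrow>\<^sub>E carrier R" by (auto simp: char_fun_def)

lemma FS_Fun: "f \<in> FS \<Longrightarrow> f \<in> carrier H \<rightarrow>\<^sub>E carrier R" using OG.finite_supportD(1) by simp

lemma \<delta>_conv:
  assumes "h \<in> carrier H" "f \<in> FS" shows "OG.conv (\<delta> h) f = translate h f"
proof (rule OG.Fun_eqI)
  have f: "f \<in> OG.Fun" using assms OG.finite_supportD by blast
  show "OG.conv (\<delta> h) f \<in> OG.Fun" using OG.conv_in_Fun[OF _ f] \<delta>_Fun by simp
  show "translate h f \<in> OG.Fun" using f assms by (auto simp: translate_def)
  fix g assume g: "g \<in> arrows (one_object_groupoid H)"
  have "OG.conv (\<delta> h) f g = \<delta> h h \<otimes> f (cmp (one_object_groupoid H) (OG.ginv h) g)"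
    by (rule OG.conv_single_left[OF _ f g]) (use assms \<delta>_Fun in auto)
  then show "OG.conv (\<delta> h) f g = translate h f g"
    using g assms OG_inv FS_fun[OF assms(2)] by (simp add: translate_def)
qed

lemma translate_FS: "h \<in> carrier H \<Longrightarrow> f \<in> FS \<Longrightarrow> translate h f \<in> FS"
  using \<delta>_conv[of h f] OG.conv_finite_support[OF \<delta>_FS] by metis

text \<open>Closure under scalars and under translations suffices, because the group ring is spanned by point masses.\<close>

lemma left_idealI:
  assumes "I \<subseteq> FS" "(\<lambda>g\<in>carrier H. \<zero>) \<in> I"
    "\<And>f f'. f \<in> I \<Longrightarrow> f' \<in> I \<Longrightarrow> (\<lambda>g\<in>carrier H. f g \<oplus> f' g) \<in> I"
    "\<And>r f. r \<in> carrier R \<Longrightarrow> f \<in> I \<Longrightarrow> (\<lambda>g\<in>carrier H. r \<otimes> f g) \<in> I"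
    "\<And>h f. h \<in> carrier H \<Longrightarrow> f \<in> I \<Longrightarrow> translate h f \<in> I"
  shows "left_ideal I GA"
proof -
  interpret GA: nonunital_ring GA by (rule OG.nonunital_ring_finite_support)
  have neg: "(\<lambda>g\<in>carrier H. \<ominus> f g) \<in> I" if f: "f \<in> I" for f
  proof -
    have "(\<lambda>g\<in>carrier H. \<ominus> \<one> \<otimes> f g) = (\<lambda>g\<in>carrier H. \<ominus> f g)"
      using f assms(1) FS_fun by (intro restrict_ext) (auto simp: R.l_minus)
    then show ?thesis using assms(4)[of "\<ominus> \<one>" f] f by simp
  qed
  have "FS \<subseteq> {a \<in> FS. \<forall>f\<in>I. OG.conv a f \<in> I}"
  proof (rule OG.finite_support_minimal)
    show "OG.chi {g} \<in> {a \<in> FS. \<forall>f\<in>I. OG.conv a f \<in> I}" if "g \<in> arrows (one_object_groupoid H)" for g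
      using that assms(1,5) \<delta>_FS \<delta>_conv by (auto simp: subset_iff)
    have ff: "f \<in> OG.fibre_finite" if "f \<in> I" for f using that assms(1) OG.finite_support_fibre_finite by blast
    have fF: "f \<in> OG.Fun" if "f \<in> FS" for f using that OG.finite_supportD by blast
    show "submodule {a \<in> FS. \<forall>f\<in>I. OG.conv a f \<in> I} R (function_module R (arrows (one_object_groupoid H)))"
      unfolding OG.submodule_function_module_iff
    proof (intro conjI ballI)
      show "{a \<in> FS. \<forall>f\<in>I. OG.conv a f \<in> I} \<subseteq> OG.Fun" using fF by blast
      have "OG.conv (\<lambda>g\<in>carrier H. \<zero>) f = (\<lambda>g\<in>carrier H. \<zero>)" if "f \<in> I" for f
        using GA.l_null[of f] that assms(1) by auto
      then show "(\<lambda>g\<in>arrows (one_object_groupoid H). \<zero>) \<in> {a \<in> FS. \<forall>f\<in>I. OG.conv a f \<in> I}"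
        using assms(2) OG.finite_support_zero by simp
    next
      fix a b assume "a \<in> {a \<in> FS. \<forall>f\<in>I. OG.conv a f \<in> I}" "b \<in> {a \<in> FS. \<forall>f\<in>I. OG.conv a f \<in> I}"
      then show "(\<lambda>g\<in>arrows (one_object_groupoid H). a g \<oplus> b g) \<in> {a \<in> FS. \<forall>f\<in>I. OG.conv a f \<in> I}"
        using assms(3) OG.finite_support_add OG.conv_add_left[OF fF fF ff] by simp
    next
      fix r a assume "r \<in> carrier R" "a \<in> {a \<in> FS. \<forall>f\<in>I. OG.conv a f \<in> I}"
      then show "(\<lambda>g\<in>arrows (one_object_groupoid H). r \<otimes> a g) \<in> {a \<in> FS. \<forall>f\<in>I. OG.conv a f \<in> I}"
        using assms(4) OG.finite_support_submodule OG.conv_smult_left[OF _ fF ff]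
        unfolding OG.submodule_function_module_iff by simp
    qed
  qed
  then have "\<forall>a\<in>FS. \<forall>f\<in>I. OG.conv a f \<in> I" by blast
  moreover have "\<ominus>\<^bsub>GA\<^esub> f = (\<lambda>g\<in>carrier H. \<ominus> f g)" if "f \<in> I" for f
    using OG.conv_ring_a_inv[OF OG.nonunital_ring_finite_support _ _ OG.finite_support_uminus] that assms(1)
      OG.finite_supportD(1) by (simp add: subset_iff)
  ultimately show ?thesis using assms(1-3) neg by (simp add: GA.left_ideal_iff)
qed

lemma left_idealD:
  assumes "left_ideal I GA"
  shows "I \<subseteq> FS" "(\<lambda>g\<in>carrier H. \<zero>) \<in> I"
    "f \<in> I \<Longrightarrow> f' \<in> I \<Longrightarrow> (\<lambda>g\<in>carrier H. f g \<oplus> f' g) \<in> I"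
    "f \<in> I \<Longrightarrow> (\<lambda>g\<in>carrier H. \<ominus> f g) \<in> I"
    "a \<in> FS \<Longrightarrow> f \<in> I \<Longrightarrow> OG.conv a f \<in> I"
    "h \<in> carrier H \<Longrightarrow> f \<in> I \<Longrightarrow> translate h f \<in> I"
    "r \<in> carrier R \<Longrightarrow> f \<in> I \<Longrightarrow> (\<lambda>g\<in>carrier H. r \<otimes> f g) \<in> I"
proof -
  interpret GA: nonunital_ring GA by (rule OG.nonunital_ring_finite_support)
  have I: "I \<subseteq> FS" "(\<lambda>g\<in>carrier H. \<zero>) \<in> I" "\<And>f f'. f \<in> I \<Longrightarrow> f' \<in> I \<Longrightarrow> (\<lambda>g\<in>carrier H. f g \<oplus> f' g) \<in> I"
    "\<And>f. f \<in> I \<Longrightarrow> \<ominus>\<^bsub>GA\<^esub> f \<in> I" "\<And>a f. a \<in> FS \<Longrightarrow> f \<in> I \<Longrightarrow> OG.conv a f \<in> I"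
    using assms by (auto simp: GA.left_ideal_iff)
  show "I \<subseteq> FS" "(\<lambda>g\<in>carrier H. \<zero>) \<in> I" "f \<in> I \<Longrightarrow> f' \<in> I \<Longrightarrow> (\<lambda>g\<in>carrier H. f g \<oplus> f' g) \<in> I"
    "a \<in> FS \<Longrightarrow> f \<in> I \<Longrightarrow> OG.conv a f \<in> I" using I by auto
  show tr: "translate h f \<in> I" if "h \<in> carrier H" "f \<in> I" for h f
    using I(5)[OF \<delta>_FS[of h] that(2)] \<delta>_conv[of h f] that I(1) by auto
  show "(\<lambda>g\<in>carrier H. \<ominus> f g) \<in> I" if f: "f \<in> I"
    using I(4)[OF f] OG.conv_ring_a_inv[OF OG.nonunital_ring_finite_support _ _ OG.finite_support_uminus] f I(1)
      OG.finite_supportD(1) by (simp add: subset_iff)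
  show "(\<lambda>g\<in>carrier H. r \<otimes> f g) \<in> I" if r: "r \<in> carrier R" and f: "f \<in> I"
  proof -
    have f': "f \<in> FS" using f I(1) by blast
    have fF: "f \<in> OG.Fun" using f' OG.finite_supportD by blast
    have "translate \<one>\<^bsub>H\<^esub> f = f"
      by (rule OG.Fun_eqI) (use fF in \<open>auto simp: translate_def\<close>)
    then have "OG.conv (\<delta> \<one>\<^bsub>H\<^esub>) f = f" using \<delta>_conv[OF _ f'] by simp
    then have "OG.conv (\<lambda>g\<in>carrier H. r \<otimes> \<delta> \<one>\<^bsub>H\<^esub> g) f = (\<lambda>g\<in>carrier H. r \<otimes> f g)"
      using OG.conv_smult_left[OF r _ subsetD[OF OG.finite_support_fibre_finite f'], of "\<delta> \<one>\<^bsub>H\<^esub>"] \<delta>_Fun by simp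
    moreover have "(\<lambda>g\<in>carrier H. r \<otimes> \<delta> \<one>\<^bsub>H\<^esub> g) \<in> FS"
      using OG.finite_support_submodule r \<delta>_FS unfolding OG.submodule_function_module_iff by simp
    ultimately show ?thesis using I(5) f by metis
  qed
qed

lemma GA_isomorphic: "rng_isomorphic GA (group_ring R H)"
  unfolding rng_isomorphic_def
proof (intro exI[of _ "\<lambda>f. f"] conjI ballI)
  show "bij_betw (\<lambda>f. f) (carrier GA) (carrier (group_ring R H))"
    by (simp add: bij_betw_def OG.finite_support_def)
qed (use group_ring_mult OG.finite_supportD in auto)

lemma conv_left_form:
  assumes a: "a \<in> FS" and b: "b \<in> FS" and g: "g \<in> carrier H"
    and Y: "finite Y" "Y \<subseteq> carrier H" "\<And>h. h \<in> carrier H \<Longrightarrow> a h \<noteq> \<zero> \<Longrightarrow> h \<in> Y"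
  shows "OG.conv a b g = (\<Oplus>h\<in>Y. a h \<otimes> b (hinv h \<circ>\<^sub>H g))"
proof -
  have F: "a \<in> OG.Fun" "b \<in> OG.Fun" using a b OG.finite_supportD by auto
  have inj: "inj_on (\<lambda>h. hinv h \<circ>\<^sub>H g) Y"
    by (rule inj_onI) (use Y g in \<open>auto simp: subset_iff\<close>)
  have cancel: "g \<circ>\<^sub>H hinv (hinv h \<circ>\<^sub>H g) = h" if "h \<in> Y" for h
    using that Y g by (auto simp: subset_iff H.inv_mult_group H.m_assoc[symmetric])
  have cl: "a h \<otimes> b (hinv h \<circ>\<^sub>H g) \<in> carrier R" if "h \<in> Y" for h
    using that Y g FS_fun[OF a] FS_fun[OF b] by (auto simp: subset_iff)
  have "OG.conv a b g = (\<Oplus>k\<in>(\<lambda>h. hinv h \<circ>\<^sub>H g) ` Y. a (cmp (one_object_groupoid H) g (OG.ginv k)) \<otimes> b k)"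
  proof (rule OG.conv_eq_finsum[OF F])
    fix k assume k: "k \<in> arrows (one_object_groupoid H)"
      "a (cmp (one_object_groupoid H) g (OG.ginv k)) \<otimes> b k \<noteq> \<zero>"
    then have kH: "k \<in> carrier H" by simp
    have "a (g \<circ>\<^sub>H hinv k) \<noteq> \<zero>" using k OG_inv FS_fun[OF b kH] by auto
    then have "g \<circ>\<^sub>H hinv k \<in> Y" using Y(3) g kH by simp
    moreover have "hinv (g \<circ>\<^sub>H hinv k) \<circ>\<^sub>H g = k" using g kH by (simp add: H.inv_mult_group H.m_assoc)
    ultimately show "k \<in> (\<lambda>h. hinv h \<circ>\<^sub>H g) ` Y" by (metis image_eqI)
  qed (use g Y in auto)
  also have "\<dots> = (\<Oplus>h\<in>Y. a (cmp (one_object_groupoid H) g (OG.ginv (hinv h \<circ>\<^sub>H g))) \<otimes> b (hinv h \<circ>\<^sub>H g))"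
    using inj by (rule R.finsum_reindex[rotated]) (use cl cancel OG_inv Y g in \<open>auto simp: subset_iff\<close>)
  also have "\<dots> = (\<Oplus>h\<in>Y. a h \<otimes> b (hinv h \<circ>\<^sub>H g))"
    by (rule R.finsum_cong'[OF refl]) (use cl cancel OG_inv Y g in \<open>auto simp: subset_iff\<close>)
  finally show ?thesis .
qed

definition star :: "('h \<Rightarrow> 'r) \<Rightarrow> 'h \<Rightarrow> 'r" where "star f = (\<lambda>g\<in>carrier H. f (hinv g))"

lemma star_FS: assumes "f \<in> FS" shows "star f \<in> FS"
proof (rule OG.finite_supportI)
  show "star f \<in> OG.Fun" using FS_fun[OF assms] by (auto simp: star_def)
  show "finite (hinv ` {g \<in> carrier H. f g \<noteq> \<zero>})" using OG.finite_supportD(2)[OF assms] by simp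
  show "g \<in> hinv ` {g \<in> carrier H. f g \<noteq> \<zero>}"
    if "g \<in> arrows (one_object_groupoid H)" "star f g \<noteq> \<zero>" for g
    using that by (intro image_eqI[of _ _ "hinv g"]) (auto simp: star_def)
qed

lemma star_star: assumes "f \<in> FS" shows "star (star f) = f"
  by (rule OG.Fun_eqI) (use FS_fun[OF assms] OG.finite_supportD(1)[OF assms] in \<open>auto simp: star_def\<close>)

lemma star_conv:
  assumes a: "a \<in> FS" and b: "b \<in> FS" shows "star (OG.conv a b) = OG.conv (star b) (star a)"
proof (rule OG.Fun_eqI)
  have F: "a \<in> OG.Fun" "b \<in> OG.Fun" using a b OG.finite_supportD by auto
  show "star (OG.conv a b) \<in> OG.Fun" "OG.conv (star b) (star a) \<in> OG.Fun"
    using OG.finite_supportD(1)[OF star_FS[OF OG.conv_finite_support[OF a b]]]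
      OG.finite_supportD(1)[OF OG.conv_finite_support[OF star_FS[OF b] star_FS[OF a]]] by blast+
  fix g assume "g \<in> arrows (one_object_groupoid H)"
  then have g: "g \<in> carrier H" by simp
  let ?Y = "{h \<in> carrier H. a h \<noteq> \<zero>}"
  have Y: "finite ?Y" using OG.finite_supportD(2)[OF a] by simp
  have cl: "a h \<otimes> b (hinv h \<circ>\<^sub>H hinv g) \<in> carrier R" if "h \<in> carrier H" for h
    using that g FS_fun[OF a] FS_fun[OF b] by auto
  have "OG.conv (star b) (star a) g = (\<Oplus>k\<in>hinv ` ?Y. star b (cmp (one_object_groupoid H) g (OG.ginv k)) \<otimes> star a k)"
  proof (rule OG.conv_eq_finsum)
    fix k assume k: "k \<in> arrows (one_object_groupoid H)"
      "star b (cmp (one_object_groupoid H) g (OG.ginv k)) \<otimes> star a k \<noteq> \<zero>"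
    then have kH: "k \<in> carrier H" by simp
    have "star b (g \<circ>\<^sub>H hinv k) \<in> carrier R" using FS_fun[OF star_FS[OF b]] g kH by simp
    then have "star a k \<noteq> \<zero>" using k OG_inv[OF kH] by auto
    then have "hinv k \<in> ?Y" using kH by (simp add: star_def)
    then show "k \<in> hinv ` ?Y" using kH by (metis H.inv_inv image_eqI)
  next
    show "star b \<in> OG.Fun" "star a \<in> OG.Fun" using star_FS a b FS_Fun by simp_all
  qed (use g Y in auto)
  also have "\<dots> = (\<Oplus>h\<in>?Y. star b (cmp (one_object_groupoid H) g (OG.ginv (hinv h))) \<otimes> star a (hinv h))"
  proof (rule R.finsum_reindex)
    show "inj_on hinv ?Y" by (rule inj_onI) (metis (mono_tags, lifting) H.inv_inv mem_Collect_eq)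
    show "(\<lambda>k. star b (cmp (one_object_groupoid H) g (OG.ginv k)) \<otimes> star a k) \<in> hinv ` ?Y \<rightarrow> carrier R"
      using g FS_fun[OF star_FS[OF a]] FS_fun[OF star_FS[OF b]] OG_inv by auto
  qed
  also have "\<dots> = (\<Oplus>h\<in>?Y. a h \<otimes> b (hinv h \<circ>\<^sub>H hinv g))"
    by (rule R.finsum_cong'[OF refl])
      (use cl g OG_inv FS_fun[OF a] FS_fun[OF b] in \<open>auto simp: star_def H.inv_mult_group R.m_comm\<close>)
  also have "\<dots> = OG.conv a b (hinv g)"
    by (rule conv_left_form[OF a b, symmetric]) (use g Y in auto)
  finally show "star (OG.conv a b) g = OG.conv (star b) (star a) g" using g by (simp add: star_def)
qed

text \<open>Because of this involution only left ideals have to be considered.\<close>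

lemma GA_isomorphic_opposite: "rng_isomorphic GA (opposite_ring GA)"
  unfolding rng_isomorphic_def
proof (intro exI[of _ star] conjI ballI)
  show "bij_betw star (carrier GA) (carrier (opposite_ring GA))"
    by (rule bij_betwI[where g = star]) (auto simp: opposite_ring_def star_FS star_star)
  fix a b assume ab: "a \<in> carrier GA" "b \<in> carrier GA"
  show "star (a \<oplus>\<^bsub>GA\<^esub> b) = star a \<oplus>\<^bsub>opposite_ring GA\<^esub> star b"
    by (auto simp: opposite_ring_def star_def)
  show "star (a \<otimes>\<^bsub>GA\<^esub> b) = star a \<otimes>\<^bsub>opposite_ring GA\<^esub> star b"
    using ab star_conv by (simp add: opposite_ring_def)
qed

lemma chain_group_ring_left:
  assumes "chain_ring c s (group_ring R H)"
  shows "satisfies_chain c {I. left_ideal I GA}"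
proof -
  interpret GA: nonunital_ring GA by (rule OG.nonunital_ring_finite_support)
  have "chain_ring c s GA"
    by (rule chain_ring_isomorphic[OF GA.nonunital_ring_axioms nonunital_group_ring GA_isomorphic assms])
  then have "chain_ring c LeftSided (sided s GA)" by (simp add: chain_ring_def)
  moreover have "rng_isomorphic GA (sided s GA)"
    using GA_isomorphic_opposite by (cases s) (auto simp: rng_isomorphic_def intro!: exI[of _ "\<lambda>x. x"] bij_betw_imageI)
  ultimately have "chain_ring c LeftSided GA"
    using chain_ring_isomorphic[OF GA.nonunital_ring_axioms nonunital_ring_sided[OF GA.nonunital_ring_axioms]] by blast
  then show ?thesis by (simp add: chain_ring_def)
qed

lemma chain_coefficients:
  assumes chain: "satisfies_chain c {I. left_ideal I GA}"
  shows "chain_ring c s R"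
proof -
  have nR: "nonunital_ring R"
    by unfold_locales (auto simp: R.m_assoc R.l_distr R.r_distr)
  interpret S: nonunital_ring "sided s R" by (rule nonunital_ring_sided[OF nR])
  define V where "V I = {f \<in> FS. \<forall>g\<in>carrier H. f g \<in> I}" for I
  have Ic: "I \<subseteq> carrier R" "\<zero> \<in> I" "x \<in> I \<Longrightarrow> y \<in> I \<Longrightarrow> x \<oplus> y \<in> I"
    "r \<in> carrier R \<Longrightarrow> x \<in> I \<Longrightarrow> r \<otimes> x \<in> I" if "left_ideal I (sided s R)" for I x y r
  proof -
    have *: "I \<subseteq> carrier R" "\<zero> \<in> I" "\<forall>x\<in>I. \<forall>y\<in>I. x \<oplus> y \<in> I" "\<forall>r\<in>carrier R. \<forall>x\<in>I. r \<otimes>\<^bsub>sided s R\<^esub> x \<in> I"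
      using that by (auto simp: S.left_ideal_iff)
    then show "I \<subseteq> carrier R" "\<zero> \<in> I" "x \<in> I \<Longrightarrow> y \<in> I \<Longrightarrow> x \<oplus> y \<in> I" by auto
    assume "r \<in> carrier R" "x \<in> I"
    moreover from this * have "r \<otimes>\<^bsub>sided s R\<^esub> x = r \<otimes> x"
      by (cases s) (auto simp: opposite_ring_def R.m_comm)
    ultimately show "r \<otimes> x \<in> I" using * by metis
  qed
  have smul: "(\<lambda>g\<in>carrier H. r \<otimes> f g) \<in> FS" if "r \<in> carrier R" "f \<in> FS" for r f
    using OG.finite_support_submodule that unfolding OG.submodule_function_module_iff by simp
  show ?thesis unfolding chain_ring_def
  proof (rule satisfies_chain_embed1[OF chain, where \<phi> = V])
    fix I assume "I \<in> {I. left_ideal I (sided s R)}"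
    then have I: "left_ideal I (sided s R)" by simp
    have "left_ideal (V I) GA"
    proof (rule left_idealI)
      show "(\<lambda>g\<in>carrier H. \<zero>) \<in> V I" using OG.finite_support_zero Ic(2)[OF I] by (simp add: V_def)
      show "(\<lambda>g\<in>carrier H. f g \<oplus> f' g) \<in> V I" if "f \<in> V I" "f' \<in> V I" for f f'
        using OG.finite_support_add[of f f'] Ic(3)[OF I] that by (simp add: V_def)
      show "(\<lambda>g\<in>carrier H. r \<otimes> f g) \<in> V I" if "r \<in> carrier R" "f \<in> V I" for r f
        using smul Ic(4)[OF I] that by (simp add: V_def)
      show "translate h f \<in> V I" if "h \<in> carrier H" "f \<in> V I" for h f
        using translate_FS that by (simp add: V_def translate_def)
    qed (auto simp: V_def)
    then show "V I \<in> {I. left_ideal I GA}" by simp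
  next
    fix I I' assume II: "I \<in> {I. left_ideal I (sided s R)}" "I' \<in> {I. left_ideal I (sided s R)}" "V I = V I'"
    have sub: "I \<subseteq> I'" if I: "left_ideal I (sided s R)" "left_ideal I' (sided s R)" "V I = V I'" for I I'
    proof
      fix r assume r: "r \<in> I"
      have rR: "r \<in> carrier R" using r Ic(1)[OF I(1)] by auto
      define f where "f = (\<lambda>g\<in>carrier H. r \<otimes> \<delta> \<one>\<^bsub>H\<^esub> g)"
      have "f \<in> FS" unfolding f_def by (rule smul[OF rR \<delta>_FS])
      then have "f \<in> V I" using r rR Ic(2)[OF I(1)] by (auto simp: V_def f_def)
      then have "f \<in> V I'" using I(3) by simp
      then have "f \<one>\<^bsub>H\<^esub> \<in> I'" by (auto simp: V_def)
      then show "r \<in> I'" using rR by (simp add: f_def)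
    qed
    show "I = I'" using sub[of I I'] sub[of I' I] II by auto
  qed (auto simp: V_def)
qed

text \<open>A left ideal \<open>I\<close> of the group ring of \<open>K\<close> induces the left ideal of all functions whose restrictions to left
  cosets of \<open>K\<close>, moved to \<open>K\<close>, lie in \<open>I\<close>. An element of \<open>I\<close>, extended by zero, belongs to it, so \<open>I\<close> is
  recovered.\<close>

lemma chain_subgroup:
  assumes chain: "satisfies_chain c {I. left_ideal I GA}" and K: "subgroup K H"
  shows "satisfies_chain c {I. left_ideal I (group_coefficients.GA R (H\<lparr>carrier := K\<rparr>))}"
proof -
  interpret K: group_coefficients R "H\<lparr>carrier := K\<rparr>"
    by (intro group_coefficients.intro R.cring_axioms subgroup.subgroup_is_group[OF K] H.group_axioms)
  have KH: "k \<in> carrier H" if "k \<in> K" for k using K that subgroup.subset by blast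
  define V where "V I = {f \<in> FS. \<forall>g\<in>carrier H. (\<lambda>k\<in>K. f (g \<circ>\<^sub>H k)) \<in> I}" for I
  show ?thesis
  proof (rule satisfies_chain_embed1[OF chain, where \<phi> = V])
    fix I assume "I \<in> {I. left_ideal I K.GA}"
    then have I: "left_ideal I K.GA" by simp
    note Ic = K.left_idealD[OF I, simplified]
    have "left_ideal (V I) GA"
    proof (rule left_idealI)
      show "(\<lambda>g\<in>carrier H. \<zero>) \<in> V I"
        using OG.finite_support_zero Ic(2) KH by (auto simp: V_def cong: restrict_cong)
      show "(\<lambda>g\<in>carrier H. f g \<oplus> f' g) \<in> V I" if "f \<in> V I" "f' \<in> V I" for f f'
      proof -
        have "(\<lambda>k\<in>K. (\<lambda>g\<in>carrier H. f g \<oplus> f' g) (g \<circ>\<^sub>H k)) \<in> I" if g: "g \<in> carrier H" for g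
          using Ic(3)[of "\<lambda>k\<in>K. f (g \<circ>\<^sub>H k)" "\<lambda>k\<in>K. f' (g \<circ>\<^sub>H k)"] \<open>f \<in> V I\<close> \<open>f' \<in> V I\<close> g KH
          by (auto simp: V_def cong: restrict_cong)
        then show ?thesis using OG.finite_support_add[of f f'] that by (simp add: V_def)
      qed
      show "(\<lambda>g\<in>carrier H. r \<otimes> f g) \<in> V I" if r: "r \<in> carrier R" "f \<in> V I" for r f
      proof -
        have "(\<lambda>k\<in>K. (\<lambda>g\<in>carrier H. r \<otimes> f g) (g \<circ>\<^sub>H k)) \<in> I" if g: "g \<in> carrier H" for g
          using Ic(7)[of r "\<lambda>k\<in>K. f (g \<circ>\<^sub>H k)"] r g KH
          by (auto simp: V_def cong: restrict_cong)
        moreover have "(\<lambda>g\<in>carrier H. r \<otimes> f g) \<in> FS"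
          using OG.finite_support_submodule r unfolding OG.submodule_function_module_iff by (simp add: V_def)
        ultimately show ?thesis by (simp add: V_def)
      qed
      show "translate h f \<in> V I" if "h \<in> carrier H" "f \<in> V I" for h f
      proof -
        have "(\<lambda>k\<in>K. translate h f (g \<circ>\<^sub>H k)) = (\<lambda>k\<in>K. f ((hinv h \<circ>\<^sub>H g) \<circ>\<^sub>H k))" if "g \<in> carrier H" for g
          using that \<open>h \<in> carrier H\<close> KH by (intro restrict_ext) (simp add: translate_def H.m_assoc)
        then show ?thesis using translate_FS that by (simp add: V_def)
      qed
    qed (auto simp: V_def)
    then show "V I \<in> {I. left_ideal I GA}" by simp
  next
    fix I I' assume II: "I \<in> {I. left_ideal I K.GA}" "I' \<in> {I. left_ideal I K.GA}" "V I = V I'"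
    have sub: "I \<subseteq> I'" if I: "left_ideal I K.GA" "left_ideal I' K.GA" "V I = V I'" for I I'
    proof
      fix \<phi> assume \<phi>: "\<phi> \<in> I"
      have \<phi>FS: "\<phi> \<in> K.FS" using K.left_idealD(1)[OF I(1)] \<phi> by blast
      then have \<phi>K: "\<phi> \<in> K \<rightarrow>\<^sub>E carrier R" "finite {k \<in> K. \<phi> k \<noteq> \<zero>}"
        using K.OG.finite_supportD by auto
      define f where "f = (\<lambda>g\<in>carrier H. if g \<in> K then \<phi> g else \<zero>)"
      have fFS: "f \<in> FS"
        by (rule OG.finite_supportI[OF _ \<phi>K(2)]) (use \<phi>K(1) in \<open>auto simp: f_def split: if_splits\<close>)
      have "(\<lambda>k\<in>K. f (g \<circ>\<^sub>H k)) \<in> I" if g: "g \<in> carrier H" for g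
      proof (cases "g \<in> K")
        case True
        have "K.translate (hinv g) \<phi> = (\<lambda>k\<in>K. f (g \<circ>\<^sub>H k))"
          using True g KH K subgroup.m_closed[OF K True] subgroup.m_inv_closed[OF K True]
          by (auto simp: K.translate_def f_def H.m_inv_consistent[OF K] intro!: restrict_ext)
        then show ?thesis
          using K.left_idealD(6)[OF I(1) _ \<phi>, of "hinv g"] subgroup.m_inv_closed[OF K True] by simp
      next
        case False
        have "g \<circ>\<^sub>H k \<notin> K" if k: "k \<in> K" for k
        proof
          assume "g \<circ>\<^sub>H k \<in> K"
          then have "(g \<circ>\<^sub>H k) \<circ>\<^sub>H hinv k \<in> K" using k K subgroup.m_closed subgroup.m_inv_closed by metis
          then show False using False g KH[OF k] by (simp add: H.m_assoc)
        qed
        then have "(\<lambda>k\<in>K. f (g \<circ>\<^sub>H k)) = (\<lambda>k\<in>K. \<zero>)"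
          using g KH by (intro restrict_ext) (simp add: f_def)
        then show ?thesis using K.left_idealD(2)[OF I(1)] by simp
      qed
      then have "f \<in> V I" using fFS by (simp add: V_def)
      then have "f \<in> V I'" using I(3) by simp
      then have "(\<lambda>k\<in>K. f (\<one>\<^bsub>H\<^esub> \<circ>\<^sub>H k)) \<in> I'" by (simp add: V_def)
      moreover have "(\<lambda>k\<in>K. f (\<one>\<^bsub>H\<^esub> \<circ>\<^sub>H k)) = \<phi>"
        by (rule PiE_ext[OF _ \<phi>K(1)]) (use KH \<phi>K(1) in \<open>auto simp: f_def\<close>)
      ultimately show "\<phi> \<in> I'" by simp
    qed
    show "I = I'" using sub[of I I'] sub[of I' I] II by auto
  qed (auto simp: V_def)
qed

text \<open>Sums of values of \<open>f\<close> over cosets and the augmentation of \<open>f\<close> are pairings with the characteristic functions of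
  cosets and with the constant \<open>1\<close>.\<close>

definition pairing :: "('h \<Rightarrow> 'r) \<Rightarrow> ('h \<Rightarrow> 'r) \<Rightarrow> 'r"
  where "pairing f \<phi> = (\<Oplus>g\<in>{g \<in> carrier H. f g \<noteq> \<zero>}. f g \<otimes> \<phi> g)"

lemma FS_closed:
  "(\<lambda>g\<in>carrier H. \<zero>) \<in> FS" "a \<in> FS \<Longrightarrow> b \<in> FS \<Longrightarrow> (\<lambda>g\<in>carrier H. a g \<oplus> b g) \<in> FS"
  "r \<in> carrier R \<Longrightarrow> a \<in> FS \<Longrightarrow> (\<lambda>g\<in>carrier H. r \<otimes> a g) \<in> FS"
  using OG.finite_support_submodule unfolding OG.submodule_function_module_iff by simp_all

lemma FS_finite: "f \<in> FS \<Longrightarrow> finite {g \<in> carrier H. f g \<noteq> \<zero>}"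
  using OG.finite_supportD(2) by simp

lemma FS_eqI: "f \<in> FS \<Longrightarrow> f' \<in> FS \<Longrightarrow> (\<And>g. g \<in> carrier H \<Longrightarrow> f g = f' g) \<Longrightarrow> f = f'"
  by (rule PiE_ext[OF FS_Fun FS_Fun])

lemma pairing_eq:
  assumes f: "f \<in> FS" and \<phi>: "\<And>g. g \<in> carrier H \<Longrightarrow> \<phi> g \<in> carrier R"
    and Y: "finite Y" "Y \<subseteq> carrier H" "\<And>g. g \<in> carrier H \<Longrightarrow> f g \<noteq> \<zero> \<Longrightarrow> g \<in> Y"
  shows "pairing f \<phi> = (\<Oplus>g\<in>Y. f g \<otimes> \<phi> g)"
  unfolding pairing_def
  by (rule R.add.finprod_mono_neutral_cong_left) (use Y \<phi> FS_fun[OF f] in \<open>auto simp: subset_iff\<close>)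

lemma pairing_closed:
  assumes f: "f \<in> FS" and \<phi>: "\<And>g. g \<in> carrier H \<Longrightarrow> \<phi> g \<in> carrier R"
  shows "pairing f \<phi> \<in> carrier R"
  unfolding pairing_def by (rule R.finsum_closed) (use \<phi> FS_fun[OF f] in auto)

lemma pairing_zero: "pairing (\<lambda>g\<in>carrier H. \<zero>) \<phi> = \<zero>"
proof -
  have "{g \<in> carrier H. (\<lambda>g\<in>carrier H. \<zero>) g \<noteq> \<zero>} = {}" by auto
  then show ?thesis by (simp only: pairing_def R.finsum_empty)
qed

lemma pairing_add:
  assumes f: "f \<in> FS" "f' \<in> FS" and \<phi>: "\<And>g. g \<in> carrier H \<Longrightarrow> \<phi> g \<in> carrier R"
  shows "pairing (\<lambda>g\<in>carrier H. f g \<oplus> f' g) \<phi> = pairing f \<phi> \<oplus> pairing f' \<phi>"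
proof -
  let ?Y = "{g \<in> carrier H. f g \<noteq> \<zero>} \<union> {g \<in> carrier H. f' g \<noteq> \<zero>}"
  have Y: "finite ?Y" using f FS_finite by simp
  have cl: "f g \<in> carrier R" "f' g \<in> carrier R" "\<phi> g \<in> carrier R" if "g \<in> carrier H" for g
    using FS_fun f \<phi> that by auto
  have "pairing (\<lambda>g\<in>carrier H. f g \<oplus> f' g) \<phi> = (\<Oplus>g\<in>?Y. (\<lambda>g\<in>carrier H. f g \<oplus> f' g) g \<otimes> \<phi> g)"
    by (rule pairing_eq[OF FS_closed(2)[OF f] \<phi> Y]) auto
  also have "\<dots> = (\<Oplus>g\<in>?Y. f g \<otimes> \<phi> g \<oplus> f' g \<otimes> \<phi> g)"
    by (rule R.finsum_cong'[OF refl]) (use cl in \<open>auto simp: R.l_distr\<close>)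
  also have "\<dots> = (\<Oplus>g\<in>?Y. f g \<otimes> \<phi> g) \<oplus> (\<Oplus>g\<in>?Y. f' g \<otimes> \<phi> g)"
    by (rule R.finsum_addf) (use cl in auto)
  also have "(\<Oplus>g\<in>?Y. f g \<otimes> \<phi> g) = pairing f \<phi>"
    by (rule pairing_eq[OF f(1) \<phi> Y, symmetric]) auto
  also have "(\<Oplus>g\<in>?Y. f' g \<otimes> \<phi> g) = pairing f' \<phi>"
    by (rule pairing_eq[OF f(2) \<phi> Y, symmetric]) auto
  finally show ?thesis .
qed

lemma pairing_smult:
  assumes r: "r \<in> carrier R" and f: "f \<in> FS" and \<phi>: "\<And>g. g \<in> carrier H \<Longrightarrow> \<phi> g \<in> carrier R"
  shows "pairing (\<lambda>g\<in>carrier H. r \<otimes> f g) \<phi> = r \<otimes> pairing f \<phi>"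
proof -
  let ?Y = "{g \<in> carrier H. f g \<noteq> \<zero>}"
  have Y: "finite ?Y" using f FS_finite by simp
  have cl: "f g \<in> carrier R" "\<phi> g \<in> carrier R" if "g \<in> carrier H" for g
    using FS_fun f \<phi> that by auto
  have "pairing (\<lambda>g\<in>carrier H. r \<otimes> f g) \<phi> = (\<Oplus>g\<in>?Y. (\<lambda>g\<in>carrier H. r \<otimes> f g) g \<otimes> \<phi> g)"
    by (rule pairing_eq[OF FS_closed(3)[OF r f] \<phi> Y]) (use r in auto)
  also have "\<dots> = (\<Oplus>g\<in>?Y. r \<otimes> (f g \<otimes> \<phi> g))"
    by (rule R.finsum_cong'[OF refl]) (use cl r in \<open>auto simp: R.m_assoc\<close>)
  also have "\<dots> = r \<otimes> pairing f \<phi>"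
    unfolding pairing_def by (rule R.finsum_rdistr[OF Y r, symmetric]) (use cl in auto)
  finally show ?thesis .
qed

lemma pairing_translate:
  assumes h: "h \<in> carrier H" and f: "f \<in> FS" and \<phi>: "\<And>g. g \<in> carrier H \<Longrightarrow> \<phi> g \<in> carrier R"
  shows "pairing (translate h f) \<phi> = pairing f (\<lambda>g. \<phi> (h \<circ>\<^sub>H g))"
proof -
  let ?Y = "{g \<in> carrier H. f g \<noteq> \<zero>}"
  have Y: "finite ?Y" using f FS_finite by simp
  have cl: "f g \<in> carrier R" "\<phi> g \<in> carrier R" if "g \<in> carrier H" for g
    using FS_fun f \<phi> that by auto
  have inj: "inj_on (\<lambda>g. h \<circ>\<^sub>H g) ?Y" by (rule inj_onI) (use h in auto)
  have tr: "translate h f (h \<circ>\<^sub>H g) = f g" if "g \<in> carrier H" for g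
    using that h by (simp add: translate_def H.m_assoc[symmetric])
  have "pairing (translate h f) \<phi> = (\<Oplus>g\<in>(\<lambda>g. h \<circ>\<^sub>H g) ` ?Y. translate h f g \<otimes> \<phi> g)"
  proof (rule pairing_eq[OF translate_FS[OF h f] \<phi>])
    fix g assume g: "g \<in> carrier H" "translate h f g \<noteq> \<zero>"
    then have "hinv h \<circ>\<^sub>H g \<in> ?Y" using h by (simp add: translate_def)
    moreover have "g = h \<circ>\<^sub>H (hinv h \<circ>\<^sub>H g)" using g h by (simp add: H.m_assoc[symmetric])
    ultimately show "g \<in> (\<lambda>g. h \<circ>\<^sub>H g) ` ?Y" by blast
  qed (use Y h in auto)
  also have "\<dots> = (\<Oplus>g\<in>?Y. translate h f (h \<circ>\<^sub>H g) \<otimes> \<phi> (h \<circ>\<^sub>H g))"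
    by (rule R.finsum_reindex[OF _ inj]) (use tr cl h in auto)
  also have "\<dots> = (\<Oplus>g\<in>?Y. f g \<otimes> \<phi> (h \<circ>\<^sub>H g))"
    by (rule R.finsum_cong'[OF refl]) (use tr cl h in auto)
  finally show ?thesis by (simp add: pairing_def)
qed

lemma pairing_\<delta>:
  assumes h: "h \<in> carrier H" and \<phi>: "\<And>g. g \<in> carrier H \<Longrightarrow> \<phi> g \<in> carrier R"
  shows "pairing (\<delta> h) \<phi> = \<phi> h"
proof -
  have "pairing (\<delta> h) \<phi> = (\<Oplus>g\<in>{h}. \<delta> h g \<otimes> \<phi> g)"
    by (rule pairing_eq[OF \<delta>_FS \<phi>]) (use h in \<open>auto split: if_splits\<close>)
  then show ?thesis using h \<phi> by simp
qed

lemma conv_\<delta>_right: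
  assumes a: "a \<in> FS" and g: "g \<in> carrier H" and h: "h \<in> carrier H"
  shows "OG.conv a (\<delta> g) h = a (h \<circ>\<^sub>H hinv g)"
proof -
  have "OG.conv a (\<delta> g) h = a (cmp (one_object_groupoid H) h (OG.ginv g)) \<otimes> \<delta> g g"
    by (rule OG.conv_single_right) (use FS_Fun[OF a] \<delta>_Fun g h in auto)
  then show ?thesis using g h FS_fun[OF a] OG_inv by simp
qed

lemma pairing_conv_\<delta>:
  assumes g: "g \<in> carrier H" and f: "f \<in> FS" and \<phi>: "\<And>g. g \<in> carrier H \<Longrightarrow> \<phi> g \<in> carrier R"
  shows "pairing (OG.conv f (\<delta> g)) \<phi> = pairing f (\<lambda>k. \<phi> (k \<circ>\<^sub>H g))"
proof -
  let ?Y = "{k \<in> carrier H. f k \<noteq> \<zero>}"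
  have Y: "finite ?Y" using f FS_finite by simp
  have cl: "f g \<in> carrier R" "\<phi> g \<in> carrier R" if "g \<in> carrier H" for g
    using FS_fun f \<phi> that by auto
  have inj: "inj_on (\<lambda>k. k \<circ>\<^sub>H g) ?Y" by (rule inj_onI) (use g in auto)
  have tr: "OG.conv f (\<delta> g) (k \<circ>\<^sub>H g) = f k" if "k \<in> carrier H" for k
    using that g conv_\<delta>_right[OF f g, of "k \<circ>\<^sub>H g"] by (simp add: H.m_assoc)
  have "pairing (OG.conv f (\<delta> g)) \<phi> = (\<Oplus>k\<in>(\<lambda>k. k \<circ>\<^sub>H g) ` ?Y. OG.conv f (\<delta> g) k \<otimes> \<phi> k)"
  proof (rule pairing_eq[OF OG.conv_finite_support[OF f \<delta>_FS] \<phi>])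
    fix k assume k: "k \<in> carrier H" "OG.conv f (\<delta> g) k \<noteq> \<zero>"
    then have "k \<circ>\<^sub>H hinv g \<in> ?Y" using g conv_\<delta>_right[OF f g] by simp
    moreover have "k = (k \<circ>\<^sub>H hinv g) \<circ>\<^sub>H g" using g k by (simp add: H.m_assoc)
    ultimately show "k \<in> (\<lambda>k. k \<circ>\<^sub>H g) ` ?Y" by blast
  qed (use Y g in auto)
  also have "\<dots> = (\<Oplus>k\<in>?Y. OG.conv f (\<delta> g) (k \<circ>\<^sub>H g) \<otimes> \<phi> (k \<circ>\<^sub>H g))"
    by (rule R.finsum_reindex[OF _ inj]) (use tr cl g in auto)
  also have "\<dots> = (\<Oplus>k\<in>?Y. f k \<otimes> \<phi> (k \<circ>\<^sub>H g))"
    by (rule R.finsum_cong'[OF refl]) (use tr cl g in auto)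
  finally show ?thesis by (simp add: pairing_def)
qed

text \<open>Attach to a subgroup \<open>K\<close> the left ideal of all \<open>f\<close> whose sums over left cosets of \<open>K\<close> vanish. Expressed as
  orthogonality to all right \<open>K\<close>-invariant functions it visibly shrinks with \<open>K\<close>. The point mass at \<open>h\<close> minus
  the point mass at the identity belongs to it if and only if \<open>h \<in> K\<close>.\<close>

lemma minimal_infinite_subgroup:
  assumes chain: "satisfies_chain Artinian {I. left_ideal I GA}" and ne: "\<one> \<noteq> \<zero>"
    and inf: "infinite (carrier H)"
  obtains K where "subgroup K H" "infinite K" "\<And>K'. subgroup K' H \<Longrightarrow> infinite K' \<Longrightarrow> K' \<subseteq> K \<Longrightarrow> K' = K"
proof -
  define invariant where "invariant K \<phi> \<longleftrightarrow> (\<forall>g\<in>carrier H. \<phi> g \<in> carrier R) \<and>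
    (\<forall>g\<in>carrier H. \<forall>k\<in>K. \<phi> (g \<circ>\<^sub>H k) = \<phi> g)" for K and \<phi> :: "'h \<Rightarrow> 'r"
  define \<Lambda> where "\<Lambda> K = {f \<in> FS. \<forall>\<phi>. invariant K \<phi> \<longrightarrow> pairing f \<phi> = \<zero>}" for K
  have ideal: "left_ideal (\<Lambda> K) GA" if K: "subgroup K H" for K
  proof (rule left_idealI)
    have KH: "k \<in> carrier H" if "k \<in> K" for k using K that subgroup.subset by blast
    have c: "\<phi> g \<in> carrier R" if "invariant K \<phi>" "g \<in> carrier H" for \<phi> g using that by (simp add: invariant_def)
    show "\<Lambda> K \<subseteq> FS" by (auto simp: \<Lambda>_def)
    show "(\<lambda>g\<in>carrier H. \<zero>) \<in> \<Lambda> K" using FS_closed(1) pairing_zero by (auto simp: \<Lambda>_def)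
    show "(\<lambda>g\<in>carrier H. f g \<oplus> f' g) \<in> \<Lambda> K" if f: "f \<in> \<Lambda> K" "f' \<in> \<Lambda> K" for f f'
    proof -
      have "pairing (\<lambda>g\<in>carrier H. f g \<oplus> f' g) \<phi> = \<zero>" if \<phi>: "invariant K \<phi>" for \<phi>
        using pairing_add[of f f' \<phi>] c[OF \<phi>] f \<phi> by (simp add: \<Lambda>_def)
      then show ?thesis using f FS_closed(2) by (simp add: \<Lambda>_def)
    qed
    show "(\<lambda>g\<in>carrier H. r \<otimes> f g) \<in> \<Lambda> K" if r: "r \<in> carrier R" and f: "f \<in> \<Lambda> K" for r f
    proof -
      have "pairing (\<lambda>g\<in>carrier H. r \<otimes> f g) \<phi> = \<zero>" if \<phi>: "invariant K \<phi>" for \<phi>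
        using pairing_smult[of r f \<phi>] c[OF \<phi>] r f \<phi> by (simp add: \<Lambda>_def)
      then show ?thesis using r f FS_closed(3) by (simp add: \<Lambda>_def)
    qed
    show "translate h f \<in> \<Lambda> K" if h: "h \<in> carrier H" and f: "f \<in> \<Lambda> K" for h f
    proof -
      have "pairing (translate h f) \<phi> = \<zero>" if \<phi>: "invariant K \<phi>" for \<phi>
      proof -
        have "invariant K (\<lambda>g. \<phi> (h \<circ>\<^sub>H g))"
          using \<phi> h KH by (auto simp: invariant_def H.m_assoc[symmetric])
        then show ?thesis using pairing_translate[OF h _ c[OF \<phi>], of f] f by (auto simp: \<Lambda>_def)
      qed
      then show ?thesis using translate_FS h f by (auto simp: \<Lambda>_def)
    qed
  qed
  have mono: "\<Lambda> K' \<subseteq> \<Lambda> K" if "K' \<subseteq> K" for K K'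
    using that unfolding \<Lambda>_def invariant_def by blast
  have reflect: "K \<subseteq> K'" if K: "subgroup K H" "subgroup K' H" "\<Lambda> K \<subseteq> \<Lambda> K'" for K K'
  proof
    fix h assume h: "h \<in> K"
    have hH: "h \<in> carrier H" using K(1) h subgroup.subset by blast
    have K'H: "k \<in> carrier H" if "k \<in> K'" for k using K(2) that subgroup.subset by blast
    define f where "f = (\<lambda>g\<in>carrier H. \<delta> h g \<oplus> (\<lambda>g\<in>carrier H. \<ominus> \<one> \<otimes> \<delta> \<one>\<^bsub>H\<^esub> g) g)"
    have pf: "pairing f \<phi> = \<phi> h \<oplus> \<ominus> \<phi> \<one>\<^bsub>H\<^esub>" if "\<And>g. g \<in> carrier H \<Longrightarrow> \<phi> g \<in> carrier R" for \<phi>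
    proof -
      have "pairing f \<phi> = pairing (\<delta> h) \<phi> \<oplus> pairing (\<lambda>g\<in>carrier H. \<ominus> \<one> \<otimes> \<delta> \<one>\<^bsub>H\<^esub> g) \<phi>"
        unfolding f_def by (rule pairing_add[OF \<delta>_FS FS_closed(3)[OF _ \<delta>_FS] that]) auto
      also have "pairing (\<lambda>g\<in>carrier H. \<ominus> \<one> \<otimes> \<delta> \<one>\<^bsub>H\<^esub> g) \<phi> = \<ominus> \<one> \<otimes> pairing (\<delta> \<one>\<^bsub>H\<^esub>) \<phi>"
        by (rule pairing_smult[OF _ \<delta>_FS that]) auto
      finally show ?thesis using pairing_\<delta>[OF hH, of \<phi>] pairing_\<delta>[of "\<one>\<^bsub>H\<^esub>" \<phi>] that by (simp add: R.l_minus)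
    qed
    have fFS: "f \<in> FS" unfolding f_def by (rule FS_closed(2)[OF \<delta>_FS FS_closed(3)[OF _ \<delta>_FS]]) auto
    have "f \<in> \<Lambda> K"
    proof -
      have "pairing f \<phi> = \<zero>" if "invariant K \<phi>" for \<phi>
      proof -
        have c: "\<And>g. g \<in> carrier H \<Longrightarrow> \<phi> g \<in> carrier R" and "\<phi> (\<one>\<^bsub>H\<^esub> \<circ>\<^sub>H h) = \<phi> \<one>\<^bsub>H\<^esub>"
          using that h by (auto simp: invariant_def simp del: H.l_one)
        then show ?thesis using pf[OF c] hH by (simp add: R.r_neg)
      qed
      then show ?thesis using fFS by (simp add: \<Lambda>_def)
    qed
    then have f': "f \<in> \<Lambda> K'" using K(3) by blast
    define \<phi> where "\<phi> = (\<lambda>g. if g \<in> K' then \<one> else \<zero>)"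
    have "invariant K' \<phi>"
      unfolding invariant_def
    proof (intro conjI ballI)
      fix g k assume g: "g \<in> carrier H" and k: "k \<in> K'"
      have "g \<circ>\<^sub>H k \<in> K' \<longleftrightarrow> g \<in> K'"
      proof
        assume "g \<circ>\<^sub>H k \<in> K'"
        then have "(g \<circ>\<^sub>H k) \<circ>\<^sub>H hinv k \<in> K'" using k K(2) subgroup.m_closed subgroup.m_inv_closed by metis
        then show "g \<in> K'" using g K'H[OF k] by (simp add: H.m_assoc)
      qed (use subgroup.m_closed[OF K(2) _ k] in blast)
      then show "\<phi> (g \<circ>\<^sub>H k) = \<phi> g" by (simp add: \<phi>_def)
    qed (simp add: \<phi>_def)
    then have "pairing f \<phi> = \<zero>" using f' by (simp add: \<Lambda>_def)
    moreover have "pairing f \<phi> = \<phi> h \<oplus> \<ominus> \<phi> \<one>\<^bsub>H\<^esub>" by (rule pf) (simp add: \<phi>_def)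
    moreover have "\<phi> \<one>\<^bsub>H\<^esub> = \<one>" using subgroup.one_closed[OF K(2)] by (simp add: \<phi>_def)
    ultimately have "\<phi> h = \<one>" by (metis R.minus_equality R.minus_minus R.one_closed R.a_inv_closed \<phi>_def R.zero_closed)
    then show "h \<in> K'" using ne by (auto simp: \<phi>_def split: if_splits)
  qed
  have "carrier H \<in> {K. subgroup K H \<and> infinite K}" using inf H.subgroup_self by simp
  then have mem: "\<Lambda> (carrier H) \<in> \<Lambda> ` {K. subgroup K H \<and> infinite K}" by blast
  have fam: "\<Lambda> ` {K. subgroup K H \<and> infinite K} \<subseteq> {I. left_ideal I GA}" using ideal by blast
  obtain M where M: "M \<in> \<Lambda> ` {K. subgroup K H \<and> infinite K}"
    "\<forall>M'\<in>\<Lambda> ` {K. subgroup K H \<and> infinite K}. M' \<subseteq> M \<longrightarrow> M' = M"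
    using satisfies_chain_Artinian_minimal[OF chain fam mem] by (rule bexE)
  then obtain K where K: "subgroup K H" "infinite K" "M = \<Lambda> K" by auto
  show thesis
  proof (rule that[OF K(1,2)])
    fix K' assume K': "subgroup K' H" "infinite K'" "K' \<subseteq> K"
    then have "\<Lambda> K' \<in> \<Lambda> ` {K. subgroup K H \<and> infinite K}" by blast
    then have "\<Lambda> K' = \<Lambda> K" using M(2) mono[OF K'(3)] unfolding K(3) by (metis (no_types, lifting))
    then show "K' = K" using reflect[OF K(1) K'(1)] K'(3) by blast
  qed
qed

definition right_invariants :: "'h set \<Rightarrow> ('h \<Rightarrow> 'r) set"
  where "right_invariants K = {f \<in> FS. \<forall>g\<in>carrier H. \<forall>k\<in>K. f (g \<circ>\<^sub>H k) = f g}"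

lemma right_invariants_left_ideal:
  assumes K: "K \<subseteq> carrier H" shows "left_ideal (right_invariants K) GA"
proof (rule left_idealI)
  show "translate h f \<in> right_invariants K" if "h \<in> carrier H" "f \<in> right_invariants K" for h f
    using that K translate_FS
    by (auto simp: right_invariants_def translate_def subset_iff H.m_assoc[symmetric])
qed (use FS_closed K in \<open>auto simp: right_invariants_def subset_iff\<close>)

lemma indicator_right_invariant:
  assumes K: "subgroup K H" "finite K" shows "char_fun R (carrier H) K \<in> right_invariants K"
proof -
  have KH: "k \<in> carrier H" if "k \<in> K" for k using K(1) that subgroup.subset by blast
  have "g \<circ>\<^sub>H k \<in> K \<longleftrightarrow> g \<in> K" if g: "g \<in> carrier H" and k: "k \<in> K" for g k
  proof
    assume "g \<circ>\<^sub>H k \<in> K"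
    then have "(g \<circ>\<^sub>H k) \<circ>\<^sub>H hinv k \<in> K" using k K(1) subgroup.m_closed subgroup.m_inv_closed by metis
    then show "g \<in> K" using g KH[OF k] by (simp add: H.m_assoc)
  qed (use subgroup.m_closed[OF K(1) _ k] in blast)
  moreover have "char_fun R (carrier H) K \<in> FS" using OG.chi_finite_support[OF K(2)] by simp
  ultimately show ?thesis using KH by (auto simp: right_invariants_def char_fun_def)
qed

text \<open>The left ideals of right invariant functions reverse inclusions, and the characteristic function of a finite
  subgroup \<open>K\<close> is invariant under exactly \<open>K\<close>. So the descending chain condition for left ideals gives a maximal
  finite normal subgroup.\<close>

lemma maximal_finite_normal_subgroup:
  assumes chain: "satisfies_chain Artinian {I. left_ideal I GA}" and ne: "\<one> \<noteq> \<zero>"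
  obtains N where "N \<lhd> H" "finite N" "\<And>M. M \<lhd> H \<Longrightarrow> finite M \<Longrightarrow> N \<subseteq> M \<Longrightarrow> M = N"
proof -
  let ?\<N> = "{N. N \<lhd> H \<and> finite N}"
  have sub: "subgroup N H" if "N \<in> ?\<N>" for N using that by (simp add: normal_imp_subgroup)
  have ideal: "left_ideal (right_invariants N) GA" if "N \<in> ?\<N>" for N
    by (rule right_invariants_left_ideal[OF subgroup.subset[OF sub[OF that]]])
  have "{\<one>\<^bsub>H\<^esub>} \<in> ?\<N>" using H.one_is_normal by simp
  then have mem: "right_invariants {\<one>\<^bsub>H\<^esub>} \<in> right_invariants ` ?\<N>" by blast
  have fam: "right_invariants ` ?\<N> \<subseteq> {I. left_ideal I GA}" using ideal by blast
  obtain I where I: "I \<in> right_invariants ` ?\<N>"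
    "\<forall>I'\<in>right_invariants ` ?\<N>. I' \<subseteq> I \<longrightarrow> I' = I"
    using satisfies_chain_Artinian_minimal[OF chain fam mem] by (rule bexE)
  then obtain N where N: "N \<in> ?\<N>" "I = right_invariants N" by auto
  show thesis
  proof (rule that)
    show "N \<lhd> H" "finite N" using N by auto
    fix M assume M: "M \<lhd> H" "finite M" "N \<subseteq> M"
    have "right_invariants M \<subseteq> right_invariants N" using M(3) by (auto simp: right_invariants_def)
    then have "right_invariants M = right_invariants N" using I(2) M(1,2) unfolding N(2) by (metis (mono_tags, lifting) image_eqI mem_Collect_eq)
    then have c: "char_fun R (carrier H) N \<in> right_invariants M"
      using indicator_right_invariant[OF sub[OF N(1)]] N(1) by auto
    have "m \<in> N" if m: "m \<in> M" for m
    proof -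
      have mH: "m \<in> carrier H" using m M(1) normal_imp_subgroup subgroup.subset by blast
      have "\<one>\<^bsub>H\<^esub> \<in> N" by (rule subgroup.one_closed[OF sub[OF N(1)]])
      moreover have "char_fun R (carrier H) N (\<one>\<^bsub>H\<^esub> \<circ>\<^sub>H m) = char_fun R (carrier H) N \<one>\<^bsub>H\<^esub>"
        using c m unfolding right_invariants_def by blast
      ultimately show ?thesis using mH ne by (simp add: char_fun_def split: if_splits)
    qed
    then show "M = N" using M(3) by blast
  qed
qed

text \<open>The difference of two functions, composed of a sum and a scalar multiple because the closure properties of left
  ideals and the linearity of convolution and pairing are available for these.\<close>

definition dif :: "('h \<Rightarrow> 'r) \<Rightarrow> ('h \<Rightarrow> 'r) \<Rightarrow> 'h \<Rightarrow> 'r"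
  where "dif a b = (\<lambda>g\<in>carrier H. a g \<oplus> (\<lambda>g\<in>carrier H. \<ominus> \<one> \<otimes> b g) g)"

lemma dif_left_ideal: "left_ideal I GA \<Longrightarrow> a \<in> I \<Longrightarrow> b \<in> I \<Longrightarrow> dif a b \<in> I"
  unfolding dif_def by (intro left_idealD(3,7)) auto

lemma dif_FS: "a \<in> FS \<Longrightarrow> b \<in> FS \<Longrightarrow> dif a b \<in> FS"
  unfolding dif_def by (intro FS_closed) auto

lemma dif_apply: "b \<in> FS \<Longrightarrow> g \<in> carrier H \<Longrightarrow> dif a b g = a g \<oplus> \<ominus> b g"
  using FS_fun[of b g] by (simp add: dif_def R.l_minus)

lemma dif_conv:
  assumes "a \<in> FS" "b \<in> FS" "l \<in> FS" shows "OG.conv (dif a b) l = dif (OG.conv a l) (OG.conv b l)"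
proof -
  have l: "l \<in> OG.fibre_finite" using assms OG.finite_support_fibre_finite by blast
  have b': "(\<lambda>g\<in>carrier H. \<ominus> \<one> \<otimes> b g) \<in> FS" using FS_closed(3)[of "\<ominus> \<one>" b] assms by simp
  show ?thesis
    using OG.conv_add_left[OF _ _ l, of a "\<lambda>g\<in>carrier H. \<ominus> \<one> \<otimes> b g"]
      OG.conv_smult_left[OF _ _ l, of "\<ominus> \<one>" b] FS_Fun[OF assms(1)] FS_Fun[OF assms(2)] FS_Fun[OF b']
    by (simp add: dif_def)
qed

lemma pairing_dif:
  assumes "a \<in> FS" "b \<in> FS" "\<And>g. g \<in> carrier H \<Longrightarrow> \<phi> g \<in> carrier R"
  shows "pairing (dif a b) \<phi> = pairing a \<phi> \<oplus> \<ominus> pairing b \<phi>"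
  unfolding dif_def
  using pairing_add[OF assms(1) FS_closed(3)[OF _ assms(2)] assms(3), of "\<ominus> \<one>"]
    pairing_smult[OF _ assms(2,3), of "\<ominus> \<one>"] pairing_closed[OF assms(2,3)] by (simp add: R.l_minus)

lemma conv_image_left_ideal:
  assumes X: "left_ideal X GA" and l: "l \<in> FS" shows "left_ideal {OG.conv a l | a. a \<in> X} GA"
proof (rule left_idealI)
  have XF: "a \<in> FS" if "a \<in> X" for a using left_idealD(1)[OF X] that by blast
  have lf: "l \<in> OG.fibre_finite" using l OG.finite_support_fibre_finite by blast
  interpret GA: nonunital_ring GA by (rule OG.nonunital_ring_finite_support)
  show "{OG.conv a l | a. a \<in> X} \<subseteq> FS" using XF l OG.conv_finite_support by auto
  show "(\<lambda>g\<in>carrier H. \<zero>) \<in> {OG.conv a l | a. a \<in> X}"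
    using GA.l_null[of l] l left_idealD(2)[OF X] by (auto intro!: exI[of _ "\<lambda>g\<in>carrier H. \<zero>"])
  show "(\<lambda>g\<in>carrier H. f g \<oplus> f' g) \<in> {OG.conv a l | a. a \<in> X}"
    if f: "f \<in> {OG.conv a l | a. a \<in> X}" "f' \<in> {OG.conv a l | a. a \<in> X}" for f f'
  proof -
    obtain a b where "a \<in> X" "b \<in> X" "f = OG.conv a l" "f' = OG.conv b l" using f by auto
    then have "(\<lambda>g\<in>carrier H. f g \<oplus> f' g) = OG.conv (\<lambda>g\<in>carrier H. a g \<oplus> b g) l"
      using OG.conv_add_left[OF _ _ lf, of a b] XF FS_Fun by simp
    then show ?thesis using left_idealD(3)[OF X] \<open>a \<in> X\<close> \<open>b \<in> X\<close> by blast
  qed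
  show "(\<lambda>g\<in>carrier H. r \<otimes> f g) \<in> {OG.conv a l | a. a \<in> X}"
    if r: "r \<in> carrier R" and f: "f \<in> {OG.conv a l | a. a \<in> X}" for r f
  proof -
    obtain a where "a \<in> X" "f = OG.conv a l" using f by auto
    then have "(\<lambda>g\<in>carrier H. r \<otimes> f g) = OG.conv (\<lambda>g\<in>carrier H. r \<otimes> a g) l"
      using OG.conv_smult_left[OF r _ lf, of a] XF FS_Fun by simp
    then show ?thesis using left_idealD(7)[OF X r] \<open>a \<in> X\<close> by blast
  qed
  show "translate h f \<in> {OG.conv a l | a. a \<in> X}"
    if h: "h \<in> carrier H" and f: "f \<in> {OG.conv a l | a. a \<in> X}" for h f
  proof -
    obtain a where a: "a \<in> X" "f = OG.conv a l" using f by auto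
    have "translate h f = OG.conv (\<delta> h) (OG.conv a l)"
      using \<delta>_conv[OF h OG.conv_finite_support[OF XF[OF a(1)] l]] a by simp
    also have "\<dots> = OG.conv (OG.conv (\<delta> h) a) l"
      using GA.m_assoc[of "\<delta> h" a l] \<delta>_FS XF[OF a(1)] l by simp
    also have "OG.conv (\<delta> h) a = translate h a" by (rule \<delta>_conv[OF h XF[OF a(1)]])
    finally show ?thesis using left_idealD(6)[OF X h a(1)] by blast
  qed
qed

text \<open>The elements that conjugate \<open>a\<close> into a given element form a coset of the centralizer of \<open>a\<close>, which is finite,
  and finitely many finite sets do not exhaust \<open>H\<close>.\<close>

lemma infinite_avoids_conjugates:
  assumes inf: "infinite (carrier H)"
    and A: "finite A" "A \<subseteq> carrier H" "\<And>a. a \<in> A \<Longrightarrow> finite {x \<in> carrier H. x \<circ>\<^sub>H a = a \<circ>\<^sub>H x}"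
    and W: "finite W"
  obtains x where "x \<in> carrier H" "\<And>a. a \<in> A \<Longrightarrow> hinv x \<circ>\<^sub>H hinv a \<circ>\<^sub>H x \<notin> W"
proof -
  have fin: "finite {x \<in> carrier H. hinv x \<circ>\<^sub>H hinv a \<circ>\<^sub>H x = w}" if a: "a \<in> A" for a w
  proof (cases "{x \<in> carrier H. hinv x \<circ>\<^sub>H hinv a \<circ>\<^sub>H x = w} = {}")
    case False
    then obtain x0 where x0: "x0 \<in> carrier H" "hinv x0 \<circ>\<^sub>H hinv a \<circ>\<^sub>H x0 = w" by blast
    have aH: "a \<in> carrier H" using a A by auto
    have "{x \<in> carrier H. hinv x \<circ>\<^sub>H hinv a \<circ>\<^sub>H x = w} \<subseteq> (\<lambda>c. c \<circ>\<^sub>H x0) ` {x \<in> carrier H. x \<circ>\<^sub>H a = a \<circ>\<^sub>H x}"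
    proof
      fix x assume "x \<in> {x \<in> carrier H. hinv x \<circ>\<^sub>H hinv a \<circ>\<^sub>H x = w}"
      then have x: "x \<in> carrier H" "hinv x \<circ>\<^sub>H hinv a \<circ>\<^sub>H x = w" by auto
      define c where "c = x \<circ>\<^sub>H hinv x0"
      have c: "c \<in> carrier H" "c \<circ>\<^sub>H x0 = x" using x x0 by (auto simp: c_def H.m_assoc)
      have conj: "z \<circ>\<^sub>H w = hinv a \<circ>\<^sub>H z" if "z \<in> carrier H" "hinv z \<circ>\<^sub>H hinv a \<circ>\<^sub>H z = w" for z
        using that(1) aH unfolding that(2)[symmetric] by (simp add: H.m_assoc[symmetric])
      have wH: "w \<in> carrier H" using x0(1) aH unfolding x0(2)[symmetric] by simp
      have "c \<circ>\<^sub>H hinv a \<circ>\<^sub>H x0 = c \<circ>\<^sub>H (x0 \<circ>\<^sub>H w)" using conj[OF x0] c x0(1) aH by (simp add: H.m_assoc)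
      also have "\<dots> = x \<circ>\<^sub>H w" using c x0(1) wH by (simp add: H.m_assoc[symmetric])
      also have "\<dots> = hinv a \<circ>\<^sub>H c \<circ>\<^sub>H x0" using conj[OF x] c x0(1) aH by (simp add: H.m_assoc)
      finally have comm: "c \<circ>\<^sub>H hinv a = hinv a \<circ>\<^sub>H c" using c x0 aH by simp
      have "c \<circ>\<^sub>H a = a \<circ>\<^sub>H (hinv a \<circ>\<^sub>H c) \<circ>\<^sub>H a" using c aH by (simp add: H.m_assoc[symmetric])
      also have "\<dots> = a \<circ>\<^sub>H c" using c aH by (simp add: comm[symmetric] H.m_assoc)
      finally have "c \<circ>\<^sub>H a = a \<circ>\<^sub>H c" .
      then show "x \<in> (\<lambda>c. c \<circ>\<^sub>H x0) ` {x \<in> carrier H. x \<circ>\<^sub>H a = a \<circ>\<^sub>H x}" using c by blast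
    qed
    then show ?thesis using A(3)[OF a] finite_surj by blast
  next
    case True
    show ?thesis by (subst True) simp
  qed
  define U where "U = (\<Union>a\<in>A. \<Union>w\<in>W. {x \<in> carrier H. hinv x \<circ>\<^sub>H hinv a \<circ>\<^sub>H x = w})"
  have "finite U" unfolding U_def using A(1) W fin by auto
  then have "\<not> carrier H \<subseteq> U" using inf finite_subset by metis
  then obtain x where x: "x \<in> carrier H" "x \<notin> U" by blast
  show thesis
  proof (rule that[OF x(1)])
    fix a assume a: "a \<in> A"
    show "hinv x \<circ>\<^sub>H hinv a \<circ>\<^sub>H x \<notin> W"
    proof
      assume "hinv x \<circ>\<^sub>H hinv a \<circ>\<^sub>H x \<in> W"
      then have "x \<in> U" unfolding U_def using a x(1) by blast
      then show False using x(2) by blast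
    qed
  qed
qed

text \<open>Choose \<open>x\<close> such that conjugation by it moves every \<open>h \<notin> N\<close> in the support of \<open>\<alpha>\<close> so far that
  \<open>h\<close> contributes nothing to \<open>(\<alpha> x \<beta>)(x y)\<close>. The terms with \<open>h \<in> N\<close> contribute \<open>\<alpha>(h) \<beta>(y)\<close>, as \<open>\<beta>\<close> is
  \<open>N\<close>-invariant on both sides. Hence the sum of \<open>\<alpha>\<close> over \<open>N\<close> annihilates \<open>\<beta>(y)\<close>. Right translates of \<open>\<alpha>\<close>
  annihilate \<open>L\<close> as well, which gives the same for the sum over any coset.\<close>

lemma annihilator_augmentation:
  assumes inf: "infinite (carrier H)" and N: "N \<lhd> H"
    and cent: "\<And>g. g \<in> carrier H \<Longrightarrow> g \<notin> N \<Longrightarrow> finite {x \<in> carrier H. x \<circ>\<^sub>H g = g \<circ>\<^sub>H x}"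
    and L: "left_ideal L GA" "L \<subseteq> right_invariants N" and \<beta>: "\<beta> \<in> L" and y: "y \<in> carrier H"
    and \<alpha>: "\<alpha> \<in> FS" and ann: "\<And>l. l \<in> L \<Longrightarrow> OG.conv \<alpha> l = (\<lambda>g\<in>carrier H. \<zero>)"
  shows "\<beta> y \<otimes> pairing \<alpha> (\<lambda>_. \<one>) = \<zero>"
proof -
  interpret GA: nonunital_ring GA by (rule OG.nonunital_ring_finite_support)
  interpret N: normal N H by (rule N)
  have LF: "l \<in> FS" if "l \<in> L" for l using L(1) left_idealD(1) that by blast
  have NH: "n \<in> carrier H" if "n \<in> N" for n using that N.subset by blast
  define ind where "ind g = (if g \<in> N then \<one> else \<zero>)" for g
  have indR: "ind g \<in> carrier R" for g by (simp add: ind_def)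
  have b: "\<beta> y \<in> carrier R" using FS_fun[OF LF[OF \<beta>] y] .
  have left_inv: "\<beta> (n \<circ>\<^sub>H y) = \<beta> y" if n: "n \<in> N" for n
  proof -
    have "hinv y \<circ>\<^sub>H n \<circ>\<^sub>H y \<in> N" by (rule N.inv_op_closed1[OF y n])
    moreover have "y \<circ>\<^sub>H (hinv y \<circ>\<^sub>H n \<circ>\<^sub>H y) = n \<circ>\<^sub>H y" using y NH[OF n] by (simp add: H.m_assoc[symmetric])
    ultimately show ?thesis using L(2) \<beta> y unfolding right_invariants_def by force
  qed
  have base: "\<beta> y \<otimes> pairing a ind = \<zero>"
    if a: "a \<in> FS" "\<And>l. l \<in> L \<Longrightarrow> OG.conv a l = (\<lambda>g\<in>carrier H. \<zero>)" for a
  proof -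
    let ?Y = "{g \<in> carrier H. a g \<noteq> \<zero>}"
    have Y: "finite ?Y" using FS_finite[OF a(1)] .
    define W where "W = (\<lambda>w. w \<circ>\<^sub>H hinv y) ` {g \<in> carrier H. \<beta> g \<noteq> \<zero>}"
    have "finite W" unfolding W_def using FS_finite[OF LF[OF \<beta>]] by simp
    then obtain x where x: "x \<in> carrier H" "\<And>h. h \<in> ?Y - N \<Longrightarrow> hinv x \<circ>\<^sub>H hinv h \<circ>\<^sub>H x \<notin> W"
      using infinite_avoids_conjugates[OF inf, of "?Y - N" W] Y cent by auto
    have val: "translate x \<beta> (hinv h \<circ>\<^sub>H (x \<circ>\<^sub>H y)) = ind h \<otimes> \<beta> y" if h: "h \<in> ?Y" for h
    proof -
      have hH: "h \<in> carrier H" using h by simp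
      define c where "c = hinv x \<circ>\<^sub>H hinv h \<circ>\<^sub>H x"
      have c: "c \<in> carrier H" using x hH by (simp add: c_def)
      have "translate x \<beta> (hinv h \<circ>\<^sub>H (x \<circ>\<^sub>H y)) = \<beta> (c \<circ>\<^sub>H y)"
        using x hH y by (simp add: translate_def c_def H.m_assoc)
      also have "\<dots> = ind h \<otimes> \<beta> y"
      proof (cases "h \<in> N")
        case True
        then have "c \<in> N" unfolding c_def using x by (intro N.inv_op_closed1) auto
        then show ?thesis using left_inv True b by (simp add: ind_def)
      next
        case False
        then have "c \<notin> W" using x(2) h by (simp add: c_def)
        have "\<beta> (c \<circ>\<^sub>H y) = \<zero>"
        proof (rule ccontr)
          assume "\<beta> (c \<circ>\<^sub>H y) \<noteq> \<zero>"
          moreover have "c = (c \<circ>\<^sub>H y) \<circ>\<^sub>H hinv y" using c y by (simp add: H.m_assoc)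
          ultimately have "c \<in> W" unfolding W_def using c y by blast
          then show False using \<open>c \<notin> W\<close> by blast
        qed
        then show ?thesis using False b by (simp add: ind_def)
      qed
      finally show ?thesis .
    qed
    have tr: "translate x \<beta> \<in> L" by (rule left_idealD(6)[OF L(1) x(1) \<beta>])
    have "\<zero> = OG.conv a (translate x \<beta>) (x \<circ>\<^sub>H y)" using a(2)[OF tr] x y by simp
    also have "\<dots> = (\<Oplus>h\<in>?Y. a h \<otimes> translate x \<beta> (hinv h \<circ>\<^sub>H (x \<circ>\<^sub>H y)))"
      by (rule conv_left_form[OF a(1) LF[OF tr]]) (use x y Y in auto)
    also have "\<dots> = (\<Oplus>h\<in>?Y. a h \<otimes> ind h \<otimes> \<beta> y)"
      by (rule R.finsum_cong'[OF refl]) (use val FS_fun[OF a(1)] b indR in \<open>auto simp: R.m_assoc\<close>)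
    also have "\<dots> = pairing a ind \<otimes> \<beta> y"
      unfolding pairing_def by (rule R.finsum_ldistr[symmetric, OF Y b]) (use FS_fun[OF a(1)] indR in auto)
    finally show ?thesis using R.m_comm[OF b pairing_closed[OF a(1) indR]] by simp
  qed
  have shifted: "\<beta> y \<otimes> pairing \<alpha> (\<lambda>k. ind (k \<circ>\<^sub>H g)) = \<zero>" if g: "g \<in> carrier H" for g
  proof -
    have "OG.conv (OG.conv \<alpha> (\<delta> g)) l = (\<lambda>g\<in>carrier H. \<zero>)" if l: "l \<in> L" for l
    proof -
      have "OG.conv (OG.conv \<alpha> (\<delta> g)) l = OG.conv \<alpha> (OG.conv (\<delta> g) l)"
        using GA.m_assoc[of \<alpha> "\<delta> g" l] \<alpha> \<delta>_FS LF[OF l] by simp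
      also have "OG.conv (\<delta> g) l = translate g l" by (rule \<delta>_conv[OF g LF[OF l]])
      finally show ?thesis using ann[OF left_idealD(6)[OF L(1) g l]] by (rule trans)
    qed
    then have "\<beta> y \<otimes> pairing (OG.conv \<alpha> (\<delta> g)) ind = \<zero>"
      using base OG.conv_finite_support[OF \<alpha> \<delta>_FS] by blast
    then show ?thesis using pairing_conv_\<delta>[OF g \<alpha>, of ind] indR by simp
  qed
  let ?Y = "{g \<in> carrier H. \<alpha> g \<noteq> \<zero>}"
  have Y: "finite ?Y" using FS_finite[OF \<alpha>] .
  define coset where "coset k = N #>\<^bsub>H\<^esub> k" for k
  have coset_eq: "coset k = coset c \<longleftrightarrow> k \<circ>\<^sub>H hinv c \<in> N" if "k \<in> carrier H" "c \<in> carrier H" for k c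
  proof
    assume "coset k = coset c"
    then have "k \<in> N #>\<^bsub>H\<^esub> c" using H.rcos_self[OF that(1) N.subgroup_axioms] by (simp add: coset_def)
    then obtain n where "n \<in> N" "k = n \<circ>\<^sub>H c" by (auto simp: r_coset_def)
    then show "k \<circ>\<^sub>H hinv c \<in> N" using that NH by (simp add: H.m_assoc)
  next
    assume k: "k \<circ>\<^sub>H hinv c \<in> N"
    have "k = (k \<circ>\<^sub>H hinv c) \<circ>\<^sub>H c" using that by (simp add: H.m_assoc)
    then have "k \<in> N #>\<^bsub>H\<^esub> c" using k by (auto simp: r_coset_def)
    then show "coset k = coset c" using H.repr_independence[OF _ that(2) N.subgroup_axioms, of k] by (simp add: coset_def)
  qed
  have c\<alpha>: "\<alpha> k \<in> carrier R" if "k \<in> carrier H" for k using FS_fun[OF \<alpha> that] .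
  have "pairing \<alpha> (\<lambda>_. \<one>) = (\<Oplus>k\<in>?Y. \<alpha> k)"
    unfolding pairing_def by (rule R.finsum_cong'[OF refl]) (use c\<alpha> in auto)
  also have "?Y = (\<Union>C\<in>coset ` ?Y. {k \<in> ?Y. coset k = C})" by auto
  also have "(\<Oplus>k\<in>\<dots>. \<alpha> k) = (\<Oplus>C\<in>coset ` ?Y. \<Oplus>k\<in>{k \<in> ?Y. coset k = C}. \<alpha> k)"
  proof (rule R.add.finprod_UN_disjoint)
    show "finite (coset ` ?Y)" using Y by simp
    show "finite {k \<in> ?Y. coset k = C}" for C by (rule finite_subset[OF _ Y]) auto
    show "pairwise (\<lambda>C D. disjnt {k \<in> ?Y. coset k = C} {k \<in> ?Y. coset k = D}) (coset ` ?Y)"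
      by (auto simp: pairwise_def disjnt_def)
  qed (use c\<alpha> in auto)
  finally have eps: "pairing \<alpha> (\<lambda>_. \<one>) = (\<Oplus>C\<in>coset ` ?Y. \<Oplus>k\<in>{k \<in> ?Y. coset k = C}. \<alpha> k)" .
  have kill: "\<beta> y \<otimes> (\<Oplus>k\<in>{k \<in> ?Y. coset k = C}. \<alpha> k) = \<zero>" if C: "C \<in> coset ` ?Y" for C
  proof -
    obtain c where c: "c \<in> carrier H" "C = coset c" using C by auto
    have "(\<Oplus>k\<in>{k \<in> ?Y. coset k = C}. \<alpha> k) = (\<Oplus>k\<in>?Y. \<alpha> k \<otimes> ind (k \<circ>\<^sub>H hinv c))"
      by (rule R.add.finprod_mono_neutral_cong_left)
        (use Y c\<alpha> c coset_eq in \<open>auto simp: ind_def\<close>)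
    also have "\<dots> = pairing \<alpha> (\<lambda>k. ind (k \<circ>\<^sub>H hinv c))" by (simp add: pairing_def)
    finally show ?thesis using shifted[of "hinv c"] c by simp
  qed
  have cl: "(\<Oplus>k\<in>{k \<in> ?Y. coset k = C}. \<alpha> k) \<in> carrier R" for C
    by (rule R.finsum_closed) (use c\<alpha> in auto)
  have "\<beta> y \<otimes> pairing \<alpha> (\<lambda>_. \<one>) = (\<Oplus>C\<in>coset ` ?Y. \<beta> y \<otimes> (\<Oplus>k\<in>{k \<in> ?Y. coset k = C}. \<alpha> k))"
    unfolding eps by (rule R.finsum_rdistr[OF _ b]) (use Y cl in auto)
  also have "\<dots> = (\<Oplus>C\<in>coset ` ?Y. \<zero>)"
    by (rule R.finsum_cong'[OF refl]) (use kill in auto)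
  finally show ?thesis by (simp add: R.finsum_zero)
qed

text \<open>Instead of listing finitely many elements of \<open>L\<close>, the proof takes a left ideal \<open>X\<close> that is minimal among those
  with \<open>W + X = R H\<close>. For \<open>l \<in> L\<close> with \<open>X l \<noteq> 0\<close> one has \<open>X l = L\<close> and even \<open>(W \<inter> X) l = L\<close>, so the elements of
  \<open>X\<close> that annihilate \<open>l\<close> still form a supplement of \<open>W\<close>. By minimality \<open>X\<close> annihilates \<open>L\<close>, hence \<open>X \<subseteq> W\<close>,
  although \<open>W\<close> does not contain the identity.\<close>

lemma artinian_not_quasifinite:
  assumes chain: "satisfies_chain Artinian {I. left_ideal I GA}" and ne: "\<one> \<noteq> \<zero>"
    and inf: "infinite (carrier H)"
    and proper: "\<And>K. subgroup K H \<Longrightarrow> infinite K \<Longrightarrow> K = carrier H"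
  shows False
proof -
  let ?zero = "\<lambda>g\<in>carrier H. \<zero>"
  obtain N where N: "N \<lhd> H" "finite N" "\<And>M. M \<lhd> H \<Longrightarrow> finite M \<Longrightarrow> N \<subseteq> M \<Longrightarrow> M = N"
    by (rule maximal_finite_normal_subgroup[OF chain ne]) blast
  have cent: "finite {x \<in> carrier H. x \<circ>\<^sub>H g = g \<circ>\<^sub>H x}" if "g \<in> carrier H" "g \<notin> N" for g
    by (rule H.finite_centralizer_if_proper_finite[OF proper N that])
  have Nsub: "subgroup N H" using N(1) by (rule normal_imp_subgroup)
  have NH: "N \<subseteq> carrier H" by (rule subgroup.subset[OF Nsub])
  define \<L> where "\<L> = {L. left_ideal L GA \<and> L \<subseteq> right_invariants N \<and> (\<exists>l\<in>L. l \<noteq> ?zero)}"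
  have "right_invariants N \<in> \<L>"
  proof -
    have "char_fun R (carrier H) N \<one>\<^bsub>H\<^esub> = \<one>" using subgroup.one_closed[OF Nsub] by (simp add: char_fun_def)
    then have "char_fun R (carrier H) N \<noteq> ?zero" using ne by (metis H.one_closed restrict_apply')
    then show ?thesis
      unfolding \<L>_def using right_invariants_left_ideal[OF NH] indicator_right_invariant[OF Nsub N(2)] by blast
  qed
  moreover have "\<L> \<subseteq> {I. left_ideal I GA}" by (auto simp: \<L>_def)
  ultimately obtain L where L\<L>: "L \<in> \<L>" and Lmin: "\<forall>L'\<in>\<L>. L' \<subseteq> L \<longrightarrow> L' = L"
    using satisfies_chain_Artinian_minimal[OF chain] by metis
  have L: "left_ideal L GA" "L \<subseteq> right_invariants N" using L\<L> by (auto simp: \<L>_def)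
  have LF: "l \<in> FS" if "l \<in> L" for l using left_idealD(1)[OF L(1)] that by blast
  have simple: "L' = L" if "left_ideal L' GA" "L' \<subseteq> L" "l \<in> L'" "l \<noteq> ?zero" for L' l
    using Lmin that L(2) by (auto simp: \<L>_def)
  obtain \<beta> where \<beta>: "\<beta> \<in> L" "\<beta> \<noteq> ?zero" using L\<L> by (auto simp: \<L>_def)
  have "\<exists>y\<in>carrier H. \<beta> y \<noteq> \<zero>"
  proof (rule ccontr)
    assume "\<not> ?thesis"
    then have "\<beta> = ?zero" by (intro FS_eqI[OF LF[OF \<beta>(1)] FS_closed(1)]) simp
    then show False using \<beta>(2) by blast
  qed
  then obtain y where y: "y \<in> carrier H" "\<beta> y \<noteq> \<zero>" by blast
  define b where "b = \<beta> y"
  have b: "b \<in> carrier R" "b \<noteq> \<zero>" using FS_fun[OF LF[OF \<beta>(1)] y(1)] y(2) by (auto simp: b_def)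
  define \<epsilon> where "\<epsilon> f = pairing f (\<lambda>_. \<one>)" for f
  have \<epsilon>R: "\<epsilon> f \<in> carrier R" if "f \<in> FS" for f unfolding \<epsilon>_def by (rule pairing_closed[OF that]) simp
  have \<epsilon>_translate: "\<epsilon> (translate h f) = \<epsilon> f" if "h \<in> carrier H" "f \<in> FS" for h f
    using pairing_translate[OF that, of "\<lambda>_. \<one>"] by (simp add: \<epsilon>_def)
  have \<epsilon>_add: "\<epsilon> (\<lambda>g\<in>carrier H. f g \<oplus> f' g) = \<epsilon> f \<oplus> \<epsilon> f'" if "f \<in> FS" "f' \<in> FS" for f f'
    using pairing_add[OF that, of "\<lambda>_. \<one>"] by (simp add: \<epsilon>_def)
  have \<epsilon>_smult: "\<epsilon> (\<lambda>g\<in>carrier H. r \<otimes> f g) = r \<otimes> \<epsilon> f" if "r \<in> carrier R" "f \<in> FS" for r f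
    using pairing_smult[OF that, of "\<lambda>_. \<one>"] by (simp add: \<epsilon>_def)
  define W where "W = {f \<in> FS. b \<otimes> \<epsilon> f = \<zero>}"
  have WF: "w \<in> FS" if "w \<in> W" for w using that by (simp add: W_def)
  have W: "left_ideal W GA"
  proof (rule left_idealI)
    show "W \<subseteq> FS" by (auto simp: W_def)
    show "?zero \<in> W" using FS_closed(1) pairing_zero b by (simp add: W_def \<epsilon>_def)
    show "(\<lambda>g\<in>carrier H. f g \<oplus> f' g) \<in> W" if "f \<in> W" "f' \<in> W" for f f'
      using that FS_closed(2) \<epsilon>_add \<epsilon>R b by (simp add: W_def R.r_distr)
    show "(\<lambda>g\<in>carrier H. r \<otimes> f g) \<in> W" if "r \<in> carrier R" "f \<in> W" for r f
      using that FS_closed(3) \<epsilon>_smult R.m_lcomm[OF b(1) that(1) \<epsilon>R[of f]] by (simp add: W_def)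
    show "translate h f \<in> W" if "h \<in> carrier H" "f \<in> W" for h f
      using that translate_FS \<epsilon>_translate by (simp add: W_def)
  qed
  \<comment> \<open>A function fixed by all translations is constant, hence has infinite support unless it vanishes.\<close>
  obtain h0 l0 where moved: "h0 \<in> carrier H" "l0 \<in> L" "dif (translate h0 l0) l0 \<noteq> ?zero"
  proof -
    have "\<exists>h\<in>carrier H. dif (translate h \<beta>) \<beta> \<noteq> ?zero"
    proof (rule ccontr)
      assume neg: "\<not> ?thesis"
      have const: "\<beta> g = \<beta> y" if g: "g \<in> carrier H" for g
      proof -
        define h where "h = y \<circ>\<^sub>H hinv g"
        have h: "h \<in> carrier H" "hinv h \<circ>\<^sub>H y = g" using g y by (auto simp: h_def H.inv_mult_group H.m_assoc)
        have "dif (translate h \<beta>) \<beta> y = \<zero>" using neg h(1) y(1) by simp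
        then have "translate h \<beta> y \<oplus> \<ominus> \<beta> y = \<zero>" using dif_apply[OF LF[OF \<beta>(1)] y(1)] by simp
        moreover have "translate h \<beta> y = \<beta> g" using h y by (simp add: translate_def)
        ultimately have "\<beta> g \<oplus> \<ominus> \<beta> y = \<zero>" by simp
        then show ?thesis
          using FS_fun[OF LF[OF \<beta>(1)]] g y(1) by (metis R.a_inv_closed R.minus_equality R.minus_minus)
      qed
      have "{g \<in> carrier H. \<beta> g \<noteq> \<zero>} = carrier H" using const y(2) by auto
      then show False using FS_finite[OF LF[OF \<beta>(1)]] inf by simp
    qed
    then show thesis using that \<beta>(1) by blast
  qed
  define \<X> where "\<X> = {X. left_ideal X GA \<and> (\<forall>a\<in>FS. \<exists>w\<in>W. dif a w \<in> X)}"
  have FSideal: "left_ideal FS GA"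
    by (rule left_idealI) (use FS_closed translate_FS in auto)
  have "FS \<in> \<X>" using FSideal dif_FS left_idealD(2)[OF W] WF by (auto simp: \<X>_def)
  moreover have "\<X> \<subseteq> {I. left_ideal I GA}" by (auto simp: \<X>_def)
  ultimately obtain X where X\<X>: "X \<in> \<X>" and Xmin: "\<forall>X'\<in>\<X>. X' \<subseteq> X \<longrightarrow> X' = X"
    using satisfies_chain_Artinian_minimal[OF chain] by metis
  have X: "left_ideal X GA" using X\<X> by (simp add: \<X>_def)
  have XF: "a \<in> FS" if "a \<in> X" for a using left_idealD(1)[OF X] that by blast
  have dif_self: "dif a a' = ?zero" if "a = a'" "a' \<in> FS" for a a'
    by (rule FS_eqI[OF dif_FS FS_closed(1)]) (use that dif_apply FS_fun in \<open>auto simp: R.r_neg\<close>)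
  interpret GA: nonunital_ring GA by (rule OG.nonunital_ring_finite_support)
  have annihilates: "OG.conv a l = ?zero" if l: "l \<in> L" and a: "a \<in> X" for l a
  proof (rule ccontr)
    assume nz: "OG.conv a l \<noteq> ?zero"
    have lF: "l \<in> FS" using LF[OF l] .
    have inL: "{OG.conv a l | a. a \<in> Z} \<subseteq> L" if "Z \<subseteq> FS" for Z
      using left_idealD(5)[OF L(1) _ l] that by blast
    have XL: "{OG.conv a l | a. a \<in> X} = L"
      by (rule simple[OF conv_image_left_ideal[OF X lF] inL _ nz]) (use a XF in auto)
    then obtain a0 where a0: "a0 \<in> X" "l0 = OG.conv a0 l" using moved(2) by blast
    \<comment> \<open>A translate minus the original has augmentation zero, so \<open>d\<close> lies in \<open>W\<close> and witnesses \<open>(W \<inter> X) l \<noteq> 0\<close>.\<close>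
    define d where "d = dif (translate h0 a0) a0"
    have trX: "translate h0 a0 \<in> X" by (rule left_idealD(6)[OF X moved(1) a0(1)])
    have dX: "d \<in> X" unfolding d_def by (rule dif_left_ideal[OF X trX a0(1)])
    have dF: "d \<in> FS" using XF[OF dX] .
    have "\<epsilon> d = \<epsilon> (translate h0 a0) \<oplus> \<ominus> \<epsilon> a0"
      unfolding \<epsilon>_def d_def by (rule pairing_dif) (use XF trX a0 in auto)
    then have "\<epsilon> d = \<zero>" using \<epsilon>_translate[OF moved(1) XF[OF a0(1)]] \<epsilon>R[OF XF[OF a0(1)]] by (simp add: R.r_neg)
    then have dW: "d \<in> W" using dF b by (simp add: W_def)
    have "OG.conv d l = dif (OG.conv (translate h0 a0) l) (OG.conv a0 l)"
      unfolding d_def by (rule dif_conv) (use XF trX a0 lF in auto)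
    also have "OG.conv (translate h0 a0) l = OG.conv (OG.conv (\<delta> h0) a0) l"
      using \<delta>_conv[OF moved(1) XF[OF a0(1)]] by simp
    also have "\<dots> = OG.conv (\<delta> h0) l0"
      using GA.m_assoc[of "\<delta> h0" a0 l] \<delta>_FS XF[OF a0(1)] lF a0(2) by simp
    also have "\<dots> = translate h0 l0" by (rule \<delta>_conv[OF moved(1) LF[OF moved(2)]])
    finally have dl: "OG.conv d l \<noteq> ?zero" using moved(3) a0(2) by simp
    have WX: "left_ideal (W \<inter> X) GA"
      by (rule left_idealI)
        (use left_idealD[OF W] left_idealD[OF X] in \<open>auto\<close>)
    have WXL: "{OG.conv w l | w. w \<in> W \<inter> X} = L"
      by (rule simple[OF conv_image_left_ideal[OF WX lF] inL _ dl]) (use dW dX WF in auto)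
    define X' where "X' = {a \<in> X. OG.conv a l = ?zero}"
    have lf: "l \<in> OG.fibre_finite" using lF OG.finite_support_fibre_finite by blast
    have X': "left_ideal X' GA"
    proof (rule left_idealI)
      show "X' \<subseteq> FS" using XF by (auto simp: X'_def)
      show "?zero \<in> X'" using left_idealD(2)[OF X] GA.l_null[of l] lF by (simp add: X'_def)
      show "(\<lambda>g\<in>carrier H. f g \<oplus> f' g) \<in> X'" if "f \<in> X'" "f' \<in> X'" for f f'
        using that left_idealD(3)[OF X] OG.conv_add_left[OF _ _ lf, of f f'] XF FS_Fun
        by (auto simp: X'_def cong: restrict_cong)
      show "(\<lambda>g\<in>carrier H. r \<otimes> f g) \<in> X'" if "r \<in> carrier R" "f \<in> X'" for r f
        using that left_idealD(7)[OF X] OG.conv_smult_left[OF _ _ lf, of r f] XF FS_Fun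
        by (auto simp: X'_def cong: restrict_cong)
      show "translate h f \<in> X'" if h: "h \<in> carrier H" and f: "f \<in> X'" for h f
      proof -
        have fF: "f \<in> FS" using f XF by (auto simp: X'_def)
        have "OG.conv (translate h f) l = OG.conv (\<delta> h) (OG.conv f l)"
          using GA.m_assoc[of "\<delta> h" f l] \<delta>_FS fF lF \<delta>_conv[OF h fF] by simp
        also have "\<dots> = ?zero" using f GA.r_null[of "\<delta> h"] \<delta>_FS by (simp add: X'_def)
        finally show ?thesis using left_idealD(6)[OF X h] f by (simp add: X'_def)
      qed
    qed
    have "\<exists>w\<in>W. dif f w \<in> X'" if f: "f \<in> FS" for f
    proof -
      obtain w0 where w0: "w0 \<in> W" "dif f w0 \<in> X" using X\<X> f by (auto simp: \<X>_def)
      define a1 where "a1 = dif f w0"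
      have a1: "a1 \<in> X" "a1 \<in> FS" using w0 XF by (auto simp: a1_def)
      have "OG.conv a1 l \<in> L" by (rule left_idealD(5)[OF L(1) a1(2) l])
      then obtain w1 where w1: "w1 \<in> W" "w1 \<in> X" "OG.conv a1 l = OG.conv w1 l" using WXL by blast
      define w where "w = (\<lambda>g\<in>carrier H. w0 g \<oplus> w1 g)"
      have w: "w \<in> W" unfolding w_def by (rule left_idealD(3)[OF W w0(1) w1(1)])
      have "dif f w = dif a1 w1"
      proof (rule FS_eqI[OF dif_FS[OF f WF[OF w]] dif_FS[OF a1(2) WF[OF w1(1)]]])
        fix g assume g: "g \<in> carrier H"
        have "f g \<in> carrier R" "w0 g \<in> carrier R" "w1 g \<in> carrier R"
          using FS_fun f WF w0(1) w1(1) g by auto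
        then show "dif f w g = dif a1 w1 g"
          using g dif_apply[OF WF[OF w] g, of f] dif_apply[OF WF[OF w1(1)] g, of a1] dif_apply[OF WF[OF w0(1)] g, of f]
          by (simp add: w_def a1_def R.minus_add R.a_assoc)
      qed
      moreover have "OG.conv (dif a1 w1) l = ?zero"
        using dif_conv[OF a1(2) WF[OF w1(1)] lF] dif_self[OF w1(3) OG.conv_finite_support[OF WF[OF w1(1)] lF]] by simp
      moreover have "dif a1 w1 \<in> X" by (rule dif_left_ideal[OF X a1(1) w1(2)])
      ultimately have "dif f w \<in> X'" by (simp add: X'_def)
      then show ?thesis using w by blast
    qed
    then have "X' \<in> \<X>" using X' by (simp add: \<X>_def)
    then have "X' = X" using Xmin by (auto simp: X'_def)
    then show False using a nz by (auto simp: X'_def)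
  qed
  obtain w where w: "w \<in> W" "dif (\<delta> \<one>\<^bsub>H\<^esub>) w \<in> X" using X\<X> \<delta>_FS by (auto simp: \<X>_def)
  define \<alpha> where "\<alpha> = dif (\<delta> \<one>\<^bsub>H\<^esub>) w"
  have \<alpha>F: "\<alpha> \<in> FS" using XF[OF w(2)] by (simp add: \<alpha>_def)
  have "OG.conv \<alpha> l = ?zero" if "l \<in> L" for l using annihilates[OF that w(2)] by (simp add: \<alpha>_def)
  then have "b \<otimes> \<epsilon> \<alpha> = \<zero>"
    unfolding b_def \<epsilon>_def by (intro annihilator_augmentation[OF inf N(1) cent L \<beta>(1) y(1) \<alpha>F])
  moreover have "\<epsilon> \<alpha> = \<epsilon> (\<delta> \<one>\<^bsub>H\<^esub>) \<oplus> \<ominus> \<epsilon> w"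
    unfolding \<epsilon>_def \<alpha>_def by (rule pairing_dif[OF \<delta>_FS WF[OF w(1)]]) simp
  moreover have "\<epsilon> (\<delta> \<one>\<^bsub>H\<^esub>) = \<one>" unfolding \<epsilon>_def by (rule pairing_\<delta>) auto
  moreover have "b \<otimes> \<epsilon> w = \<zero>" using w(1) by (simp add: W_def)
  ultimately show False using b \<epsilon>R[OF WF[OF w(1)]] by (simp add: R.r_distr R.r_minus)
qed

theorem finite_if_artinian_group_ring:
  assumes chain: "satisfies_chain Artinian {I. left_ideal I GA}" and ne: "\<one> \<noteq> \<zero>"
  shows "finite (carrier H)"
proof (rule ccontr)
  assume inf: "infinite (carrier H)"
  obtain K where K: "subgroup K H" "infinite K" "\<And>K'. subgroup K' H \<Longrightarrow> infinite K' \<Longrightarrow> K' \<subseteq> K \<Longrightarrow> K' = K"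
    by (rule minimal_infinite_subgroup[OF chain ne inf]) blast
  interpret K: group_coefficients R "H\<lparr>carrier := K\<rparr>"
    by (intro group_coefficients.intro R.cring_axioms subgroup.subgroup_is_group[OF K(1)] H.group_axioms)
  show False
  proof (rule K.artinian_not_quasifinite[OF chain_subgroup[OF chain K(1)] ne])
    show "infinite (carrier (H\<lparr>carrier := K\<rparr>))" using K(2) by simp
    fix K' assume K': "subgroup K' (H\<lparr>carrier := K\<rparr>)" "infinite K'"
    have "subgroup K' H" by (rule H.incl_subgroup[OF K(1) K'(1)])
    moreover have "K' \<subseteq> K" using subgroup.subset[OF K'(1)] by simp
    ultimately show "K' = carrier (H\<lparr>carrier := K\<rparr>)" using K(3) K'(2) by simp
  qed
qed

end

section \<open>The equivalence\<close>

theorem theorem5p1: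
  fixes R :: "('r, 'm) ring_scheme" and G :: "'g groupoid" and T :: "'g topology"
    and J :: "'j set" and x :: "'j \<Rightarrow> 'g" and c :: chain_condition and s :: side
  assumes "cring R" and "\<one>\<^bsub>R\<^esub> \<noteq> \<zero>\<^bsub>R\<^esub>" and "ample_groupoid G T"
    and "orbit_representatives G J x"
  shows "(categorically_chain c s (groupoid_algebra R G T) \<longleftrightarrow>
          locally_chain c s (groupoid_algebra R G T)) \<and>
         (locally_chain c s (groupoid_algebra R G T) \<longleftrightarrow>
          T = discrete_topology (arrows G) \<and>
          (\<forall>y\<in>unit_arrows G. chain_ring c s (group_ring R (isotropy_group G y)))) \<and>
         (T = discrete_topology (arrows G) \<and>
          (\<forall>y\<in>unit_arrows G. chain_ring c s (group_ring R (isotropy_group G y))) \<longleftrightarrow>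
          rng_isomorphic (groupoid_algebra R G T)
            (direct_sum_ring J (\<lambda>\<alpha>. matrix_ring (groupoid_orbit G (x \<alpha>))
              (group_ring R (isotropy_group G (x \<alpha>))))) \<and>
          (\<forall>\<alpha>\<in>J. chain_ring c s (group_ring R (isotropy_group G (x \<alpha>))))) \<and>
         ((\<forall>\<alpha>\<in>J. chain_ring Artinian s (group_ring R (isotropy_group G (x \<alpha>)))) \<longrightarrow>
          (\<forall>\<alpha>\<in>J. finite (carrier (isotropy_group G (x \<alpha>))) \<and> chain_ring Artinian s R))"
proof -
  interpret ample_coefficients R G T
    using assms by (intro ample_coefficients.intro)
  interpret orbit_coefficients R G J x
    by (intro orbit_coefficients.intro groupoid_coefficients_axioms orbit_coefficients_axioms.intro assms(4))
  let ?A = "groupoid_algebra R G T" and ?D = "conv_ring finite_support"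
  let ?cat = "categorically_chain c s ?A" and ?loc = "locally_chain c s ?A"
  let ?iso = "T = discrete_topology (arrows G) \<and> (\<forall>y\<in>unit_arrows G. chain_ring c s (group_ring R (isotropy_group G y)))"
  let ?mat = "rng_isomorphic ?A MatSum \<and> (\<forall>\<alpha>\<in>J. chain_ring c s (IsoRing \<alpha>))"
  have cat_loc: "?cat \<Longrightarrow> ?loc"
    by (rule categorically_chain_imp_locally_chain[OF nonunital_ring_groupoid_algebra])
  have loc_iso: "?iso" if ?loc
    using discrete_if_locally_chain[OF assms(2) that] isotropy_chain_if_locally_chain[OF _ that] by blast
  have iso_mat: "?mat" if ?iso
  proof -
    have "?A = ?D" using groupoid_algebra_eq Alg_discrete[OF conjunct1[OF that]] by metis
    then show ?thesis using that finite_support_isomorphic_matrices rep_unit by metis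
  qed
  have mat_cat: "?cat" if ?mat
  proof -
    have "categorically_chain c s ?D"
    proof (rule finite_support_categorically_chain)
      show "x ` J \<subseteq> unit_arrows G" using rep_unit by auto
      show "\<exists>g\<in>arrows G. src G g \<in> x ` J \<and> tgt G g = y" if "y \<in> unit_arrows G" for y
        using path[OF index(2)[OF that]] index(1)[OF that] by blast
      show "chain_ring c s (group_ring R (isotropy_group G z))" if "z \<in> x ` J" for z
        using that \<open>?mat\<close> by auto
    qed
    moreover have "rng_isomorphic ?D ?A"
    proof -
      have "rng_isomorphic MatSum ?A"
        by (rule nonunital_ring.rng_isomorphic_sym[OF nonunital_ring_groupoid_algebra]) (use that in blast)
      then show ?thesis by (rule rng_isomorphic_trans[OF finite_support_isomorphic_matrices])
    qed
    ultimately show ?thesis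
      using categorically_chain_isomorphic nonunital_ring_finite_support by blast
  qed
  have connell: "finite (carrier (Iso \<alpha>)) \<and> chain_ring Artinian s R"
    if "\<alpha> \<in> J" "chain_ring Artinian s (IsoRing \<alpha>)" for \<alpha>
  proof -
    interpret I: group_coefficients R "Iso \<alpha>" by (rule isotropy_group_coefficients[OF rep_unit[OF that(1)]])
    have "satisfies_chain Artinian {I. left_ideal I I.GA}" by (rule I.chain_group_ring_left[OF that(2)])
    then show ?thesis using I.finite_if_artinian_group_ring I.chain_coefficients assms(2) by blast
  qed
  show ?thesis using cat_loc loc_iso iso_mat mat_cat connell by blast
qed

end
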